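(* Let $\omega$ be an environment, let $(X_n)_{n\ge 0}$ be the associated walk, and let $\beta:\mathbb{Z}_+\to(1,\infty)$ satisfy $\beta_*:=\inf_{x\in\mathbb{Z}_+}\beta(x)>2$. Assume $A_x<\infty$ for all $x\in\mathbb{Z}_+$, and that the following hold for some $\varepsilon>0$ and some $\eta$ with $0\le\eta<\min\{\frac12,\frac{\beta_*-2}{2}\}$: (B1) there exist $\mu>1$ and $\sigma^2>0$ such that $\frac1x\sum_{w=0}^{x-1}m_w=\mu+\theta_1(x)$ and $\frac1x\sigma_x^2=\sigma^2+\theta_2(x)$, where $\theta_i(x)=o(x^{-\eta}(\log x)^{-1/2})$ as $x\to\infty$ for $i=1,2$; (B2) $A_x=O(x^\eta)$ and $x^{-1}\sum_{w=0}^{x-1}B_w^{3+\varepsilon}=O(1)$, where $B_w=A'_w$ if $\beta_*\in(2,3]$ and $B_w=A_w$ if $\beta_*>3$; (B3) for all $u>0$, $L(x;u)=o(x^{1/2-\eta})$ as $x\to\infty$; (B4) the quantity $$K_x=\sup_{n\ge2}\frac{\omega^x_n-\omega^x_{n+1}}{\omega^x_1-\omega^x_2}+\frac{\omega^x_1-\omega^x_2}{1-\omega^x_1}$$ satisfies $x^{-1}\sum_{w=0}^{x-1}K_w=O(1)$. Let $\tilde\sigma^2=\sigma^2/\mu^3$ and, for $\ell\ge1$, let $h_\ell$ be the density of the normal distribution $N(M_\ell,\ell\tilde\sigma^2)$. Then, as $n\to\infty$, $$P_\omega(X_n=x)=\mu^{-1}\sum_{\ell=1}^n h_\ell(x)\,\omega^x_{n-\ell}+o(n^{-1/2}),$$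 where the error term is uniform in $x\in\mathbb{Z}_+$.
   Context: $\mathbb{Z}_+=\{0,1,2,\dots\}$. An environment is a family $\omega=(\omega^x)_{x\in\mathbb{Z}_+}$ of real sequences $\omega^x=(\omega^x_n)_{n\ge0}$ such that, for every $x$, $\omega^x_0=1$, $0<\omega^x_{n+1}<\omega^x_n$ for all $n\ge0$, and $\lim_{n\to\infty}\omega^x_n=0$. Given $\omega$, let $Z_n=(X_n,Y_n)$, $n\ge0$, be the Markov chain on $\mathbb{Z}_+\times\mathbb{Z}_+$ with initial distribution $P_\omega(Z_0=(0,y))=\omega^0_y-\omega^0_{y+1}$, $y\in\mathbb{Z}_+$, and transitions: from $(x',y')$ with $y'>0$ the chain moves to $(x',y'-1)$ with probability $1$; from $(x',0)$ it moves to $(x'+1,y)$ with probability $\omega^{x'+1}_y-\omega^{x'+1}_{y+1}$, $y\in\mathbb{Z}_+$. $P_\omega$ denotes the law of this chain. The walk is the first coordinate $(X_n)$. Notation: $A_x=\max\{\sup_{n\ge1}n^{\beta(x)}\omega^x_n,\,1\}$; $A'_x=\max\{\sup_{n\ge1}n^{\beta(x)+1}(\omega^x_{n-1}-\omega^x_n),\,1\}$; $m_x=\sum_{n=0}^\infty\omega^x_n$; $\mu_x=\sum_{w=0}^{x-1}m_w$; $\sigma_x^2=\sum_{w=0}^{x-1}\bigl\{\sum_{n=0}^\infty(2n+1)\omega^w_n-\bigl[\sum_{n=0}^\infty\omega^w_n\bigr]^2\bigr\}$; $M_n=\inf\{x\in\mathbb{Z}_+:\mu_x\ge n\}$. For $u>0$,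 $$L(x;u)=\max_{\ell\in\mathbb{Z}:\,|\ell|\le u\,b(x)}\Bigl|\sum_{w\in[x]_\ell}(m_w-\mu)\Bigr|,\qquad b(x)=(x\log x)^{1/2},$$ where $[x]_\ell=[x,x+\ell-1]\cap\mathbb{Z}_+$ if $\ell\ge0$ and $[x]_\ell=[x+\ell-1,x]\cap\mathbb{Z}_+$ if $\ell<0$. $a_x=O(b_x)$ means that there is a constant $C$ with $|a_x|\le Cb_x$ for all $x\ge1$. *)

theory Defs
  imports "HOL-Probability.Probability" "HOL-Library.Landau_Symbols"
begin

definition environment :: "(nat \<Rightarrow> nat \<Rightarrow> real) \<Rightarrow> bool" where
  "environment \<omega> \<longleftrightarrow>
     (\<forall>x. \<omega> x 0 = 1 \<and> (\<forall>n. 0 < \<omega> x (Suc n) \<and> \<omega> x (Suc n) < \<omega> x n) \<and> \<omega> x \<longlonglongrightarrow> 0)"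

definition init_prob :: "(nat \<Rightarrow> nat \<Rightarrow> real) \<Rightarrow> nat \<times> nat \<Rightarrow> real" where
  "init_prob \<omega> z = (case z of (x, y) \<Rightarrow> if x = 0 then \<omega> 0 y - \<omega> 0 (y + 1) else 0)"

definition trans_prob :: "(nat \<Rightarrow> nat \<Rightarrow> real) \<Rightarrow> nat \<times> nat \<Rightarrow> nat \<times> nat \<Rightarrow> real" where
  "trans_prob \<omega> z' z = (case (z', z) of ((x', y'), (x, y)) \<Rightarrow>
     if y' > 0 then (if x = x' \<and> y = y' - 1 then 1 else 0)
     else (if x = x' + 1 then \<omega> (x' + 1) y - \<omega> (x' + 1) (y + 1) else 0))"

text \<open>
  A process \<open>Z\<close> on an arbitrary probability space \<open>M\<close> that is a Markov chain with the above
  initial distribution and transition probabilities.  The event probabilities under \<open>M\<close> play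
  the role of \<open>P\<^sub>\<omega>\<close>; the walk is \<open>\<lambda>n s. fst (Z n s)\<close>.
\<close>

definition env_chain ::
  "(nat \<Rightarrow> nat \<Rightarrow> real) \<Rightarrow> 's measure \<Rightarrow> (nat \<Rightarrow> 's \<Rightarrow> nat \<times> nat) \<Rightarrow> bool" where
  "env_chain \<omega> M Z \<longleftrightarrow>
     prob_space M \<and>
     (\<forall>n. Z n \<in> M \<rightarrow>\<^sub>M count_space UNIV) \<and>
     (\<forall>z. \<P>(s in M. Z 0 s = z) = init_prob \<omega> z) \<and>
     (\<forall>n z z'. \<P>(s in M. \<forall>i\<le>n. Z i s = z i) > 0 \<longrightarrow>
        \<P>(s in M. Z (Suc n) s = z' \<bar> \<forall>i\<le>n. Z i s = z i) = trans_prob \<omega> (z n) z')"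

definition beta_star :: "(nat \<Rightarrow> real) \<Rightarrow> real" where
  "beta_star \<beta> = (INF x. \<beta> x)"

text \<open>The suprema in \<open>A\<^sub>x\<close> and \<open>A'\<^sub>x\<close> may be infinite, hence the extended reals.\<close>

definition A_env :: "(nat \<Rightarrow> nat \<Rightarrow> real) \<Rightarrow> (nat \<Rightarrow> real) \<Rightarrow> nat \<Rightarrow> ereal" where
  "A_env \<omega> \<beta> x = max (SUP n\<in>{1..}. ereal (real n powr \<beta> x * \<omega> x n)) 1"

definition A'_env :: "(nat \<Rightarrow> nat \<Rightarrow> real) \<Rightarrow> (nat \<Rightarrow> real) \<Rightarrow> nat \<Rightarrow> ereal" where
  "A'_env \<omega> \<beta> x =
     max (SUP n\<in>{1..}. ereal (real n powr (\<beta> x + 1) * (\<omega> x (n - 1) - \<omega> x n))) 1"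

text \<open>Only used for \<open>beta_star \<beta> > 2\<close>.\<close>

definition B_env :: "(nat \<Rightarrow> nat \<Rightarrow> real) \<Rightarrow> (nat \<Rightarrow> real) \<Rightarrow> nat \<Rightarrow> ereal" where
  "B_env \<omega> \<beta> w = (if beta_star \<beta> \<le> 3 then A'_env \<omega> \<beta> w else A_env \<omega> \<beta> w)"

text \<open>
  The series below converge as soon as \<open>\<omega> x n = O(n powr (- \<beta> x))\<close> with \<open>\<beta> x > 2\<close>, that is, under
  \<open>A_env \<omega> \<beta> x < \<infinity>\<close> and \<open>beta_star \<beta> > 2\<close>.
\<close>

definition m_env :: "(nat \<Rightarrow> nat \<Rightarrow> real) \<Rightarrow> nat \<Rightarrow> real" where
  "m_env \<omega> x = (\<Sum>n. \<omega> x n)"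

definition mu_env :: "(nat \<Rightarrow> nat \<Rightarrow> real) \<Rightarrow> nat \<Rightarrow> real" where
  "mu_env \<omega> x = (\<Sum>w<x. m_env \<omega> w)"

definition sigma2_env :: "(nat \<Rightarrow> nat \<Rightarrow> real) \<Rightarrow> nat \<Rightarrow> real" where
  "sigma2_env \<omega> x = (\<Sum>w<x. (\<Sum>n. (2 * real n + 1) * \<omega> w n) - (\<Sum>n. \<omega> w n)\<^sup>2)"

text \<open>The set is nonempty in every case of interest: \<open>m_env \<omega> w \<ge> 1\<close>, so \<open>mu_env \<omega> x \<ge> x\<close>.\<close>

definition M_env :: "(nat \<Rightarrow> nat \<Rightarrow> real) \<Rightarrow> nat \<Rightarrow> nat" where
  "M_env \<omega> n = Inf {x. mu_env \<omega> x \<ge> real n}"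

definition b_scale :: "nat \<Rightarrow> real" where
  "b_scale x = sqrt (real x * ln (real x))"

definition bracket :: "nat \<Rightarrow> int \<Rightarrow> nat set" where
  "bracket x l = (if l \<ge> 0 then {w. int w \<in> {int x .. int x + l - 1}}
                  else {w. int w \<in> {int x + l - 1 .. int x}})"

definition L_env :: "(nat \<Rightarrow> nat \<Rightarrow> real) \<Rightarrow> real \<Rightarrow> nat \<Rightarrow> real \<Rightarrow> real" where
  "L_env \<omega> \<mu> x u =
     Max ((\<lambda>l::int. \<bar>\<Sum>w\<in>bracket x l. (m_env \<omega> w - \<mu>)\<bar>) ` {l. real_of_int \<bar>l\<bar> \<le> u * b_scale x})"

definition K_env :: "(nat \<Rightarrow> nat \<Rightarrow> real) \<Rightarrow> nat \<Rightarrow> real" where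
  "K_env \<omega> x =
     (SUP n\<in>{2..}. (\<omega> x n - \<omega> x (n + 1)) / (\<omega> x 1 - \<omega> x 2)) + (\<omega> x 1 - \<omega> x 2) / (1 - \<omega> x 1)"

text \<open>\<open>a\<^sub>x = O(b\<^sub>x)\<close> with one constant valid for all \<open>x \<ge> 1\<close>, not merely eventually.\<close>

definition bigO_from_1 :: "(nat \<Rightarrow> real) \<Rightarrow> (nat \<Rightarrow> real) \<Rightarrow> bool" where
  "bigO_from_1 a b \<longleftrightarrow> (\<exists>C. \<forall>x\<ge>1. \<bar>a x\<bar> \<le> C * b x)"

end

theory Submission
  imports Defs "HOL-Real_Asymp.Real_Asymp"
begin

text \<open>
  Let \<open>S x\<close> be the time at which the walk first reaches \<open>x\<close>. It is a sum of \<open>x\<close> independent holding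
  times with tails \<open>\<omega> w\<close>, and the walk is at \<open>x\<close> at time \<open>n\<close> iff \<open>S x = l \<le> n\<close> and the holding time
  at \<open>x\<close> exceeds \<open>n - l\<close>. Hence \<open>P (X n = x)\<close> is the sum of \<open>P (S x = l) * \<omega> x (n - l)\<close> over \<open>l \<le> n\<close>.
  Since the sum of \<open>\<omega> x k\<close> over \<open>k\<close> is \<open>O(x powr \<eta>)\<close>, it suffices, when \<open>x\<close> is of order at least \<open>n\<close>, to
  know \<open>P (S x = l)\<close> up to a uniform error \<open>o(x powr (-1/2 - \<eta>))\<close>.

  Fourier inversion gives this. The moments of order \<open>p > 2 + 2 * \<eta>\<close> of the holding times control the
  characteristic function of \<open>S x\<close> near \<open>0\<close> and yield an error \<open>O(x powr (-(p - 1)/2))\<close>. By (B4) a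
  positive fraction of the holding times charge both \<open>1\<close> and \<open>2\<close> substantially, so that the
  characteristic function is at most \<open>exp (- c * x * t\<^sup>2)\<close> on the whole of \<open>[-\<pi>, \<pi>]\<close>. Assumptions (B1) and
  (B3) allow one to replace the resulting Gaussian, centred at \<open>mu x\<close> and evaluated at \<open>l\<close>, by the
  one centred at \<open>M l\<close> and evaluated at \<open>x\<close>. If \<open>x\<close> is much smaller than \<open>n\<close>, Chebyshev's inequality
  shows that both sides are \<open>o(n powr (-1/2))\<close>.
\<close>

subsection \<open>Hitting probabilities of the columns\<close>

text \<open>All tolerances are dictated by the target \<open>o(x powr (-1/2 - \<eta>))\<close>. The
  Fourier error \<open>x powr (-(p - 1)/2)\<close> meets it when \<open>p > 2 + 2 * \<eta>\<close>;
  such a \<open>p\<close>, at most 3 and below the tail exponent, exists exactly because \<eta> is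
  below 1/2 and below half of \<open>beta_star \<beta> - 2\<close>. A normal density of width
  \<open>sqrt x\<close> is Lipschitz in its centre with constant of order \<open>1/x\<close> and
  reacts to its variance at rate \<open>x powr (-3/2)\<close>. Hence centres may be off by
  \<open>o(x powr (1/2 - \<eta>))\<close>, which is the order in (B3), and variances by
  \<open>o(x powr (1 - \<eta>))\<close>, which (B1) yields. At distances of order
  \<open>b_scale x\<close> both densities have dropped to a negligible power of \<open>x\<close>,
  whence the width of the window in (B3).

  The obstacle is that the holding times are not identically distributed and single ones may be
  almost degenerate. Decay of characteristic functions is therefore taken from a set of good sites
  only; elsewhere the bound 1 must do. The local errors grow like the cube of \<open>A_env\<close>,
  so averages of cubes are what (B2) has to supply.\<close>

definition conv :: "(nat \<Rightarrow> real) \<Rightarrow> (nat \<Rightarrow> real) \<Rightarrow> nat \<Rightarrow> real" where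
  "conv a b k = (\<Sum>i\<le>k. a i * b (k - i))"

text \<open>The law of the number of steps \<open>Y + 1\<close> spent in a column, where \<open>P (Y \<ge> n) = w n\<close>.\<close>

definition holding :: "(nat \<Rightarrow> real) \<Rightarrow> nat \<Rightarrow> real" where
  "holding w n = (case n of 0 \<Rightarrow> 0 | Suc k \<Rightarrow> w k - w (Suc k))"

text \<open>The law of the hitting time is built algebraically from the holding laws, so that
  independence never has to be shown for the chain itself; \<open>env_chain_prob\<close> provides
  the link.\<close>

primrec hitting :: "(nat \<Rightarrow> nat \<Rightarrow> real) \<Rightarrow> nat \<Rightarrow> nat \<Rightarrow> real" where
  "hitting \<omega> 0 = (\<lambda>k. if k = 0 then 1 else 0)"
| "hitting \<omega> (Suc x) = conv (hitting \<omega> x) (holding (\<omega> x))"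

text \<open>\<open>env_chain\<close> speaks of transitions given a full history only. Summing over
  the countably many histories ending in \<open>z\<close> removes the conditioning, since the factor
  depends on the last state alone.\<close>

lemma env_chain_joint:
  assumes "env_chain \<omega> M Z"
  shows "\<P>(s in M. Z n s = z \<and> Z (Suc n) s = z') = \<P>(s in M. Z n s = z) * trans_prob \<omega> z z'"
proof -
  interpret prob_space M using assms by (simp add: env_chain_def)
  have meas [measurable]: "Z n \<in> M \<rightarrow>\<^sub>M count_space UNIV" for n
    using assms by (simp add: env_chain_def)
  have cond: "\<P>(s in M. Z (Suc n) s = z' \<bar> \<forall>i\<le>n. Z i s = h i) = trans_prob \<omega> (h n) z'"
    if "\<P>(s in M. \<forall>i\<le>n. Z i s = h i) > 0" for h n z'
    using assms that unfolding env_chain_def by blast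
  define H where "H s = map (\<lambda>i. Z i s) [0..<Suc n]" for s
  have H_eq: "H s = l \<longleftrightarrow> length l = Suc n \<and> (\<forall>i\<le>n. Z i s = l ! i)" for s l
    unfolding H_def by (auto simp: list_eq_iff_nth_eq simp del: upt_Suc)
  have Hn: "Z n s = H s ! n" for s
    by (simp add: H_def del: upt_Suc)
  have H_meas: "{s \<in> space M. H s = l} \<in> sets M" for l
    unfolding H_eq by measurable
  \<comment> \<open>Countable additivity over the histories, indexed by their codes; a number that
    codes no list contributes the empty event.\<close>
  have split: "(\<lambda>k. prob {s \<in> space M. to_nat (H s) = k \<and> Q s}) sums prob {s \<in> space M. Q s}"
    if [measurable]: "Measurable.pred M Q" for Q
  proof -
    have sets: "{s \<in> space M. to_nat (H s) = k \<and> Q s} \<in> sets M" for k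
    proof (cases "\<exists>l::(nat \<times> nat) list. to_nat l = k")
      case True
      then obtain l :: "(nat \<times> nat) list" where "to_nat l = k" by blast
      then have "{s \<in> space M. to_nat (H s) = k \<and> Q s} = {s \<in> space M. H s = l} \<inter> {s \<in> space M. Q s}"
        by auto
      then show ?thesis using H_meas[of l] by simp
    next
      case False
      then have "{s \<in> space M. to_nat (H s) = k \<and> Q s} = {}" by auto
      then show ?thesis by (metis sets.empty_sets)
    qed
    have "(\<lambda>k. prob {s \<in> space M. to_nat (H s) = k \<and> Q s}) sums
        prob (\<Union>k. {s \<in> space M. to_nat (H s) = k \<and> Q s})"
      by (rule finite_measure_UNION) (use sets in \<open>auto simp: disjoint_family_on_def\<close>)
    also have "(\<Union>k. {s \<in> space M. to_nat (H s) = k \<and> Q s}) = {s \<in> space M. Q s}" by auto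
    finally show ?thesis .
  qed
  have "prob {s \<in> space M. to_nat (H s) = k \<and> (Z n s = z \<and> Z (Suc n) s = z')}
      = prob {s \<in> space M. to_nat (H s) = k \<and> Z n s = z} * trans_prob \<omega> z z'" for k
  proof (cases "\<exists>l. to_nat l = k \<and> length l = Suc n \<and> l ! n = z")
    case True
    then obtain l where l: "to_nat l = k" "length l = Suc n" "l ! n = z" by blast
    have "to_nat (H s) = k \<longleftrightarrow> (\<forall>i\<le>n. Z i s = l ! i)" for s
      using l H_eq[of s l] by auto
    then have 1: "{s \<in> space M. to_nat (H s) = k \<and> (Z n s = z \<and> Z (Suc n) s = z')}
        = {s \<in> space M. (\<forall>i\<le>n. Z i s = l ! i) \<and> Z (Suc n) s = z'}"
      and 2: "{s \<in> space M. to_nat (H s) = k \<and> Z n s = z} = {s \<in> space M. \<forall>i\<le>n. Z i s = l ! i}"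
      using l by auto
    show ?thesis
    proof (cases "prob {s \<in> space M. \<forall>i\<le>n. Z i s = l ! i} > 0")
      case True
      from cond[OF this, of z'] True l show ?thesis
        unfolding 1 2 by (simp add: cond_prob_def field_simps conj_commute)
    next
      \<comment> \<open>The hypothesis says nothing about a history of probability 0, but then both
        sides vanish.\<close>
      case False
      have "prob {s \<in> space M. (\<forall>i\<le>n. Z i s = l ! i) \<and> Z (Suc n) s = z'}
          \<le> prob {s \<in> space M. \<forall>i\<le>n. Z i s = l ! i}"
        by (rule finite_measure_mono) auto
      with False have "prob {s \<in> space M. (\<forall>i\<le>n. Z i s = l ! i) \<and> Z (Suc n) s = z'} = 0"
        "prob {s \<in> space M. \<forall>i\<le>n. Z i s = l ! i} = 0"
        by (smt (verit) measure_nonneg)+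
      then show ?thesis unfolding 1 2 by simp
    qed
  next
    case False
    then have "\<not> (to_nat (H s) = k \<and> Z n s = z)" for s
      unfolding Hn by (metis H_def length_map length_upt minus_nat.diff_0)
    then have 1: "{s \<in> space M. to_nat (H s) = k \<and> (Z n s = z \<and> Z (Suc n) s = z')} = {}"
      and 2: "{s \<in> space M. to_nat (H s) = k \<and> Z n s = z} = {}"
      by blast+
    show ?thesis unfolding 1 2 by simp
  qed
  moreover have "(\<lambda>k. prob {s \<in> space M. to_nat (H s) = k \<and> (Z n s = z \<and> Z (Suc n) s = z')}) sums
      \<P>(s in M. Z n s = z \<and> Z (Suc n) s = z')"
    by (rule split) measurable
  moreover have "(\<lambda>k. prob {s \<in> space M. to_nat (H s) = k \<and> Z n s = z} * trans_prob \<omega> z z') sums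
      (\<P>(s in M. Z n s = z) * trans_prob \<omega> z z')"
    by (rule sums_mult2, rule split) measurable
  ultimately show ?thesis by (simp add: sums_iff)
qed

text \<open>A state has at most two predecessors, the one above it and the bottom of the previous
  column, so the sum over all previous states is finite.\<close>

lemma env_chain_succ:
  assumes "env_chain \<omega> M Z"
  shows "\<P>(s in M. Z (Suc n) s = (x, y)) = \<P>(s in M. Z n s = (x, Suc y))
    + (if x = 0 then 0 else \<P>(s in M. Z n s = (x - 1, 0)) * (\<omega> x y - \<omega> x (Suc y)))"
proof -
  interpret prob_space M using assms by (simp add: env_chain_def)
  have meas [measurable]: "Z n \<in> M \<rightarrow>\<^sub>M count_space UNIV" for n
    using assms by (simp add: env_chain_def)
  define f where "f k = prob {s \<in> space M. to_nat (Z n s) = k \<and> Z (Suc n) s = (x, y)}" for k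
  define A where "A = to_nat ` ({(x, Suc y)} \<union> (if x = 0 then {} else {(x - 1, 0::nat)}))"
  have "f sums prob (\<Union>k. {s \<in> space M. to_nat (Z n s) = k \<and> Z (Suc n) s = (x, y)})"
    unfolding f_def by (rule finite_measure_UNION) (auto simp: disjoint_family_on_def)
  also have "(\<Union>k. {s \<in> space M. to_nat (Z n s) = k \<and> Z (Suc n) s = (x, y)})
      = {s \<in> space M. Z (Suc n) s = (x, y)}" by auto
  finally have 1: "f sums \<P>(s in M. Z (Suc n) s = (x, y))" .
  have val: "f (to_nat z) = \<P>(s in M. Z n s = z) * trans_prob \<omega> z (x, y)" for z
    unfolding f_def by (simp add: env_chain_joint[OF assms])
  have "f k = 0" if "k \<notin> A" for k
  proof (cases "\<exists>z::nat\<times>nat. to_nat z = k")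
    case True
    then obtain z :: "nat \<times> nat" where z: "k = to_nat z" by blast
    obtain a b where ab: "z = (a, b)" by force
    have "trans_prob \<omega> z (x, y) = 0"
      using that unfolding z ab A_def trans_prob_def by (auto split: if_splits simp: Suc_diff_1)
    then show ?thesis by (simp add: z val)
  next
    case False
    then have "{s \<in> space M. to_nat (Z n s) = k \<and> Z (Suc n) s = (x, y)} = {}" by blast
    then show ?thesis unfolding f_def by (metis measure_empty)
  qed
  then have 2: "f sums (\<Sum>k\<in>A. f k)"
    by (intro sums_finite) (auto simp: A_def)
  have "\<P>(s in M. Z (Suc n) s = (x, y)) = (\<Sum>k\<in>A. f k)"
    using 1 2 sums_unique2 by blast
  also have "\<dots> = (\<Sum>z\<in>{(x, Suc y)} \<union> (if x = 0 then {} else {(x - 1, 0::nat)}). f (to_nat z))"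
    unfolding A_def by (subst sum.reindex) (auto simp: inj_on_def)
  also have "\<dots> = \<P>(s in M. Z n s = (x, Suc y))
    + (if x = 0 then 0 else \<P>(s in M. Z n s = (x - 1, 0)) * (\<omega> x y - \<omega> x (Suc y)))"
    by (auto simp: val trans_prob_def)
  finally show ?thesis .
qed

lemma hitting_Suc_0 [simp]: "hitting \<omega> (Suc x) 0 = 0"
  by (simp add: conv_def holding_def)

lemma hitting_Suc_Suc:
  "hitting \<omega> (Suc x) (Suc k) = (\<Sum>i\<le>k. hitting \<omega> x i * (\<omega> x (k - i) - \<omega> x (Suc (k - i))))"
  by (simp add: conv_def holding_def Suc_diff_le)

text \<open>The chain is at \<open>(x, y)\<close> at time \<open>n\<close> iff it entered column \<open>x\<close> at height \<open>n - l + y\<close>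
  at some time \<open>l \<le> n\<close>.\<close>

lemma env_chain_prob:
  assumes "env_chain \<omega> M Z"
  shows "\<P>(s in M. Z n s = (x, y)) =
    (\<Sum>l\<le>n. hitting \<omega> x l * (\<omega> x (n - l + y) - \<omega> x (Suc (n - l + y))))"
proof (induction n arbitrary: x y)
  case 0
  have "\<P>(s in M. Z 0 s = (x, y)) = init_prob \<omega> (x, y)"
    using assms by (simp add: env_chain_def)
  then show ?case by (cases x) (auto simp: init_prob_def simp del: hitting.simps(2))
next
  case (Suc n)
  \<comment> \<open>The mass entering from the previous column is the new summand
    \<open>l = Suc n\<close>: by \<open>hitting_Suc_Suc\<close>, the induction hypothesis at height
    0 is the next hitting probability.\<close>
  have "(if x = 0 then 0 else \<P>(s in M. Z n s = (x - 1, 0)) * (\<omega> x y - \<omega> x (Suc y)))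
      = hitting \<omega> x (Suc n) * (\<omega> x y - \<omega> x (Suc y))"
    by (cases x) (simp_all add: Suc.IH hitting_Suc_Suc del: hitting.simps(2))
  then show ?case
    unfolding env_chain_succ[OF assms] Suc.IH
    by (simp add: Suc_diff_le del: hitting.simps(2))
qed

text \<open>Summation over the heights telescopes and turns the point masses of the holding law into
  its tail.\<close>

lemma env_chain_fst_prob:
  assumes chain: "env_chain \<omega> M Z" and env: "environment \<omega>"
  shows "\<P>(s in M. fst (Z n s) = x) = (\<Sum>l\<le>n. hitting \<omega> x l * \<omega> x (n - l))"
proof -
  interpret prob_space M using chain by (simp add: env_chain_def)
  have meas [measurable]: "Z n \<in> M \<rightarrow>\<^sub>M count_space UNIV" for n
    using chain by (simp add: env_chain_def)
  have "(\<lambda>y. prob {s \<in> space M. Z n s = (x, y)}) sums prob (\<Union>y. {s \<in> space M. Z n s = (x, y)})"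
    by (rule finite_measure_UNION) (auto simp: disjoint_family_on_def)
  also have "(\<Union>y. {s \<in> space M. Z n s = (x, y)}) = {s \<in> space M. fst (Z n s) = x}"
    by (auto simp: prod_eq_iff)
  finally have 1: "(\<lambda>y. prob {s \<in> space M. Z n s = (x, y)}) sums \<P>(s in M. fst (Z n s) = x)" .
  have lim: "\<omega> x \<longlonglongrightarrow> 0" using env by (simp add: environment_def)
  have "(\<lambda>y. \<omega> x (k + y) - \<omega> x (Suc (k + y))) sums \<omega> x k" for k
    using telescope_sums'[OF LIMSEQ_ignore_initial_segment[OF lim, of k]] by (simp add: add.commute)
  then have "(\<lambda>y. \<Sum>l\<le>n. hitting \<omega> x l * (\<omega> x (n - l + y) - \<omega> x (Suc (n - l + y))))
      sums (\<Sum>l\<le>n. hitting \<omega> x l * \<omega> x (n - l))"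
    by (intro sums_sum sums_mult)
  with 1 show ?thesis
    unfolding env_chain_prob[OF chain] by (rule sums_unique2)
qed

subsection \<open>Holding times: moments and characteristic function\<close>

lemma powr_Suc_diff_le:
  assumes "1 \<le> p" "1 \<le> n"
  shows "real (Suc n) powr p - real n powr p \<le> p * 2 powr (p - 1) * real n powr (p - 1)"
proof -
  obtain z where z: "real n < z" "z < real (Suc n)"
    "real (Suc n) powr p - real n powr p = (real (Suc n) - real n) * (p * z powr (p - 1))"
    using assms MVT2[of "real n" "real (Suc n)" "\<lambda>x. x powr p" "\<lambda>x. p * x powr (p - 1)"]
    by (force intro!: has_real_derivative_powr)
  have "z powr (p - 1) \<le> (2 * real n) powr (p - 1)"
    using z assms by (intro powr_mono2) auto
  then show ?thesis
    using z assms by (simp add: powr_mult mult.assoc mult_left_mono)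
qed

text \<open>The error is at most \<open>s\<^sup>2\<close> for small and at most \<open>s\<close> for
  large \<open>s\<close>; the exponent \<open>p / 2\<close> lies between 1 and 2 and serves both
  ranges.\<close>

lemma exp_minus_approx:
  assumes "0 \<le> s" "2 \<le> p" "p \<le> (3::real)"
  shows "\<bar>exp (- s) - (1 - s)\<bar> \<le> s powr (p / 2)"
proof (cases "s \<le> 1")
  case True
  have "exp (- s) \<le> 1 / (1 + s)"
    using assms exp_ge_add_one_self[of s] by (simp add: exp_minus divide_simps)
  also have "\<dots> \<le> 1 - s + s\<^sup>2"
    using assms by (simp add: divide_simps) (simp add: algebra_simps power2_eq_square power3_eq_cube)
  finally have "\<bar>exp (- s) - (1 - s)\<bar> \<le> s\<^sup>2"
    using exp_ge_add_one_self[of "- s"] by simp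
  also have "s\<^sup>2 \<le> s powr (p / 2)"
  proof (cases "s = 0")
    case False
    then have "s powr 2 \<le> s powr (p / 2)"
      using assms True by (intro powr_mono') auto
    with False assms show ?thesis by simp
  qed auto
  finally show ?thesis .
next
  case False
  have "\<bar>exp (- s) - (1 - s)\<bar> \<le> s"
    using exp_ge_add_one_self[of "- s"] assms by simp
  also have "s \<le> s powr (p / 2)"
    using False assms powr_mono[of 1 "p / 2" s] by simp
  finally show ?thesis .
qed

text \<open>Taylor expansion to fourth order, with \<open>pi\<^sup>2 < 10\<close> for the quartic
  term: 1/2 - 10/24 = 1/12.\<close>

lemma one_minus_cos_ge:
  assumes "\<bar>t\<bar> \<le> pi"
  shows "1 - cos t \<ge> t\<^sup>2 / 12"
proof -
  have "\<bar>Re (iexp t - (\<Sum>k\<le>3. (\<i> * t)^k / fact k))\<bar> \<le> \<bar>t\<bar> ^ Suc 3 / fact (Suc 3)"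
    using abs_Re_le_cmod iexp_approx1 by (rule order_trans)
  also have "\<bar>t\<bar> ^ Suc 3 / fact (Suc 3) = t ^ 4 / 24"
    by (simp add: fact_numeral power4_eq_xxxx)
  also have "Re (iexp t - (\<Sum>k\<le>3. (\<i> * t)^k / fact k)) = cos t - (1 - t\<^sup>2 / 2)"
    by (simp add: numeral_3_eq_3 Re_exp power2_eq_square)
  finally have 1: "cos t \<le> 1 - t\<^sup>2 / 2 + t ^ 4 / 24" by linarith
  have "t\<^sup>2 \<le> 3.15\<^sup>2"
    using assms pi_approx by (intro abs_le_square_iff[THEN iffD1]) auto
  then have "t\<^sup>2 * t\<^sup>2 \<le> 10 * t\<^sup>2"
    by (intro mult_right_mono) (auto simp: power2_eq_square)
  with 1 show ?thesis by (simp add: power2_eq_square power4_eq_xxxx)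
qed

text \<open>Interpolation between the cubic remainder, good for small \<open>y\<close>, and the
  quadratic one, good for large \<open>y\<close>. It makes a moment of order \<open>p\<close>,
  possibly below 3, sufficient.\<close>

lemma iexp_approx_powr:
  assumes "2 \<le> p" "p \<le> 3"
  shows "cmod (cis y - (1 + \<i> * y - y\<^sup>2 / 2)) \<le> \<bar>y\<bar> powr p"
proof -
  have eq: "iexp y - (\<Sum>k\<le>2. (\<i> * y)^k / fact k) = cis y - (1 + \<i> * y - y\<^sup>2 / 2)"
    by (simp add: numeral_2_eq_2 cis_conv_exp power2_eq_square) (simp add: algebra_simps)
  have 1: "cmod (cis y - (1 + \<i> * y - y\<^sup>2 / 2)) \<le> \<bar>y\<bar> ^ 3 / 6"
    using iexp_approx1[of y 2] unfolding eq by (simp add: fact_numeral numeral_3_eq_3)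
  have 2: "cmod (cis y - (1 + \<i> * y - y\<^sup>2 / 2)) \<le> \<bar>y\<bar>\<^sup>2"
    using iexp_approx2[of y 2] unfolding eq by (simp add: fact_numeral)
  show ?thesis
  proof (cases "y = 0")
    case False
    show ?thesis
    proof (cases "\<bar>y\<bar> \<le> 1")
      case True
      have "\<bar>y\<bar> powr 3 \<le> \<bar>y\<bar> powr p"
        using assms True False by (intro powr_mono') auto
      then have "\<bar>y\<bar> ^ 3 \<le> \<bar>y\<bar> powr p"
        using False by (simp add: powr_numeral)
      moreover have "0 \<le> \<bar>y\<bar> ^ 3" by simp
      ultimately show ?thesis using 1 by linarith
    next
      case False
      then have "\<bar>y\<bar> powr 2 \<le> \<bar>y\<bar> powr p"
        using assms by (intro powr_mono) auto
      moreover have "\<bar>y\<bar> powr 2 = \<bar>y\<bar>\<^sup>2"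
        using False by (simp add: powr_numeral)
      ultimately show ?thesis using 2 by linarith
    qed
  qed simp
qed

text \<open>Bound for the moment of order \<open>p\<close> per unit of \<open>a\<close>. The 1 is
  the term \<open>n = 0\<close> of the summation by parts, where no power bound on the tail is
  available; the series covers the other terms.\<close>

definition moment_const :: "real \<Rightarrow> real \<Rightarrow> real" where
  "moment_const p b = 1 + p * 2 powr (p - 1) * (\<Sum>n. real n powr (p - 1 - b))"

definition chf :: "(nat \<Rightarrow> real) \<Rightarrow> real \<Rightarrow> complex" where
  "chf w t = (\<Sum>n. complex_of_real (holding w n) * cis (t * real n))"

definition mean :: "(nat \<Rightarrow> real) \<Rightarrow> real" where
  "mean w = (\<Sum>n. w n)"

text \<open>This is the variance of the holding time: \<open>w n\<close> is the probability that it
  exceeds \<open>n\<close>, and \<open>2 * n + 1\<close> is the increment of the square from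
  \<open>n\<close> to \<open>n + 1\<close>.\<close>

definition var :: "(nat \<Rightarrow> real) \<Rightarrow> real" where
  "var w = (\<Sum>n. (2 * real n + 1) * w n) - (\<Sum>n. w n)\<^sup>2"

text \<open>A single column. In the application \<open>a\<close> is \<open>A_env\<close> of the
  column and \<open>b\<close> is \<open>beta_star\<close>, an exponent common to all
  columns.\<close>

locale tail_seq =
  fixes w :: "nat \<Rightarrow> real" and a b :: real
  assumes w_0: "w 0 = 1"
    and w_pos: "0 < w n"
    and w_dec: "w (Suc n) < w n"
    and w_le: "1 \<le> n \<Longrightarrow> w n \<le> a * real n powr (- b)"
    and b_gt: "2 < b"
    and a_ge: "1 \<le> a"
begin

lemma w_powr_le:
  assumes "1 \<le> n" shows "w n * real n powr r \<le> a * real n powr (r - b)"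
proof -
  have "w n * real n powr r \<le> (a * real n powr (- b)) * real n powr r"
    using assms by (intro mult_right_mono w_le) auto
  then show ?thesis by (simp add: mult.assoc flip: powr_add)
qed

lemma w_powr_tendsto:
  assumes "r < b" shows "(\<lambda>n. w n * real n powr r) \<longlonglongrightarrow> 0"
proof (rule tendsto_sandwich[OF _ _ tendsto_const])
  show "(\<lambda>n. a * real n powr (r - b)) \<longlonglongrightarrow> 0"
    using assms
    by (intro tendsto_mult_right_zero tendsto_neg_powr filterlim_real_sequentially) auto
  show "\<forall>\<^sub>F n in sequentially. w n * real n powr r \<le> a * real n powr (r - b)"
    using w_powr_le by (auto simp: eventually_at_top_linorder)
qed (auto simp: less_imp_le[OF w_pos])

lemma w_tendsto: "w \<longlonglongrightarrow> 0"
proof -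
  have "(\<lambda>n. w n * real n powr 0) \<longlonglongrightarrow> 0" using b_gt by (intro w_powr_tendsto) auto
  moreover have "\<forall>\<^sub>F n in sequentially. w n * real n powr 0 = w n"
    using eventually_gt_at_top[of 0] by eventually_elim simp
  ultimately show ?thesis by (rule Lim_transform_eventually)
qed

lemma holding_nonneg [simp]: "0 \<le> holding w n"
  using w_dec by (cases n) (auto simp: holding_def less_imp_le)

lemma holding_0 [simp]: "holding w 0 = 0"
  by (simp add: holding_def)

lemma holding_sums: "holding w sums 1"
proof -
  have "(\<lambda>n. holding w (Suc n)) sums (w 0 - 0)"
    unfolding holding_def using telescope_sums'[OF w_tendsto] by simp
  then show ?thesis by (simp add: sums_Suc_iff w_0)
qed

text \<open>Abel summation: the tails, for which bounds are given, replace the point masses. The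
  boundary term \<open>w N * f N\<close> is the one that \<open>lim\<close> removes.\<close>

lemma holding_sums_by_parts:
  assumes f0: "f 0 = 0" and lim: "(\<lambda>n. w n * f n) \<longlonglongrightarrow> 0"
    and sum: "(\<lambda>n. w n * (f (Suc n) - f n)) sums s"
  shows "(\<lambda>n. holding w n * f n) sums s"
proof -
  have "(\<Sum>n<N. holding w (Suc n) * f (Suc n)) = (\<Sum>n<N. w n * (f (Suc n) - f n)) - w N * f N" for N
    by (induction N) (auto simp: f0 holding_def algebra_simps)
  moreover have "(\<lambda>N. (\<Sum>n<N. w n * (f (Suc n) - f n)) - w N * f N) \<longlonglongrightarrow> s - 0"
    using sum lim by (intro tendsto_diff) (auto simp: sums_def)
  ultimately have "(\<lambda>n. holding w (Suc n) * f (Suc n)) sums s"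
    by (simp add: sums_def)
  then show ?thesis by (simp add: sums_Suc_iff[of "\<lambda>n. holding w n * f n"])
qed

lemma powr_diff_le:
  assumes "1 \<le> p" "1 \<le> n"
  shows "w n * (real (Suc n) powr p - real n powr p)
    \<le> a * (p * 2 powr (p - 1)) * real n powr (p - 1 - b)"
proof -
  have "w n * (real (Suc n) powr p - real n powr p)
      \<le> w n * (p * 2 powr (p - 1) * real n powr (p - 1))"
    using assms w_pos[of n] by (intro mult_left_mono powr_Suc_diff_le) auto
  also have "\<dots> = p * 2 powr (p - 1) * (w n * real n powr (p - 1))" by simp
  also have "\<dots> \<le> p * 2 powr (p - 1) * (a * real n powr (p - 1 - b))"
    using assms by (intro mult_left_mono w_powr_le) auto
  finally show ?thesis by (simp add: mult_ac)
qed

lemma summable_powr_diff: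
  assumes "1 \<le> p" "p < b"
  shows "summable (\<lambda>n. w n * (real (Suc n) powr p - real n powr p))"
proof (rule summable_comparison_test')
  show "summable (\<lambda>n. a * (p * 2 powr (p - 1)) * real n powr (p - 1 - b))"
    using assms by (intro summable_mult) (simp add: summable_real_powr_iff)
  show "norm (w n * (real (Suc n) powr p - real n powr p))
      \<le> a * (p * 2 powr (p - 1)) * real n powr (p - 1 - b)" if "1 \<le> n" for n
  proof -
    have "0 \<le> w n * (real (Suc n) powr p - real n powr p)"
      using w_pos[of n] assms by (auto intro!: mult_nonneg_nonneg powr_mono2)
    then show ?thesis using powr_diff_le[OF assms(1) that] by simp
  qed
qed

lemma moment_const_ge: 
  assumes "1 \<le> p" "p < b" shows "1 \<le> moment_const p b"
  unfolding moment_const_def using assms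
  by (auto intro!: mult_nonneg_nonneg suminf_nonneg simp: summable_real_powr_iff)

lemma holding_moment:
  assumes "1 \<le> p" "p < b"
  shows "summable (\<lambda>n. holding w n * real n powr p)"
    and "(\<Sum>n. holding w n * real n powr p) \<le> moment_const p b * a"
proof -
  note sum = summable_powr_diff[OF assms]
  have s: "(\<lambda>n. holding w n * real n powr p) sums (\<Sum>n. w n * (real (Suc n) powr p - real n powr p))"
    using assms sum
    by (intro holding_sums_by_parts w_powr_tendsto summable_sums) auto
  then show "summable (\<lambda>n. holding w n * real n powr p)" by (rule sums_summable)
  have sum2: "summable (\<lambda>n. real n powr (p - 1 - b))"
    using assms by (simp add: summable_real_powr_iff)
  have "(\<Sum>n. w n * (real (Suc n) powr p - real n powr p))
      = (\<Sum>n. w (Suc n) * (real (Suc (Suc n)) powr p - real (Suc n) powr p)) + 1"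
    using assms suminf_split_head[OF sum] by (simp add: w_0)
  also have "(\<Sum>n. w (Suc n) * (real (Suc (Suc n)) powr p - real (Suc n) powr p))
      \<le> (\<Sum>n. a * (p * 2 powr (p - 1)) * real (Suc n) powr (p - 1 - b))"
    using sum sum2 assms(1)
    by (intro suminf_le powr_diff_le summable_mult)
      (auto simp: summable_Suc_iff[of "\<lambda>n. w n * (real (Suc n) powr p - real n powr p)"]
        summable_Suc_iff[of "\<lambda>n. real n powr (p - 1 - b)"] simp del: of_nat_Suc)
  also have "\<dots> = a * (p * 2 powr (p - 1)) * (\<Sum>n. real (Suc n) powr (p - 1 - b))"
    using sum2 by (intro suminf_mult) (auto simp: summable_Suc_iff[of "\<lambda>n. real n powr (p - 1 - b)"] simp del: of_nat_Suc)
  also have "(\<Sum>n. real (Suc n) powr (p - 1 - b)) = (\<Sum>n. real n powr (p - 1 - b))"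
    using suminf_split_head[OF sum2] by simp
  finally have "(\<Sum>n. w n * (real (Suc n) powr p - real n powr p)) \<le> moment_const p b * a"
    using a_ge by (simp add: moment_const_def algebra_simps)
  then show "(\<Sum>n. holding w n * real n powr p) \<le> moment_const p b * a"
    using s by (simp add: sums_iff)
qed

lemma summable_w: "summable w"
  and holding_mean: "(\<lambda>n. holding w n * real n) sums mean w"
proof -
  show s: "summable w"
  proof -
    have "summable (\<lambda>n. w n * (real (Suc n) powr 1 - real n powr 1))"
      using b_gt by (intro summable_powr_diff) auto
    then show ?thesis by simp
  qed
  have "(\<lambda>n. w n * real n) \<longlonglongrightarrow> 0"
    using w_powr_tendsto[of 1] b_gt by simp
  then show "(\<lambda>n. holding w n * real n) sums mean w"
    using s by (intro holding_sums_by_parts) (auto simp: mean_def summable_sums)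
qed

lemma holding_second_moment: "(\<lambda>n. holding w n * (real n)\<^sup>2) sums (var w + (mean w)\<^sup>2)"
proof -
  have eq: "real n powr 2 = (real n)\<^sup>2" for n by (cases "n = 0") auto
  have "summable (\<lambda>n. w n * (real (Suc n) powr 2 - real n powr 2))"
    using b_gt by (intro summable_powr_diff) auto
  then have s: "summable (\<lambda>n. (2 * real n + 1) * w n)"
    unfolding eq by (simp add: power2_eq_square algebra_simps)
  have eq2: "w n * ((real (Suc n))\<^sup>2 - (real n)\<^sup>2) = (2 * real n + 1) * w n" for n
    by (simp add: power2_eq_square algebra_simps)
  show ?thesis
  proof (rule holding_sums_by_parts)
    show "(\<lambda>n. w n * (real n)\<^sup>2) \<longlonglongrightarrow> 0"
      using w_powr_tendsto[of 2] b_gt unfolding eq by simp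
    show "(\<lambda>n. w n * ((real (Suc n))\<^sup>2 - (real n)\<^sup>2)) sums (var w + (mean w)\<^sup>2)"
      unfolding eq2 var_def mean_def using s by (simp add: summable_sums)
  qed auto
qed

lemma holding_square_diff: "(\<lambda>n. holding w n * (real n - c)\<^sup>2) sums (var w + (mean w - c)\<^sup>2)"
proof -
  have "(\<lambda>n. holding w n * (real n)\<^sup>2 - 2 * c * (holding w n * real n) + c\<^sup>2 * holding w n) sums
      (var w + (mean w)\<^sup>2 - 2 * c * mean w + c\<^sup>2 * 1)"
    by (intro sums_add sums_diff sums_mult holding_sums holding_mean holding_second_moment)
  then show ?thesis by (simp add: power2_eq_square algebra_simps)
qed

lemma var_nonneg: "0 \<le> var w"
  using holding_square_diff[of "mean w"] sums_le[OF _ sums_zero, of "\<lambda>n. holding w n * (real n - mean w)\<^sup>2"]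
  by (auto simp: sums_iff intro!: suminf_nonneg)

lemma mean_ge: "1 \<le> mean w"
  using sum_le_suminf[OF summable_w, of "{0}"] w_pos by (auto simp: w_0 mean_def less_imp_le)

lemma nat_le_powr: "1 \<le> p \<Longrightarrow> real n \<le> real n powr p"
  using powr_mono[of 1 p "real n"] by (cases "n = 0") auto

lemma nat_square_le_powr: "2 \<le> p \<Longrightarrow> (real n)\<^sup>2 \<le> real n powr p"
  using powr_mono[of 2 p "real n"] by (cases "n = 0") auto

lemma mean_le:
  assumes "1 \<le> p" "p < b" shows "mean w \<le> moment_const p b * a"
proof -
  have "mean w \<le> (\<Sum>n. holding w n * real n powr p)"
  proof (rule sums_le[OF _ holding_mean])
    show "holding w n * real n \<le> holding w n * real n powr p" for n
      using assms by (intro mult_left_mono nat_le_powr) auto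
  qed (use holding_moment(1)[OF assms] in \<open>auto simp: summable_sums\<close>)
  then show ?thesis using holding_moment(2)[OF assms] by simp
qed

lemma var_le:
  assumes "2 \<le> p" "p < b" shows "var w \<le> moment_const p b * a"
proof -
  have "var w + (mean w)\<^sup>2 \<le> (\<Sum>n. holding w n * real n powr p)"
  proof (rule sums_le[OF _ holding_second_moment])
    show "holding w n * (real n)\<^sup>2 \<le> holding w n * real n powr p" for n
      using assms by (intro mult_left_mono nat_square_le_powr) auto
  qed (use holding_moment(1)[of p] assms in \<open>auto simp: summable_sums\<close>)
  also have "\<dots> \<le> moment_const p b * a" using holding_moment(2)[of p] assms by simp
  finally show ?thesis using zero_le_power2[of "mean w"] by linarith
qed

text \<open>Both \<open>n\<close> and the mean are nonnegative, so their distance is at most their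
  maximum. The cube arises from the mean raised to the power \<open>p\<close>, as \<open>p\<close>
  is at most 3.\<close>

lemma holding_central_moment:
  assumes "2 \<le> p" "p \<le> 3" "p < b"
  shows "summable (\<lambda>n. holding w n * \<bar>real n - mean w\<bar> powr p)"
    and "(\<Sum>n. holding w n * \<bar>real n - mean w\<bar> powr p) \<le> 2 * (moment_const p b * a) ^ 3"
proof -
  define C where "C = moment_const p b * a"
  have C: "1 \<le> C"
    unfolding C_def using moment_const_ge[of p] a_ge assms mult_mono[of 1 "moment_const p b" 1 a] by simp
  have pt: "\<bar>real n - mean w\<bar> powr p \<le> real n powr p + mean w powr p" for n
  proof -
    have "\<bar>real n - mean w\<bar> powr p \<le> max (real n) (mean w) powr p"
      using mean_ge assms by (intro powr_mono2) auto
    also have "\<dots> \<le> real n powr p + mean w powr p" by (auto simp: max_def)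
    finally show ?thesis .
  qed
  have s: "(\<lambda>n. holding w n * real n powr p + mean w powr p * holding w n) sums
     ((\<Sum>n. holding w n * real n powr p) + mean w powr p * 1)"
    using assms by (intro sums_add sums_mult holding_sums summable_sums holding_moment) auto
  have pt2: "holding w n * \<bar>real n - mean w\<bar> powr p
      \<le> holding w n * real n powr p + mean w powr p * holding w n" for n
    using mult_left_mono[OF pt holding_nonneg, of n n] by (simp add: algebra_simps)
  show sm: "summable (\<lambda>n. holding w n * \<bar>real n - mean w\<bar> powr p)"
    by (rule summable_comparison_test'[OF sums_summable[OF s]]) (use pt2 in auto)
  have "(\<Sum>n. holding w n * \<bar>real n - mean w\<bar> powr p)
      \<le> (\<Sum>n. holding w n * real n powr p) + mean w powr p"
    using sums_le[OF pt2 summable_sums[OF sm] s] by simp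
  also have "\<dots> \<le> C + C ^ 3"
  proof -
    have "mean w powr p \<le> C powr p"
      using mean_ge mean_le[of p] assms by (intro powr_mono2) (auto simp: C_def)
    also have "\<dots> \<le> C powr 3" using C assms by (intro powr_mono) auto
    finally show ?thesis using holding_moment(2)[of p] assms C by (auto simp: C_def powr_numeral)
  qed
  also have "\<dots> \<le> 2 * C ^ 3" using C power_increasing[of 1 3 C] by simp
  finally show "(\<Sum>n. holding w n * \<bar>real n - mean w\<bar> powr p) \<le> 2 * (moment_const p b * a) ^ 3"
    by (simp add: C_def)
qed

lemma summable_chf: "summable (\<lambda>n. norm (complex_of_real (holding w n) * cis (t * real n)))"
  using holding_sums by (simp add: norm_mult sums_iff)

lemma norm_chf_le: "norm (chf w t) \<le> 1"
proof -
  have "norm (chf w t) \<le> (\<Sum>n. norm (complex_of_real (holding w n) * cis (t * real n)))"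
    unfolding chf_def by (intro summable_norm summable_chf)
  also have "\<dots> = 1" using holding_sums by (simp add: norm_mult sums_iff)
  finally show ?thesis .
qed

lemma chf_taylor:
  assumes p: "2 \<le> p" "p \<le> 3" "p < b"
  shows "cmod (cis (- t * mean w) * chf w t - (1 - var w * t\<^sup>2 / 2))
    \<le> 2 * (moment_const p b * a) ^ 3 * \<bar>t\<bar> powr p"
proof -
  define y where "y n = t * (real n - mean w)" for n
  define g where "g n = complex_of_real (holding w n) * (cis (y n) - (1 + \<i> * y n - (y n)\<^sup>2 / 2))" for n
  have 1: "(\<lambda>n. complex_of_real (holding w n) * cis (y n)) sums (cis (- t * mean w) * chf w t)"
  proof -
    have "(\<lambda>n. cis (- t * mean w) * (complex_of_real (holding w n) * cis (t * real n))) sums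
        (cis (- t * mean w) * chf w t)"
      unfolding chf_def by (intro sums_mult summable_sums summable_norm_cancel[OF summable_chf])
    moreover have "cis (- t * mean w) * (complex_of_real (holding w n) * cis (t * real n))
        = complex_of_real (holding w n) * cis (y n)" for n
      by (simp add: y_def cis_mult algebra_simps)
    ultimately show ?thesis by (simp only:)
  qed
  have 2: "(\<lambda>n. complex_of_real (holding w n) * (1 + \<i> * y n - (y n)\<^sup>2 / 2)) sums (1 - var w * t\<^sup>2 / 2)"
  proof -
    have m: "(\<lambda>n. holding w n * real n - mean w * holding w n) sums (mean w - mean w * 1)"
      by (intro sums_diff sums_mult holding_sums holding_mean)
    have "(\<lambda>n. of_real (holding w n) + (\<i> * t) * of_real (holding w n * real n - mean w * holding w n)
        - (t\<^sup>2 / 2) * of_real (holding w n * (real n - mean w)\<^sup>2))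
      sums (of_real 1 + (\<i> * t) * of_real (mean w - mean w * 1)
        - (t\<^sup>2 / 2) * of_real (var w + (mean w - mean w)\<^sup>2))"
      by (intro sums_add sums_diff sums_mult sums_of_real holding_sums holding_square_diff m)
    moreover have "of_real (holding w n) + (\<i> * t) * of_real (holding w n * real n - mean w * holding w n)
        - (t\<^sup>2 / 2) * of_real (holding w n * (real n - mean w)\<^sup>2)
        = complex_of_real (holding w n) * (1 + \<i> * y n - (y n)\<^sup>2 / 2)" for n
      by (simp add: y_def field_simps power2_eq_square)
    ultimately show ?thesis by (simp add: mult.commute)
  qed
  have g: "g sums (cis (- t * mean w) * chf w t - (1 - var w * t\<^sup>2 / 2))"
    unfolding g_def right_diff_distrib by (rule sums_diff[OF 1 2[unfolded right_diff_distrib]])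
  have bnd: "norm (g n) \<le> \<bar>t\<bar> powr p * (holding w n * \<bar>real n - mean w\<bar> powr p)" for n
  proof -
    have "norm (g n) \<le> holding w n * \<bar>y n\<bar> powr p"
      unfolding g_def norm_mult
      using mult_left_mono[OF iexp_approx_powr[OF p(1,2)] holding_nonneg] by simp
    then show ?thesis by (simp add: y_def abs_mult powr_mult mult_ac)
  qed
  have sm: "summable (\<lambda>n. \<bar>t\<bar> powr p * (holding w n * \<bar>real n - mean w\<bar> powr p))"
    by (intro summable_mult holding_central_moment p)
  have "norm (suminf g) \<le> (\<Sum>n. \<bar>t\<bar> powr p * (holding w n * \<bar>real n - mean w\<bar> powr p))"
    using bnd sm by (rule norm_suminf_le)
  also have "\<dots> = \<bar>t\<bar> powr p * (\<Sum>n. holding w n * \<bar>real n - mean w\<bar> powr p)"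
    by (intro suminf_mult holding_central_moment p)
  also have "\<dots> \<le> \<bar>t\<bar> powr p * (2 * (moment_const p b * a) ^ 3)"
    by (intro mult_left_mono holding_central_moment p) auto
  finally show ?thesis using g by (simp add: sums_iff mult_ac)
qed

text \<open>The centred characteristic function and the Gaussian share the expansion
  \<open>1 - var w * t\<^sup>2 / 2\<close>; the remainders contribute 2 and 1 to the factor
  3.\<close>

lemma chf_gauss:
  assumes p: "2 \<le> p" "p \<le> 3" "p < b"
  shows "cmod (cis (- t * mean w) * chf w t - exp (- var w * t\<^sup>2 / 2))
    \<le> 3 * (moment_const p b * a) ^ 3 * \<bar>t\<bar> powr p"
proof -
  define C where "C = moment_const p b * a"
  have C: "1 \<le> C"
    unfolding C_def using moment_const_ge[of p] a_ge p mult_mono[of 1 "moment_const p b" 1 a] by simp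
  define s where "s = var w * t\<^sup>2 / 2"
  have s0: "0 \<le> s" using var_nonneg by (simp add: s_def)
  have "s \<le> C * t\<^sup>2"
  proof -
    have "var w * t\<^sup>2 \<le> C * t\<^sup>2" unfolding C_def using p by (intro mult_right_mono var_le) auto
    moreover have "0 \<le> var w * t\<^sup>2" using var_nonneg by simp
    ultimately show ?thesis by (simp add: s_def)
  qed
  then have "s powr (p / 2) \<le> (C * t\<^sup>2) powr (p / 2)"
    using s0 p by (intro powr_mono2) auto
  also have "\<dots> = C powr (p / 2) * (\<bar>t\<bar> powr 2) powr (p / 2)"
    using C by (simp add: powr_mult)
  also have "(\<bar>t\<bar> powr 2) powr (p / 2) = \<bar>t\<bar> powr p" unfolding powr_powr by simp
  also have "C powr (p / 2) * \<bar>t\<bar> powr p \<le> C powr 3 * \<bar>t\<bar> powr p"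
    using C p by (intro mult_right_mono powr_mono) auto
  finally have s: "\<bar>exp (- s) - (1 - s)\<bar> \<le> C ^ 3 * \<bar>t\<bar> powr p"
    using exp_minus_approx[OF s0 p(1,2)] C by (simp add: powr_numeral)
  have "cmod (cis (- t * mean w) * chf w t - of_real (exp (- s)))
    \<le> cmod (cis (- t * mean w) * chf w t - of_real (1 - s)) + cmod (of_real (1 - s) - of_real (exp (- s)))"
    using norm_triangle_ineq[of "cis (- t * mean w) * chf w t - of_real (1 - s)" "of_real (1 - s) - of_real (exp (- s))"]
    by simp
  also have "cmod (of_real (1 - s) - of_real (exp (- s))) = \<bar>exp (- s) - (1 - s)\<bar>"
    by (metis norm_of_real of_real_diff abs_minus_commute)
  finally show ?thesis
    using chf_taylor[OF p, of t] s by (simp add: s_def C_def)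
qed

text \<open>Only the atoms at 1 and 2 are exploited, the rest being bounded by its mass. Because
  these atoms are adjacent, their contributions are aligned in \<open>[-pi, pi]\<close> at
  \<open>t = 0\<close> only, so the decay extends to the whole interval.\<close>

lemma norm_chf_decay:
  assumes "\<bar>t\<bar> \<le> pi"
  shows "norm (chf w t) \<le> exp (- ((1 - w 1) * (w 1 - w 2) / 12 * t\<^sup>2))"
proof -
  define p q where "p = holding w 1" and "q = holding w 2"
  have pq: "p = 1 - w 1" "q = w 1 - w 2"
    using w_0 by (simp_all add: p_def q_def holding_def numeral_2_eq_2)
  define f where "f n = complex_of_real (holding w n) * cis (t * real n)" for n
  have sf: "summable (\<lambda>n. norm (f n))" unfolding f_def by (rule summable_chf)
  have nf: "norm (f n) = holding w n" for n by (simp add: f_def norm_mult)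
  have s3: "summable (\<lambda>n. norm (f (n + 3)))" using sf by (rule summable_ignore_initial_segment)
  have sum3: "sum g {..<3} = g 0 + g 1 + g 2" for g :: "nat \<Rightarrow> 'x::comm_monoid_add"
    by (simp add: numeral_3_eq_3 numeral_2_eq_2)
  have "(\<Sum>n. holding w (n + 3)) = 1 - (p + q)"
    using suminf_split_initial_segment[of "holding w" 3] holding_sums
    by (simp add: sums_iff p_def q_def sum3)
  moreover have "0 \<le> (\<Sum>n. holding w (n + 3))"
    using s3 unfolding nf by (intro suminf_nonneg) auto
  ultimately have rest: "(\<Sum>n. norm (f (n + 3))) = 1 - (p + q)" and le1: "p + q \<le> 1"
    by (simp_all add: nf)
  have p0: "0 \<le> p" and q0: "0 \<le> q" by (simp_all add: p_def q_def)
  have "chf w t = (\<Sum>n. f (n + 3)) + (of_real p * cis t + of_real q * cis (2 * t))"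
    unfolding chf_def f_def[symmetric]
    using suminf_split_initial_segment[OF summable_norm_cancel[OF sf], of 3]
    by (simp add: sum3 f_def p_def q_def mult.commute)
  also have "of_real p * cis t + of_real q * cis (2 * t) = cis t * (of_real p + of_real q * cis t)"
    by (simp add: algebra_simps cis_mult mult_2)
  finally have "norm (chf w t) \<le> norm (\<Sum>n. f (n + 3)) + norm (cis t * (of_real p + of_real q * cis t))"
    by (metis norm_triangle_ineq)
  also have "norm (\<Sum>n. f (n + 3)) \<le> 1 - (p + q)"
    using summable_norm[OF s3] rest by simp
  also have "norm (cis t * (of_real p + of_real q * cis t)) = norm (of_real p + of_real q * cis t)"
    by (simp add: norm_mult)
  \<comment> \<open>With \<open>d = p * q * (1 - cos t)\<close> the squared modulus is
    \<open>(p + q)\<^sup>2 - 2 * d\<close>; since \<open>p + q\<close> is at most 1, this is below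
    \<open>(p + q - d)\<^sup>2\<close>.\<close>
  also have "\<dots> \<le> p + q - p * q * (1 - cos t)"
  proof (rule power2_le_imp_le)
    define d where "d = p * q * (1 - cos t)"
    have d: "0 \<le> d" using p0 q0 by (simp add: d_def)
    have "d \<le> p * q * 2" unfolding d_def using p0 q0 cos_ge_minus_one[of t]
      by (intro mult_left_mono) auto
    moreover have "p * q \<le> p * 1" "p * q \<le> 1 * q" using p0 q0 le1 by (intro mult_mono; simp)+
    ultimately show "0 \<le> p + q - p * q * (1 - cos t)" by (simp add: d_def[symmetric])
    have "(norm (of_real p + of_real q * cis t))\<^sup>2 = (p + q * cos t)\<^sup>2 + (q * sin t)\<^sup>2"
      by (simp add: cmod_power2)
    also have "\<dots> = p\<^sup>2 + 2 * p * q * cos t + q\<^sup>2 * ((cos t)\<^sup>2 + (sin t)\<^sup>2)"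
      by (simp add: power2_sum power_mult_distrib distrib_left del: sin_cos_squared_add sin_cos_squared_add2)
    also have "\<dots> = (p + q)\<^sup>2 - 2 * d"
      by (simp add: d_def power2_eq_square algebra_simps)
    also have "\<dots> \<le> (p + q)\<^sup>2 - 2 * (p + q) * d + d\<^sup>2"
    proof -
      have "2 * (p + q) * d \<le> 2 * d" unfolding mult.assoc using mult_right_mono[OF le1 d] by linarith
      then show ?thesis using zero_le_power2[of d] by linarith
    qed
    also have "\<dots> = (p + q - d)\<^sup>2" by (simp add: power2_eq_square algebra_simps)
    finally show "(norm (of_real p + of_real q * cis t))\<^sup>2 \<le> (p + q - p * q * (1 - cos t))\<^sup>2"
      by (simp add: d_def)
  qed
  finally have "norm (chf w t) \<le> 1 - p * q * (1 - cos t)" by simp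
  also have "\<dots> \<le> 1 - p * q * (t\<^sup>2 / 12)"
    using one_minus_cos_ge[OF assms] p0 q0 by (intro diff_left_mono mult_left_mono) auto
  also have "\<dots> \<le> exp (- (p * q * (t\<^sup>2 / 12)))"
    using exp_ge_add_one_self[of "- (p * q * (t\<^sup>2 / 12))"] by simp
  finally show ?thesis by (simp add: pq)
qed

text \<open>Used backwards: once the variance is bounded below, the atom \<open>w 1 - w 2\<close> at
  2 cannot be small. Up to \<open>Suc N\<close> every atom from 2 on is at most \<open>R\<close>
  times the one at 2; beyond, the moment of order \<open>p\<close> takes over.\<close>

lemma var_le_truncated:
  assumes p: "2 \<le> p" "p < b" and N: "1 \<le> N" and R: "1 \<le> R"
    and le: "\<And>n. 2 \<le> n \<Longrightarrow> w n - w (Suc n) \<le> R * (w 1 - w 2)"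
  shows "var w \<le> real N ^ 3 * R * (w 1 - w 2) + real N powr (2 - p) * (moment_const p b * a)"
proof -
  define q where "q = w 1 - w 2"
  have q: "0 \<le> q" using w_dec[of 1] by (simp add: q_def numeral_2_eq_2)
  have hq: "holding w n \<le> R * q" if "2 \<le> n" for n
  proof (cases "n = 2")
    case True
    then show ?thesis using mult_right_mono[OF R q] by (simp add: holding_def q_def numeral_2_eq_2)
  next
    case False
    with that obtain k where "n = Suc k" "2 \<le> k" by (cases n) auto
    then show ?thesis using le[of k] by (simp add: holding_def q_def)
  qed
  \<comment> \<open>The second moment is taken about 1, so that the uncontrolled atom at 1
    contributes nothing.\<close>
  define g where "g n = (if n \<in> {2..Suc N} then R * q * (real N)\<^sup>2 else 0)
    + real N powr (2 - p) * (holding w n * real n powr p)" for n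
  have pt: "holding w n * (real n - 1)\<^sup>2 \<le> g n" for n
  proof -
    consider "n = 0" | "n = 1" | "n \<in> {2..Suc N}" | "Suc N < n" by fastforce
    then show ?thesis
    proof cases
      case 3
      have "holding w n * (real n - 1)\<^sup>2 \<le> R * q * (real N)\<^sup>2"
        using 3 using R q by (intro mult_mono hq power_mono) auto
      also have "\<dots> \<le> g n" using 3 by (simp add: g_def)
      finally show ?thesis .
    next
      case 4
      have "real n powr 2 * real N powr (p - 2) \<le> real n powr 2 * real n powr (p - 2)"
        using 4 p by (intro mult_left_mono powr_mono2) auto
      also have "\<dots> = real n powr p" unfolding powr_add[symmetric] by simp
      finally have "real n powr 2 * real N powr (p - 2) * real N powr (2 - p)
          \<le> real n powr p * real N powr (2 - p)"
        by (rule mult_right_mono) simp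
      moreover have "real N powr (p - 2) * real N powr (2 - p) = 1"
        using N by (simp flip: powr_add)
      ultimately have "(real n)\<^sup>2 \<le> real n powr p * real N powr (2 - p)"
        using 4 by (simp add: mult.assoc powr_numeral)
      moreover have "(real n - 1)\<^sup>2 \<le> (real n)\<^sup>2" using 4 by (intro power_mono) auto
      ultimately have "holding w n * (real n - 1)\<^sup>2 \<le> holding w n * (real n powr p * real N powr (2 - p))"
        by (intro mult_left_mono) auto
      also have "\<dots> = g n" using 4 by (simp add: g_def mult_ac)
      finally show ?thesis .
    qed (auto simp: g_def)
  qed
  have "g sums ((\<Sum>n\<in>{2..Suc N}. R * q * (real N)\<^sup>2) + real N powr (2 - p) * (\<Sum>n. holding w n * real n powr p))"
    unfolding g_def using p
    by (intro sums_add sums_mult summable_sums holding_moment sums_If_finite_set) auto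
  from sums_le[OF pt holding_square_diff this]
  have "var w + (mean w - 1)\<^sup>2 \<le> real N * (R * q * (real N)\<^sup>2) + real N powr (2 - p) * (\<Sum>n. holding w n * real n powr p)"
    by simp
  moreover have "real N powr (2 - p) * (\<Sum>n. holding w n * real n powr p) \<le> real N powr (2 - p) * (moment_const p b * a)"
    using p by (intro mult_left_mono holding_moment(2)) auto
  moreover have "real N * (R * q * (real N)\<^sup>2) = real N ^ 3 * R * q"
    by (simp add: power2_eq_square power3_eq_cube)
  ultimately show ?thesis
    unfolding q_def using zero_le_power2[of "mean w - 1"] by linarith
qed

end

subsection \<open>Moments of the hitting times\<close>

lemma conv_sums:
  fixes a b :: "nat \<Rightarrow> real"
  assumes "a sums A" "b sums B" "\<And>n. 0 \<le> a n" "\<And>n. 0 \<le> b n"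
  shows "conv a b sums (A * B)"
  using Cauchy_product_sums[of a b] assms unfolding conv_def
  by (auto simp: sums_iff)

lemma conv_moments:
  assumes a: "\<And>n. 0 \<le> a n" "a sums 1" "(\<lambda>n. a n * real n) sums m" "(\<lambda>n. a n * (real n)\<^sup>2) sums (v + m\<^sup>2)"
    and b: "\<And>n. 0 \<le> b n" "b sums 1" "(\<lambda>n. b n * real n) sums m'" "(\<lambda>n. b n * (real n)\<^sup>2) sums (v' + m'\<^sup>2)"
  shows "conv a b sums 1"
    and "(\<lambda>n. conv a b n * real n) sums (m + m')"
    and "(\<lambda>n. conv a b n * (real n)\<^sup>2) sums ((v + v') + (m + m')\<^sup>2)"
proof -
  show "conv a b sums 1" using conv_sums[OF a(2) b(2)] a b by simp
  have split: "real n = real i + real (n - i)" if "i \<le> n" for i n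
    using that by simp
  have "(\<lambda>n. conv (\<lambda>n. a n * real n) b n + conv a (\<lambda>n. b n * real n) n) sums (m * 1 + 1 * m')"
    using a b by (intro sums_add conv_sums) auto
  moreover have "conv (\<lambda>n. a n * real n) b n + conv a (\<lambda>n. b n * real n) n = conv a b n * real n" for n
    unfolding conv_def sum_distrib_right sum.distrib[symmetric]
    by (intro sum.cong refl) (simp add: algebra_simps of_nat_diff)
  ultimately show "(\<lambda>n. conv a b n * real n) sums (m + m')" by simp
  have "(\<lambda>n. conv (\<lambda>n. a n * (real n)\<^sup>2) b n + 2 * conv (\<lambda>n. a n * real n) (\<lambda>n. b n * real n) n
      + conv a (\<lambda>n. b n * (real n)\<^sup>2) n) sums ((v + m\<^sup>2) * 1 + 2 * (m * m') + 1 * (v' + m'\<^sup>2))"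
    using a b by (intro sums_add sums_mult conv_sums) auto
  moreover have "conv (\<lambda>n. a n * (real n)\<^sup>2) b n + 2 * conv (\<lambda>n. a n * real n) (\<lambda>n. b n * real n) n
      + conv a (\<lambda>n. b n * (real n)\<^sup>2) n = conv a b n * (real n)\<^sup>2" for n
    unfolding conv_def sum_distrib_right sum_distrib_left sum.distrib[symmetric]
    by (intro sum.cong refl) (simp add: algebra_simps power2_eq_square of_nat_diff)
  ultimately show "(\<lambda>n. conv a b n * (real n)\<^sup>2) sums ((v + v') + (m + m')\<^sup>2)"
    by (simp add: power2_eq_square algebra_simps)
qed

subsection \<open>Fourier inversion\<close>

lemma integral_cis_int:
  fixes j :: int
  shows "(\<integral>t. indicator {-pi..pi} t *\<^sub>R cis (t * of_int j) \<partial>lborel) = (if j = 0 then 2 * pi else 0)"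
proof (cases "j = 0")
  case True
  then show ?thesis by (simp add: scaleR_conv_of_real)
next
  case False
  define F where "F t = cis (t * of_int j) / (\<i> * of_int j)" for t :: real
  have "(F has_vector_derivative cis (t * of_int j)) (at t within {-pi..pi})" for t
    unfolding F_def cis_conv_exp using False
    by (auto intro!: derivative_eq_intros has_vector_derivative_real_field simp: algebra_simps)
  then have "(\<integral>t. indicator {-pi..pi} t *\<^sub>R cis (t * of_int j) \<partial>lborel) = F pi - F (- pi)"
    by (intro integral_FTC_Icc) (auto intro!: continuous_intros)
  also have "F pi = F (- pi)"
  proof -
    have "sin (pi * of_int j) = 0" unfolding sin_zero_iff_int2 by (auto intro: mult.commute)
    then have "cis (- (pi * of_int j)) = cis (pi * of_int j)" by (simp add: complex_eq_iff)
    then show ?thesis by (simp add: F_def)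
  qed
  finally show ?thesis using False by simp
qed

lemma fourier_coefficient:
  fixes q :: "nat \<Rightarrow> real"
  assumes q: "summable (\<lambda>n. \<bar>q n\<bar>)"
  shows "integrable lborel (\<lambda>t. indicator {-pi..pi} t *\<^sub>R (cis (- t * real k) * (\<Sum>n. of_real (q n) * cis (t * real n))))"
    and "(\<integral>t. indicator {-pi..pi} t *\<^sub>R (cis (- t * real k) * (\<Sum>n. of_real (q n) * cis (t * real n))) \<partial>lborel)
      = of_real (2 * pi * q k)"
proof -
  define f where "f n t = indicator {-pi..pi} t *\<^sub>R (of_real (q n) * cis (t * of_int (int n - int k)))" for n t
  have int1: "integrable lborel (\<lambda>t. indicator {-pi..pi} t *\<^sub>R cis (t * of_int j))" for j
    unfolding set_integrable_def[symmetric]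
    by (intro borel_integrable_atLeastAtMost' continuous_intros)
  have f_eq: "f n t = of_real (q n) * (indicator {-pi..pi} t *\<^sub>R cis (t * of_int (int n - int k)))" for n t
    by (simp add: f_def)
  have int: "integrable lborel (f n)" for n
    unfolding f_eq[abs_def] by (intro integrable_mult_right int1)
  have nf: "norm (f n t) = \<bar>q n\<bar> * indicator {-pi..pi} t" for n t
    by (simp add: f_def norm_mult indicator_def)
  have sm: "AE t in lborel. summable (\<lambda>n. norm (f n t))"
    unfolding nf using q by (auto intro: summable_mult2)
  have sm2: "summable (\<lambda>n. \<integral>t. norm (f n t) \<partial>lborel)"
    unfolding nf using q by (auto intro!: summable_mult2)
  have sum_f: "(\<Sum>n. f n t) = indicator {-pi..pi} t *\<^sub>R (cis (- t * real k) * (\<Sum>n. of_real (q n) * cis (t * real n)))" for t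
  proof -
    have sq: "summable (\<lambda>n. complex_of_real (q n) * cis (t * real n))"
      by (rule summable_norm_cancel) (use q in \<open>simp add: norm_mult\<close>)
    have "f n t = (indicator {-pi..pi} t * cis (- t * real k)) * (of_real (q n) * cis (t * real n))" for n
      by (auto simp: f_def indicator_def cis_mult algebra_simps)
    then have "(\<Sum>n. f n t) = (indicator {-pi..pi} t * cis (- t * real k)) * (\<Sum>n. of_real (q n) * cis (t * real n))"
      by (simp only: suminf_mult[OF sq])
    then show ?thesis by (simp add: indicator_def)
  qed
  show "integrable lborel (\<lambda>t. indicator {-pi..pi} t *\<^sub>R (cis (- t * real k) * (\<Sum>n. of_real (q n) * cis (t * real n))))"
    using integrable_suminf[OF int sm sm2] unfolding sum_f .
  have "(\<integral>t. (\<Sum>n. f n t) \<partial>lborel) = (\<Sum>n. integral\<^sup>L lborel (f n))"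
    by (rule integral_suminf[OF int sm sm2])
  also have "integral\<^sup>L lborel (f n) = (if n = k then of_real (2 * pi * q k) else 0)" for n
    unfolding f_eq[abs_def] integral_mult_right_zero integral_cis_int by simp
  then have "(\<Sum>n. integral\<^sup>L lborel (f n)) = (\<Sum>n. if n = k then of_real (2 * pi * q k) else 0)"
    by simp
  also have "\<dots> = of_real (2 * pi * q k)"
    using sums_single[of k "\<lambda>_. complex_of_real (2 * pi * q k)"] by (simp add: sums_iff)
  finally show "(\<integral>t. indicator {-pi..pi} t *\<^sub>R (cis (- t * real k) * (\<Sum>n. of_real (q n) * cis (t * real n))) \<partial>lborel)
      = of_real (2 * pi * q k)"
    unfolding sum_f .
qed

text \<open>The characteristic function of the standard normal law, at frequency
  \<open>- z / sqrt v\<close> and after the substitution \<open>x = sqrt v * t\<close>, with the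
  roles of density and transform exchanged.\<close>

lemma gauss_fourier:
  assumes v: "0 < v"
  shows "integrable lborel (\<lambda>t. cis (- t * z) * complex_of_real (exp (- v * t\<^sup>2 / 2)))"
    and "(\<integral>t. cis (- t * z) * complex_of_real (exp (- v * t\<^sup>2 / 2)) \<partial>lborel)
      = of_real (2 * pi * normal_density 0 (sqrt v) z)"
proof -
  define s where "s = - z / sqrt v"
  define g where "g x = std_normal_density x *\<^sub>R iexp (s * x)" for x
  have int_g: "integrable lborel g"
    unfolding g_def
    by (rule Bochner_Integration.integrable_bound[of _ std_normal_density])
      (auto simp: norm_mult)
  have "integral\<^sup>L lborel g = (CLINT x|std_normal_distribution. iexp (s * x))"
    unfolding g_def by (subst integral_density) auto
  also have "\<dots> = exp (- (s\<^sup>2) / 2)"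
    using fun_cong[OF char_std_normal_distribution, of s] by (simp add: char_def)
  finally have val: "integral\<^sup>L lborel g = complex_of_real (exp (- (s\<^sup>2) / 2))" .
  have aff: "g (0 + sqrt v * t) = of_real (1 / sqrt (2 * pi)) * (cis (- t * z) * complex_of_real (exp (- v * t\<^sup>2 / 2)))" for t
    using v by (simp add: g_def s_def std_normal_density_def cis_conv_exp power_mult_distrib scaleR_conv_of_real field_simps)
  have "integrable lborel (\<lambda>t. g (0 + sqrt v * t))"
    using int_g v by (intro lborel_integrable_real_affine) auto
  then have "integrable lborel (\<lambda>t. of_real (sqrt (2 * pi)) * g (0 + sqrt v * t))"
    by (rule integrable_mult_right)
  then show "integrable lborel (\<lambda>t. cis (- t * z) * complex_of_real (exp (- v * t\<^sup>2 / 2)))"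
    unfolding aff by (simp add: mult.assoc[symmetric] flip: of_real_mult)
  have "integral\<^sup>L lborel g = sqrt v *\<^sub>R (\<integral>t. g (0 + sqrt v * t) \<partial>lborel)"
    using v lborel_integral_real_affine[of "sqrt v" g 0] by simp
  also have "(\<integral>t. g (0 + sqrt v * t) \<partial>lborel) = of_real (1 / sqrt (2 * pi)) * (\<integral>t. cis (- t * z) * complex_of_real (exp (- v * t\<^sup>2 / 2)) \<partial>lborel)"
    unfolding aff by (rule integral_mult_right_zero)
  finally have "(\<integral>t. cis (- t * z) * complex_of_real (exp (- v * t\<^sup>2 / 2)) \<partial>lborel)
      = of_real (sqrt (2 * pi) / sqrt v * exp (- (s\<^sup>2) / 2))"
    using v unfolding val by (simp add: scaleR_conv_of_real field_simps)
  also have "sqrt (2 * pi) / sqrt v * exp (- (s\<^sup>2) / 2) = 2 * pi * normal_density 0 (sqrt v) z"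
    using v by (simp add: normal_density_def s_def power_divide real_sqrt_mult field_simps)
  finally show "(\<integral>t. cis (- t * z) * complex_of_real (exp (- v * t\<^sup>2 / 2)) \<partial>lborel)
      = of_real (2 * pi * normal_density 0 (sqrt v) z)" .
qed

text \<open>A real power of \<open>\<bar>t\<bar>\<close> is dominated by \<open>1 + t ^ 4\<close>,
  which leaves moments of integer order.\<close>

lemma integrable_gauss_moment:
  assumes "0 < c" "0 \<le> p" "p \<le> (4::real)"
  shows "integrable lborel (\<lambda>t::real. \<bar>t\<bar> powr p * exp (- c * t\<^sup>2))"
proof -
  define s where "s = 1 / sqrt (2 * c)"
  have s: "0 < s" "s\<^sup>2 = 1 / (2 * c)" using assms by (simp_all add: s_def power_divide)
  have nd: "normal_density 0 s t = (1 / sqrt (2 * pi * s\<^sup>2)) * exp (- c * t\<^sup>2)" for t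
    using assms by (simp add: normal_density_def s(2))
  have "integrable lborel (\<lambda>t. normal_density 0 s t * (t - 0) ^ k)" for k
    using s by (intro integrable_normal_moment)
  then have "integrable lborel (\<lambda>t. (1 / sqrt (2 * pi * s\<^sup>2)) * (exp (- c * t\<^sup>2) * t ^ k))" for k
    unfolding nd by (simp add: mult.assoc)
  then have i: "integrable lborel (\<lambda>t. exp (- c * t\<^sup>2) * t ^ k)" for k
    by (subst (asm) integrable_mult_left_iff) (use s assms in auto)
  have i2: "integrable lborel (\<lambda>t. exp (- c * t\<^sup>2) * t ^ 0 + exp (- c * t\<^sup>2) * t ^ 4)"
    by (intro Bochner_Integration.integrable_add i)
  show ?thesis
  proof (rule Bochner_Integration.integrable_bound[OF i2])
    show "AE t in lborel. norm (\<bar>t\<bar> powr p * exp (- c * t\<^sup>2)) \<le> norm (exp (- c * t\<^sup>2) * t ^ 0 + exp (- c * t\<^sup>2) * t ^ 4)"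
    proof (intro AE_I2)
      fix t :: real
      have "\<bar>t\<bar> powr p \<le> 1 + t ^ 4"
      proof (cases "\<bar>t\<bar> \<le> 1")
        case True
        have "\<bar>t\<bar> powr p \<le> 1 powr p" using True assms by (intro powr_mono2) auto
        then show ?thesis by (simp add: add_increasing2)
      next
        case False
        then have "\<bar>t\<bar> powr p \<le> \<bar>t\<bar> powr 4" using assms by (intro powr_mono) auto
        also have "\<dots> = t ^ 4" using False by (simp add: powr_numeral)
        finally show ?thesis by simp
      qed
      then have "\<bar>t\<bar> powr p * exp (- c * t\<^sup>2) \<le> (1 + t ^ 4) * exp (- c * t\<^sup>2)"
        by (intro mult_right_mono) auto
      then show "norm (\<bar>t\<bar> powr p * exp (- c * t\<^sup>2)) \<le> norm (exp (- c * t\<^sup>2) * t ^ 0 + exp (- c * t\<^sup>2) * t ^ 4)"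
        by (simp add: algebra_simps)
    qed
  qed auto
qed

text \<open>The origin of the rate: \<open>x\<close> factors, each with an error
  \<open>\<bar>t\<bar> powr p\<close>, give
  \<open>x * x powr (-(p + 1)/2) = x powr (-(p - 1)/2)\<close>.\<close>

lemma integral_gauss_moment_scale:
  assumes "0 < (x::real)" "0 \<le> p"
  shows "(\<integral>t. \<bar>t\<bar> powr p * exp (- c * x * t\<^sup>2) \<partial>lborel)
    = x powr (- (p + 1) / 2) * (\<integral>t. \<bar>t\<bar> powr p * exp (- c * t\<^sup>2) \<partial>lborel)"
proof -
  have "(\<integral>t. \<bar>t\<bar> powr p * exp (- c * t\<^sup>2) \<partial>lborel)
      = sqrt x * (\<integral>t. \<bar>0 + sqrt x * t\<bar> powr p * exp (- c * (0 + sqrt x * t)\<^sup>2) \<partial>lborel)"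
    using assms lborel_integral_real_affine[of "sqrt x" "\<lambda>t. \<bar>t\<bar> powr p * exp (- c * t\<^sup>2)" 0] by simp
  also have "(\<lambda>t. \<bar>0 + sqrt x * t\<bar> powr p * exp (- c * (0 + sqrt x * t)\<^sup>2))
     = (\<lambda>t. sqrt x powr p * (\<bar>t\<bar> powr p * exp (- c * x * t\<^sup>2)))"
    using assms by (simp add: abs_mult powr_mult power_mult_distrib mult_ac)
  also have "(\<integral>t. sqrt x powr p * (\<bar>t\<bar> powr p * exp (- c * x * t\<^sup>2)) \<partial>lborel)
      = sqrt x powr p * (\<integral>t. (\<bar>t\<bar> powr p * exp (- c * x * t\<^sup>2)) \<partial>lborel)"
    by (rule integral_mult_right_zero)
  also have "sqrt x * (sqrt x powr p * (\<integral>t. (\<bar>t\<bar> powr p * exp (- c * x * t\<^sup>2)) \<partial>lborel))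
     = x powr ((p + 1) / 2) * (\<integral>t. (\<bar>t\<bar> powr p * exp (- c * x * t\<^sup>2)) \<partial>lborel)"
    using assms by (simp add: powr_half_sqrt[symmetric] powr_powr powr_add[symmetric] mult.assoc[symmetric] add_divide_distrib add.commute)
  finally have eq: "(\<integral>t. \<bar>t\<bar> powr p * exp (- c * t\<^sup>2) \<partial>lborel)
      = x powr ((p + 1) / 2) * (\<integral>t. \<bar>t\<bar> powr p * exp (- c * x * t\<^sup>2) \<partial>lborel)" .
  show ?thesis
  proof -
    have "- (p + 1) / 2 + (p + 1) / 2 = 0" by (simp add: field_simps)
    then have "x powr (- (p + 1) / 2) * x powr ((p + 1) / 2) = 1"
      unfolding powr_add[symmetric] using assms by simp
    then show ?thesis by (simp only: eq mult.assoc[symmetric] mult_1)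
  qed
qed

section \<open>The whole environment: law of the hitting time and comparison with a Gaussian\<close>

locale tail_env =
  fixes \<omega> :: "nat \<Rightarrow> nat \<Rightarrow> real" and a :: "nat \<Rightarrow> real" and b :: real
  assumes tail: "tail_seq (\<omega> x) (a x) b"
begin

definition mu :: "nat \<Rightarrow> real" where "mu x = (\<Sum>w<x. mean (\<omega> w))"

definition s2 :: "nat \<Rightarrow> real" where "s2 x = (\<Sum>w<x. var (\<omega> w))"

lemma hitting_nonneg: "0 \<le> hitting \<omega> x n"
  by (induction x arbitrary: n)
    (auto simp: conv_def intro!: sum_nonneg mult_nonneg_nonneg tail_seq.holding_nonneg[OF tail])

lemma hitting_sums: "hitting \<omega> x sums 1"
  and hitting_mean: "(\<lambda>n. hitting \<omega> x n * real n) sums mu x"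
  and hitting_second_moment: "(\<lambda>n. hitting \<omega> x n * (real n)\<^sup>2) sums (s2 x + (mu x)\<^sup>2)"
proof (induction x)
  case 0
  show "hitting \<omega> 0 sums 1" using sums_single[of 0 "\<lambda>_. 1::real"] by simp
  have "(\<lambda>n. hitting \<omega> 0 n * real n ^ Suc k) = (\<lambda>_. 0)" for k by auto
  from this[of 0] this[of 1]
  show "(\<lambda>n. hitting \<omega> 0 n * real n) sums mu 0"
    "(\<lambda>n. hitting \<omega> 0 n * (real n)\<^sup>2) sums (s2 0 + (mu 0)\<^sup>2)"
    by (auto simp: mu_def s2_def numeral_2_eq_2)
next
  case (Suc x)
  interpret tail_seq "\<omega> x" "a x" b by (rule tail)
  note m = conv_moments[OF hitting_nonneg Suc holding_nonneg holding_sums holding_mean holding_second_moment]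
  show "hitting \<omega> (Suc x) sums 1"
    "(\<lambda>n. hitting \<omega> (Suc x) n * real n) sums mu (Suc x)"
    "(\<lambda>n. hitting \<omega> (Suc x) n * (real n)\<^sup>2) sums (s2 (Suc x) + (mu (Suc x))\<^sup>2)"
    using m by (auto simp: mu_def s2_def)
qed

lemma hitting_square_diff: "(\<lambda>n. hitting \<omega> x n * (real n - mu x)\<^sup>2) sums s2 x"
proof -
  have "(\<lambda>n. hitting \<omega> x n * (real n)\<^sup>2 - 2 * mu x * (hitting \<omega> x n * real n) + (mu x)\<^sup>2 * hitting \<omega> x n) sums
      ((s2 x + (mu x)\<^sup>2) - 2 * mu x * mu x + (mu x)\<^sup>2 * 1)"
    by (intro sums_add sums_diff sums_mult hitting_sums hitting_mean hitting_second_moment)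
  then show ?thesis by (simp add: power2_eq_square algebra_simps)
qed

lemma summable_hitting: "summable (\<lambda>n. \<bar>hitting \<omega> x n\<bar>)"
  using hitting_sums[of x] hitting_nonneg by (simp add: sums_iff)

lemma hitting_chf:
  "(\<Sum>n. of_real (hitting \<omega> x n) * cis (t * real n)) = (\<Prod>w<x. chf (\<omega> w) t)"
proof (induction x)
  case 0
  have "(\<lambda>n. of_real (hitting \<omega> 0 n) * cis (t * real n)) = (\<lambda>n. if n = 0 then 1 else 0)" by auto
  then show ?case using sums_single[of 0 "\<lambda>_. 1::complex"] by (simp add: sums_iff)
next
  case (Suc x)
  interpret tail_seq "\<omega> x" "a x" b by (rule tail)
  let ?f = "\<lambda>n. complex_of_real (hitting \<omega> x n) * cis (t * real n)"
  let ?g = "\<lambda>n. complex_of_real (holding (\<omega> x) n) * cis (t * real n)"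
  have "(\<Sum>i\<le>n. ?f i * ?g (n - i)) = of_real (hitting \<omega> (Suc x) n) * cis (t * real n)" for n
  proof -
    have pt: "?f i * ?g (n - i) = of_real (hitting \<omega> x i * holding (\<omega> x) (n - i)) * cis (t * real n)" if "i \<le> n" for i
    proof -
      have "cis (t * real i) * cis (t * real (n - i)) = cis (t * real n)"
        using that by (simp add: cis_mult of_nat_diff algebra_simps)
      then show ?thesis by (metis (no_types, lifting) mult.assoc mult.left_commute of_real_mult)
    qed
    have "(\<Sum>i\<le>n. ?f i * ?g (n - i))
        = (\<Sum>i\<le>n. of_real (hitting \<omega> x i * holding (\<omega> x) (n - i)) * cis (t * real n))"
      by (intro sum.cong refl pt) auto
    then show ?thesis by (simp add: conv_def sum_distrib_right)
  qed
  moreover have "(\<lambda>n. \<Sum>i\<le>n. ?f i * ?g (n - i)) sums ((\<Sum>n. ?f n) * (\<Sum>n. ?g n))"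
    using summable_chf summable_hitting[of x] by (intro Cauchy_product_sums) (auto simp: norm_mult)
  ultimately show ?case
    using Suc by (simp add: sums_iff chf_def del: hitting.simps)
qed

text \<open>Inside \<open>[-pi, pi]\<close> the factors of both products are divided by \<open>exp (- c * t\<^sup>2)\<close> at the sites of
  \<open>G\<close>; they stay bounded by 1, so that the difference of the products is at most the sum of the
  differences. Outside only the Gaussian remains, and there \<open>\<bar>t\<bar> \<ge> 1\<close>.\<close>

lemma local_limit_bound:
  assumes p: "0 \<le> p" "p \<le> 4" and x: "1 \<le> x" and c: "0 < c" and \<kappa>: "0 < \<kappa>"
    and G: "G \<subseteq> {..<x}" "\<kappa> * real x \<le> real (card G)"
    and decay: "\<And>w t. w \<in> G \<Longrightarrow> \<bar>t\<bar> \<le> pi \<Longrightarrow> norm (chf (\<omega> w) t) \<le> exp (- (c * t\<^sup>2))"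
    and var_ge: "\<And>w. w \<in> G \<Longrightarrow> 2 * c \<le> var (\<omega> w)"
    and gauss: "\<And>w t. cmod (cis (- t * mean (\<omega> w)) * chf (\<omega> w) t - exp (- var (\<omega> w) * t\<^sup>2 / 2)) \<le> D w * \<bar>t\<bar> powr p"
    and D: "(\<Sum>w<x. D w) \<le> D' * real x"
  shows "\<bar>hitting \<omega> x k - normal_density (mu x) (sqrt (s2 x)) (real k)\<bar>
    \<le> (max 1 (exp (c * pi\<^sup>2) * D') / (2 * pi) * (\<integral>t. \<bar>t\<bar> powr p * exp (- (c * \<kappa>) * t\<^sup>2) \<partial>lborel))
      * real x powr (- (p - 1) / 2)"
proof -
  define A where "A t = (\<Prod>w<x. cis (- t * mean (\<omega> w)) * chf (\<omega> w) t)" for t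
  define B where "B t = (\<Prod>w<x. complex_of_real (exp (- var (\<omega> w) * t\<^sup>2 / 2)))" for t
  \<comment> \<open>The factor \<open>exp (c * pi\<^sup>2)\<close> is the price of dividing each
    difference by its damping factor; the maximum with 1 serves \<open>\<bar>t\<bar> > pi\<close>,
    where \<open>H\<close> has to dominate the bare Gaussian.\<close>
  define C where "C = max 1 (exp (c * pi\<^sup>2) * D')"
  define H where "H t = C * real x * (\<bar>t\<bar> powr p * exp (- (c * \<kappa>) * real x * t\<^sup>2))" for t
  have C: "1 \<le> C" "exp (c * pi\<^sup>2) * D' \<le> C" by (auto simp: C_def)
  have fG: "finite G" using G(1) by (rule finite_subset) auto
  have B_eq: "B t = exp (- (s2 x) * t\<^sup>2 / 2)" for t
  proof -
    have "- (s2 x) * t\<^sup>2 / 2 = (\<Sum>w<x. - var (\<omega> w) * t\<^sup>2 / 2)"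
      by (simp add: s2_def sum_distrib_right sum_divide_distrib sum_negf)
    then show ?thesis by (simp add: B_def exp_sum)
  qed
  have A_eq: "A t = cis (- t * mu x) * (\<Sum>n. of_real (hitting \<omega> x n) * cis (t * real n))" for t
  proof -
    have "(\<Prod>w<y. cis (- t * mean (\<omega> w))) = cis (- t * mu y)" for y
      by (induction y) (auto simp: mu_def cis_mult algebra_simps)
    then show ?thesis by (simp add: A_def hitting_chf prod.distrib)
  qed
  have exp_le: "exp (- (c * real (card G) * t\<^sup>2)) \<le> exp (- (c * \<kappa>) * real x * t\<^sup>2)" for t
  proof -
    have "(c * \<kappa>) * real x * t\<^sup>2 \<le> c * real (card G) * t\<^sup>2"
      using mult_left_mono[OF G(2), of c] c by (intro mult_right_mono) (auto simp: mult.assoc)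
    then show ?thesis by simp
  qed
  have s2_ge: "2 * c * real (card G) \<le> s2 x"
  proof -
    have "2 * c * real (card G) = (\<Sum>w\<in>G. 2 * c)" by simp
    also have "\<dots> \<le> (\<Sum>w\<in>G. var (\<omega> w))" using var_ge by (rule sum_mono)
    also have "\<dots> \<le> s2 x" unfolding s2_def
      using G(1) by (intro sum_mono2) (auto simp: tail_seq.var_nonneg[OF tail])
    finally show ?thesis .
  qed
  have "0 < \<kappa> * real x" using \<kappa> x by simp
  then have s2_pos: "0 < s2 x" using s2_ge c G(2) by (smt (verit) mult_pos_pos)
  have key: "norm (indicator {-pi..pi} t *\<^sub>R A t - B t) \<le> H t" for t
  proof (cases "\<bar>t\<bar> \<le> pi")
    case True
    define e where "e w = (if w \<in> G then exp (- (c * t\<^sup>2)) else 1)" for w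
    have e: "0 < e w" for w by (simp add: e_def)
    have e_ge: "1 / e w \<le> exp (c * pi\<^sup>2)" for w
    proof -
      have "t\<^sup>2 \<le> pi\<^sup>2" using True by (intro abs_le_square_iff[THEN iffD1]) auto
      then have "c * t\<^sup>2 \<le> c * pi\<^sup>2" using c by (intro mult_left_mono) auto
      moreover have "0 \<le> c * pi\<^sup>2" using c by simp
      ultimately show ?thesis by (auto simp: e_def exp_minus field_simps)
    qed
    define a' where "a' w = cis (- t * mean (\<omega> w)) * chf (\<omega> w) t" for w
    define b' where "b' w = complex_of_real (exp (- var (\<omega> w) * t\<^sup>2 / 2))" for w
    have a': "norm (a' w) \<le> e w" for w
      using decay[OF _ True, of w] tail_seq.norm_chf_le[OF tail, of w t]
      by (auto simp: a'_def e_def norm_mult)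
    have b': "norm (b' w) \<le> e w" for w
    proof (cases "w \<in> G")
      case True
      have "2 * c * t\<^sup>2 \<le> var (\<omega> w) * t\<^sup>2" using var_ge[OF True] by (intro mult_right_mono) auto
      then show ?thesis using True by (simp add: b'_def e_def)
    next
      case False
      then show ?thesis using tail_seq.var_nonneg[OF tail, of w] by (simp add: b'_def e_def)
    qed
    have prod_e: "(\<Prod>w<x. e w) = exp (- (c * real (card G) * t\<^sup>2))"
    proof -
      have "(\<Prod>w<x. e w) = (\<Prod>w\<in>G. exp (- (c * t\<^sup>2)))"
        unfolding e_def using G(1) by (subst prod.If_cases) (auto simp: Int_absorb1)
      also have "\<dots> = exp (- (c * real (card G) * t\<^sup>2))"
        by (simp add: exp_of_nat_mult[symmetric] mult_ac)
      finally show ?thesis .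
    qed
    have "norm ((\<Prod>w<x. a' w / of_real (e w)) - (\<Prod>w<x. b' w / of_real (e w)))
        \<le> (\<Sum>w<x. norm (a' w / of_real (e w) - b' w / of_real (e w)))"
      using a' b' e by (intro norm_prod_diff) (auto simp: norm_divide divide_le_eq_1 less_imp_le)
    also have "\<dots> \<le> (\<Sum>w<x. exp (c * pi\<^sup>2) * (D w * \<bar>t\<bar> powr p))"
    proof (rule sum_mono)
      fix w
      have "norm (a' w / of_real (e w) - b' w / of_real (e w)) = (1 / e w) * norm (a' w - b' w)"
        using e[of w] by (simp add: diff_divide_distrib[symmetric] norm_divide)
      also have "\<dots> \<le> exp (c * pi\<^sup>2) * (D w * \<bar>t\<bar> powr p)"
        using e_ge gauss[of t w] by (intro mult_mono) (auto simp: a'_def b'_def)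
      finally show "norm (a' w / of_real (e w) - b' w / of_real (e w)) \<le> exp (c * pi\<^sup>2) * (D w * \<bar>t\<bar> powr p)" .
    qed
    also have "\<dots> = exp (c * pi\<^sup>2) * ((\<Sum>w<x. D w) * \<bar>t\<bar> powr p)"
      by (simp add: sum_distrib_left sum_distrib_right)
    also have "\<dots> \<le> exp (c * pi\<^sup>2) * ((D' * real x) * \<bar>t\<bar> powr p)"
      using D by (intro mult_left_mono mult_right_mono) auto
    also have "\<dots> = (exp (c * pi\<^sup>2) * D') * (real x * \<bar>t\<bar> powr p)" by simp
    also have "\<dots> \<le> C * (real x * \<bar>t\<bar> powr p)"
      using C(2) by (rule mult_right_mono) auto
    finally have diff: "norm ((\<Prod>w<x. a' w / of_real (e w)) - (\<Prod>w<x. b' w / of_real (e w)))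
        \<le> C * (real x * \<bar>t\<bar> powr p)" .
    have "indicator {-pi..pi} t *\<^sub>R A t - B t
        = of_real (\<Prod>w<x. e w) * ((\<Prod>w<x. a' w / of_real (e w)) - (\<Prod>w<x. b' w / of_real (e w)))"
      using True e by (simp add: A_def B_def a'_def b'_def prod_dividef abs_le_iff right_diff_distrib less_imp_neq[symmetric])
    then have "norm (indicator {-pi..pi} t *\<^sub>R A t - B t)
        = exp (- (c * real (card G) * t\<^sup>2)) * norm ((\<Prod>w<x. a' w / of_real (e w)) - (\<Prod>w<x. b' w / of_real (e w)))"
      by (simp add: norm_mult prod_e)
    also have "\<dots> \<le> exp (- (c * \<kappa>) * real x * t\<^sup>2) * (C * (real x * \<bar>t\<bar> powr p))"
      using exp_le diff by (intro mult_mono) auto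
    also have "\<dots> = H t" by (simp add: H_def)
    finally show ?thesis .
  next
    case False
    then have t: "1 \<le> \<bar>t\<bar>" using pi_gt3 by linarith
    have "norm (indicator {-pi..pi} t *\<^sub>R A t - B t) = exp (- (s2 x) * t\<^sup>2 / 2)"
      using False by (auto simp: B_eq indicator_def)
    also have "\<dots> \<le> exp (- (c * real (card G) * t\<^sup>2))"
      using mult_right_mono[OF s2_ge, of "t\<^sup>2"] by (simp add: mult_ac)
    also have "\<dots> \<le> exp (- (c * \<kappa>) * real x * t\<^sup>2)" by (rule exp_le)
    also have "\<dots> \<le> H t"
    proof -
      have "1 * 1 * 1 \<le> C * real x * \<bar>t\<bar> powr p"
        using C x t p ge_one_powr_ge_zero[OF t p(1)] by (intro mult_mono) auto
      from mult_right_mono[OF this, of "exp (- (c * \<kappa>) * real x * t\<^sup>2)"]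
      show ?thesis by (simp add: H_def mult_ac)
    qed
    finally show ?thesis .
  qed
  have intH: "integrable lborel H"
    unfolding H_def using c \<kappa> x p integrable_gauss_moment[of "c * \<kappa> * real x" p]
    by (intro integrable_mult_right) auto
  \<comment> \<open>The phase \<open>cis (t * mu x)\<close> undoes the centring in \<open>A\<close>,
    leaving the Fourier coefficient at \<open>k\<close>; applied to \<open>B\<close> it shifts the
    normal density to \<open>mu x\<close>.\<close>
  have iA: "integrable lborel (\<lambda>t. cis (t * (mu x - real k)) * (indicator {-pi..pi} t *\<^sub>R A t))"
    and vA: "(\<integral>t. cis (t * (mu x - real k)) * (indicator {-pi..pi} t *\<^sub>R A t) \<partial>lborel) = of_real (2 * pi * hitting \<omega> x k)"
  proof -
    have eq: "cis (t * (mu x - real k)) * (indicator {-pi..pi} t *\<^sub>R A t)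
      = indicator {-pi..pi} t *\<^sub>R (cis (- t * real k) * (\<Sum>n. of_real (hitting \<omega> x n) * cis (t * real n)))" for t
      by (simp add: A_eq mult.assoc[symmetric] cis_mult) (simp add: algebra_simps)
    show "integrable lborel (\<lambda>t. cis (t * (mu x - real k)) * (indicator {-pi..pi} t *\<^sub>R A t))"
      "(\<integral>t. cis (t * (mu x - real k)) * (indicator {-pi..pi} t *\<^sub>R A t) \<partial>lborel) = of_real (2 * pi * hitting \<omega> x k)"
      unfolding eq by (rule fourier_coefficient[OF summable_hitting])+
  qed
  have iB: "integrable lborel (\<lambda>t. cis (t * (mu x - real k)) * B t)"
    and vB: "(\<integral>t. cis (t * (mu x - real k)) * B t \<partial>lborel) = of_real (2 * pi * normal_density (mu x) (sqrt (s2 x)) (real k))"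
  proof -
    have "cis (t * (mu x - real k)) * B t = cis (- t * (real k - mu x)) * complex_of_real (exp (- s2 x * t\<^sup>2 / 2))" for t
      by (simp add: B_eq algebra_simps)
    moreover have "normal_density (mu x) (sqrt (s2 x)) (real k) = normal_density 0 (sqrt (s2 x)) (real k - mu x)"
      by (simp add: normal_density_def)
    ultimately show "integrable lborel (\<lambda>t. cis (t * (mu x - real k)) * B t)"
      "(\<integral>t. cis (t * (mu x - real k)) * B t \<partial>lborel) = of_real (2 * pi * normal_density (mu x) (sqrt (s2 x)) (real k))"
      using gauss_fourier[OF s2_pos, of "real k - mu x"] by simp_all
  qed
  define d where "d = hitting \<omega> x k - normal_density (mu x) (sqrt (s2 x)) (real k)"
  have "complex_of_real (2 * pi * d) = (\<integral>t. cis (t * (mu x - real k)) * (indicator {-pi..pi} t *\<^sub>R A t) - cis (t * (mu x - real k)) * B t \<partial>lborel)"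
    unfolding Bochner_Integration.integral_diff[OF iA iB] vA vB d_def by (simp add: algebra_simps)
  also have "norm \<dots> \<le> (\<integral>t. H t \<partial>lborel)"
  proof (rule Bochner_Integration.integral_norm_bound_integral[OF Bochner_Integration.integrable_diff[OF iA iB] intH])
    show "norm (cis (t * (mu x - real k)) * (indicator {-pi..pi} t *\<^sub>R A t) - cis (t * (mu x - real k)) * B t) \<le> H t" for t
      using key[of t] unfolding right_diff_distrib[symmetric] norm_mult by simp
  qed
  finally have "norm (complex_of_real (2 * pi * d)) \<le> (\<integral>t. H t \<partial>lborel)" .
  then have "2 * pi * \<bar>d\<bar> \<le> (\<integral>t. H t \<partial>lborel)"
    by (simp only: norm_of_real abs_mult) simp
  also have "(\<integral>t. H t \<partial>lborel) = C * real x * (real x powr (- (p + 1) / 2) * (\<integral>t. \<bar>t\<bar> powr p * exp (- (c * \<kappa>) * t\<^sup>2) \<partial>lborel))"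
    unfolding H_def integral_mult_right_zero using x p by (subst integral_gauss_moment_scale) auto
  also have "\<dots> = C * (\<integral>t. \<bar>t\<bar> powr p * exp (- (c * \<kappa>) * t\<^sup>2) \<partial>lborel) * (real x powr 1 * real x powr (- (p + 1) / 2))"
    by simp
  also have "real x powr 1 * real x powr (- (p + 1) / 2) = real x powr (- (p - 1) / 2)"
    unfolding powr_add[symmetric] by (simp add: field_simps)
  finally show ?thesis unfolding d_def C_def by (simp add: field_simps)
qed

end

subsection \<open>A local limit theorem for the hitting times\<close>

lemma eventually_powr_le:
  fixes e f C \<delta> :: real
  assumes "e < f" "0 < \<delta>"
  shows "\<forall>\<^sub>F n in sequentially. C * real n powr e \<le> \<delta> * real n powr f"
proof -
  have "(\<lambda>n. C * real n powr (e - f)) \<longlonglongrightarrow> 0"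
    using assms by (intro tendsto_mult_right_zero tendsto_neg_powr filterlim_real_sequentially) auto
  then have "\<forall>\<^sub>F n in sequentially. C * real n powr (e - f) < \<delta>"
    by (rule order_tendstoD) (use assms in auto)
  then show ?thesis
  proof eventually_elim
    case (elim n)
    then have "(C * real n powr (e - f)) * real n powr f \<le> \<delta> * real n powr f"
      by (intro mult_right_mono) auto
    then show ?case by (simp add: mult.assoc powr_add[symmetric])
  qed
qed

context tail_seq
begin

text \<open>The supremum in \<open>K_env\<close> is one of reals and dominates its members only if
  they are bounded; the tails being at most 1 ensures this.\<close>

lemma K_bdd: "bdd_above ((\<lambda>n. (w n - w (n + 1)) / (w 1 - w 2)) ` {2..})"
proof (rule bdd_aboveI)
  fix y assume "y \<in> (\<lambda>n. (w n - w (n + 1)) / (w 1 - w 2)) ` {2..}"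
  then obtain n where y: "y = (w n - w (n + 1)) / (w 1 - w 2)" by blast
  have "w n \<le> 1" using decseq_SucI[of w] w_dec w_0 by (metis decseq_def less_imp_le le0)
  then have "w n - w (n + 1) \<le> 1" using w_pos[of "n + 1"] by simp
  then show "y \<le> 1 / (w 1 - w 2)"
    unfolding y using w_dec[of 1] by (intro divide_right_mono) (auto simp: numeral_2_eq_2)
qed

end

context tail_env
begin

lemma K_env_ratio:
  assumes "2 \<le> n"
  shows "\<omega> x n - \<omega> x (Suc n) \<le> K_env \<omega> x * (\<omega> x 1 - \<omega> x 2)"
    and "\<omega> x 1 - \<omega> x 2 \<le> K_env \<omega> x * (1 - \<omega> x 1)"
    and "0 \<le> K_env \<omega> x"
proof -
  interpret tail_seq "\<omega> x" "a x" b by (rule tail)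
  have p1: "0 < \<omega> x 1 - \<omega> x 2" using w_dec[of 1] by (simp add: numeral_2_eq_2)
  have p0: "0 < 1 - \<omega> x 1" using w_dec[of 0] w_0 by simp
  define S where "S = (SUP n\<in>{2..}. (\<omega> x n - \<omega> x (n + 1)) / (\<omega> x 1 - \<omega> x 2))"
  have up: "(\<omega> x n - \<omega> x (n + 1)) / (\<omega> x 1 - \<omega> x 2) \<le> S" if "2 \<le> n" for n
    unfolding S_def using that by (intro cSUP_upper K_bdd) auto
  have "0 \<le> (\<omega> x 2 - \<omega> x (2 + 1)) / (\<omega> x 1 - \<omega> x 2)"
    using p1 w_dec[of 2] by simp
  then have S0: "0 \<le> S" using up[of 2] by linarith
  have K: "K_env \<omega> x = S + (\<omega> x 1 - \<omega> x 2) / (1 - \<omega> x 1)"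
    by (simp add: K_env_def S_def)
  have q0: "0 \<le> (\<omega> x 1 - \<omega> x 2) / (1 - \<omega> x 1)" using p0 p1 by simp
  have "(\<omega> x n - \<omega> x (n + 1)) / (\<omega> x 1 - \<omega> x 2) \<le> K_env \<omega> x"
    using up[OF assms] q0 K by linarith
  then show "\<omega> x n - \<omega> x (Suc n) \<le> K_env \<omega> x * (\<omega> x 1 - \<omega> x 2)"
    using p1 by (simp add: divide_le_eq)
  have "(\<omega> x 1 - \<omega> x 2) / (1 - \<omega> x 1) \<le> K_env \<omega> x" using S0 K by linarith
  then show "\<omega> x 1 - \<omega> x 2 \<le> K_env \<omega> x * (1 - \<omega> x 1)"
    using p0 by (simp add: divide_le_eq)
  show "0 \<le> K_env \<omega> x" using S0 q0 K by linarith
qed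

end

text \<open>The hypotheses in quantitative form with one constant \<open>C\<close>. The bound
  \<open>a_growth\<close> uses \<open>x + 1\<close> so as to include \<open>x = 0\<close>, where
  \<open>0 powr \<eta>\<close> is 0. The exponent \<open>p\<close> is auxiliary; its lower bound is
  what puts the Fourier error below \<open>x powr (-1/2 - \<eta>)\<close>.\<close>

locale walk_env = tail_env +
  fixes C \<eta> p \<mu> \<sigma>2 :: real
  assumes eta: "0 \<le> \<eta>" "\<eta> < 1 / 2"
    and p: "2 + 2 * \<eta> < p" "p \<le> 3" "p < b"
    and C_ge: "1 \<le> C"
    and a_growth: "a x \<le> C * real (x + 1) powr \<eta>"
    and a_cube: "(\<Sum>w<x. a w ^ 3) \<le> C * real x"
    and K_sum: "(\<Sum>w<x. K_env \<omega> w) \<le> C * real x"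
    and mu_gt: "1 < \<mu>" and sigma2_gt: "0 < \<sigma>2"
    and mu_asymp: "0 < \<epsilon> \<Longrightarrow> \<forall>\<^sub>F x in sequentially. \<bar>mu x - \<mu> * real x\<bar> \<le> \<epsilon> * real x powr (1 - \<eta>)"
    and s2_asymp: "0 < \<epsilon> \<Longrightarrow> \<forall>\<^sub>F x in sequentially. \<bar>s2 x - \<sigma>2 * real x\<bar> \<le> \<epsilon> * real x powr (1 - \<eta>)"
    and L_asymp: "0 < u \<Longrightarrow> 0 < \<epsilon> \<Longrightarrow> \<forall>\<^sub>F x in sequentially. \<bar>L_env \<omega> \<mu> x u\<bar> \<le> \<epsilon> * real x powr (1 / 2 - \<eta>)"
begin

definition mom :: real where "mom = moment_const p b"

lemma p_ge: "2 \<le> p" using p eta by linarith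

lemma mom_ge: "1 \<le> mom"
  unfolding mom_def using p_ge p by (intro tail_seq.moment_const_ge[OF tail]) auto

lemma a_ge: "1 \<le> a w" by (rule tail_seq.a_ge[OF tail])

lemma a_le_cube: "a w \<le> a w ^ 3" "(a w)\<^sup>2 \<le> a w ^ 3"
  using a_ge[of w] power_increasing[of 1 3 "a w"] power_increasing[of 2 3 "a w"] by auto

lemma mean_le: "mean (\<omega> w) \<le> mom * a w"
  unfolding mom_def using p_ge p by (intro tail_seq.mean_le[OF tail]) auto

lemma var_le: "var (\<omega> w) \<le> mom * a w"
  unfolding mom_def using p_ge p by (intro tail_seq.var_le[OF tail]) auto

lemma sum_mom_le: "(\<Sum>w<x. mom * a w) \<le> mom * C * real x"
proof -
  have "(\<Sum>w<x. mom * a w) \<le> mom * (\<Sum>w<x. a w ^ 3)"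
    unfolding sum_distrib_left using mom_ge a_le_cube by (intro sum_mono mult_left_mono) auto
  also have "\<dots> \<le> mom * (C * real x)" using a_cube mom_ge by (intro mult_left_mono) auto
  finally show ?thesis by simp
qed

lemma mu_le: "mu x \<le> mom * C * real x"
  unfolding mu_def using sum_mono[OF mean_le] sum_mom_le by (rule order_trans)

lemma s2_le: "s2 x \<le> mom * C * real x"
  unfolding s2_def using sum_mono[OF var_le] sum_mom_le by (rule order_trans)

lemma s2_bounds:
  "\<forall>\<^sub>F x in sequentially. \<sigma>2 * real x / 2 \<le> s2 x \<and> s2 x \<le> 2 * \<sigma>2 * real x"
  using s2_asymp[OF half_gt_zero[OF sigma2_gt]] eventually_ge_at_top[of 1]
proof eventually_elim
  case (elim x)
  have "real x powr (1 - \<eta>) \<le> real x powr 1"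
    using elim eta by (intro powr_mono) auto
  then have "\<sigma>2 / 2 * real x powr (1 - \<eta>) \<le> \<sigma>2 / 2 * real x"
    using elim sigma2_gt by (intro mult_left_mono) auto
  with elim have "\<bar>s2 x - \<sigma>2 * real x\<bar> \<le> \<sigma>2 * real x / 2" by simp
  moreover have "0 \<le> \<sigma>2 * real x" using sigma2_gt by simp
  ultimately show ?case unfolding abs_le_iff by linarith
qed

text \<open>A positive fraction of the sites have a controlled holding time: at the others either the
  variance is small or one of \<open>a\<close>, \<open>K_env\<close> is large, and the averages bound their contribution to
  the total variance.\<close>

lemma good_sites:
  obtains c \<kappa> where "0 < c" "0 < \<kappa>"
    "\<forall>\<^sub>F x in sequentially. \<exists>G\<subseteq>{..<x}. \<kappa> * real x \<le> real (card G) \<and>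
      (\<forall>w\<in>G. 2 * c \<le> var (\<omega> w) \<and> c \<le> (1 - \<omega> w 1) * (\<omega> w 1 - \<omega> w 2) / 12)"
proof -
  \<comment> \<open>Variance budget: the total is at least \<open>\<sigma>2 * x / 2\<close>. Sites
    of small variance use up at most 1/4 of \<open>\<sigma>2 * x\<close>, those with
    \<open>a w > R1\<close> or \<open>K_env \<omega> w > R2\<close> at most 1/16 each, so 1/8
    remains for the good sites, each of which carries at most \<open>mom * R1\<close>. This yields
    \<open>\<kappa>\<close>.\<close>
  define R1 where "R1 = 16 * mom * C / \<sigma>2 + 1"
  define R2 where "R2 = 16 * mom * R1 * C / \<sigma>2 + 1"
  have frac: "1 \<le> 16 * y / \<sigma>2 + 1" "y / (16 * y / \<sigma>2 + 1) \<le> \<sigma>2 / 16" if "0 \<le> y" for y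
  proof -
    show 1: "1 \<le> 16 * y / \<sigma>2 + 1" using that sigma2_gt by simp
    have "\<sigma>2 / 16 * (16 * y / \<sigma>2 + 1) = y + \<sigma>2 / 16" using sigma2_gt by (simp add: field_simps)
    then show "y / (16 * y / \<sigma>2 + 1) \<le> \<sigma>2 / 16" using 1 sigma2_gt by (simp add: divide_le_eq)
  qed
  have R1: "1 \<le> R1" "mom * C / R1 \<le> \<sigma>2 / 16"
    using frac[of "mom * C"] mom_ge C_ge by (simp_all add: R1_def mult.assoc)
  have R2: "1 \<le> R2" "mom * R1 * C / R2 \<le> \<sigma>2 / 16"
    using frac[of "mom * R1 * C"] mom_ge C_ge R1 by (simp_all add: R2_def mult.assoc)
  \<comment> \<open>Truncation level: at a good site, holding times beyond it account for less than
    half of the variance \<open>\<sigma>2 / 4\<close>.\<close>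
  have "(\<lambda>N. real N powr (2 - p) * (mom * R1)) \<longlonglongrightarrow> 0"
    using p eta by (intro tendsto_mult_left_zero tendsto_neg_powr filterlim_real_sequentially) auto
  then have "\<forall>\<^sub>F N in sequentially. real N powr (2 - p) * (mom * R1) < \<sigma>2 / 8"
    by (rule order_tendstoD) (use sigma2_gt in auto)
  then have "\<forall>\<^sub>F N in sequentially. real N powr (2 - p) * (mom * R1) < \<sigma>2 / 8 \<and> 1 \<le> N"
    using eventually_ge_at_top[of 1] by (rule eventually_conj)
  then obtain N where N: "real N powr (2 - p) * (mom * R1) < \<sigma>2 / 8" "1 \<le> N"
    using eventually_happens'[OF sequentially_bot] by blast
  \<comment> \<open>At a good site \<open>c1\<close> bounds the atom at 2 from below, and by the
    second summand of \<open>K_env\<close> the atom at 1 is at least \<open>c1 / R2\<close>.\<close>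
  define c1 where "c1 = \<sigma>2 / 8 / (real N ^ 3 * R2)"
  define c where "c = min (\<sigma>2 / 8) (c1 * (c1 / R2) / 12)"
  define \<kappa> where "\<kappa> = \<sigma>2 / (8 * mom * R1)"
  have c1: "0 < c1" using sigma2_gt N R2 by (simp add: c1_def)
  have good: "c \<le> (1 - \<omega> w 1) * (\<omega> w 1 - \<omega> w 2) / 12"
    if w: "a w \<le> R1" "K_env \<omega> w \<le> R2" "\<sigma>2 / 4 \<le> var (\<omega> w)" for w
  proof -
    interpret tail_seq "\<omega> w" "a w" b by (rule tail)
    have q: "0 < \<omega> w 1 - \<omega> w 2" using w_dec[of 1] by (simp add: numeral_2_eq_2)
    have r: "0 < 1 - \<omega> w 1" using w_dec[of 0] w_0 by simp
    have "\<omega> w n - \<omega> w (Suc n) \<le> R2 * (\<omega> w 1 - \<omega> w 2)" if "2 \<le> n" for n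
      using K_env_ratio(1)[OF that, of w] mult_right_mono[OF w(2), of "\<omega> w 1 - \<omega> w 2"] q by linarith
    then have "var (\<omega> w) \<le> real N ^ 3 * R2 * (\<omega> w 1 - \<omega> w 2) + real N powr (2 - p) * (mom * a w)"
      unfolding mom_def using p_ge p N R2 by (intro var_le_truncated) auto
    moreover have "real N powr (2 - p) * (mom * a w) \<le> real N powr (2 - p) * (mom * R1)"
      using w mom_ge by (intro mult_left_mono) auto
    ultimately have "\<sigma>2 / 8 \<le> real N ^ 3 * R2 * (\<omega> w 1 - \<omega> w 2)" using N w by linarith
    then have 1: "c1 \<le> \<omega> w 1 - \<omega> w 2" using N R2 by (simp add: c1_def divide_le_eq mult_ac)
    have "\<omega> w 1 - \<omega> w 2 \<le> R2 * (1 - \<omega> w 1)"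
      using K_env_ratio(2)[of 2 w] mult_right_mono[OF w(2), of "1 - \<omega> w 1"] r by linarith
    then have "c1 / R2 \<le> 1 - \<omega> w 1" using 1 R2 by (simp add: divide_le_eq mult_ac)
    then have "(c1 / R2) * c1 \<le> (1 - \<omega> w 1) * (\<omega> w 1 - \<omega> w 2)"
      using 1 c1 r by (intro mult_mono) auto
    then show ?thesis by (simp add: c_def mult_ac)
  qed
  have ev: "\<forall>\<^sub>F x in sequentially. \<exists>G\<subseteq>{..<x}. \<kappa> * real x \<le> real (card G) \<and>
      (\<forall>w\<in>G. 2 * c \<le> var (\<omega> w) \<and> c \<le> (1 - \<omega> w 1) * (\<omega> w 1 - \<omega> w 2) / 12)"
    using s2_bounds
  proof eventually_elim
    case (elim x)
    define G where "G = {w\<in>{..<x}. a w \<le> R1 \<and> K_env \<omega> w \<le> R2 \<and> \<sigma>2 / 4 \<le> var (\<omega> w)}"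
    have pt: "var (\<omega> w) \<le> \<sigma>2 / 4 + mom * a w ^ 3 / R1 + mom * R1 * K_env \<omega> w / R2
        + (if w \<in> G then mom * R1 else 0)" if "w < x" for w
    proof -
      note K0 = K_env_ratio(3)[of 2 w, simplified]
      have nn: "0 \<le> mom * a w ^ 3 / R1" "0 \<le> mom * R1 * K_env \<omega> w / R2"
        "0 \<le> (if w \<in> G then mom * R1 else 0)"
        using mom_ge R1 R2 K0 a_ge[of w] by auto
      have in_G: "w \<in> G \<longleftrightarrow> a w \<le> R1 \<and> K_env \<omega> w \<le> R2 \<and> \<sigma>2 / 4 \<le> var (\<omega> w)"
        using that by (simp add: G_def)
      consider "var (\<omega> w) < \<sigma>2 / 4" | "R1 < a w" | "a w \<le> R1" "R2 < K_env \<omega> w" | "w \<in> G"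
        using in_G by (metis not_le_imp_less)
      then show ?thesis
      proof cases
        case 2
        have "a w * R1 \<le> a w * a w" using 2 a_ge[of w] by (intro mult_left_mono) auto
        then have "a w * R1 \<le> a w ^ 3" using a_le_cube(2)[of w] by (simp add: power2_eq_square)
        then have "mom * (a w * R1) \<le> mom * a w ^ 3" using mom_ge by (intro mult_left_mono) auto
        then have "mom * a w \<le> mom * a w ^ 3 / R1" using R1 by (simp add: le_divide_eq)
        then show ?thesis using var_le[of w] nn sigma2_gt by linarith
      next
        case 3
        have "var (\<omega> w) \<le> mom * R1"
          using var_le[of w] mult_left_mono[OF 3(1), of mom] mom_ge by linarith
        also have "\<dots> \<le> mom * R1 * K_env \<omega> w / R2"
          using mult_left_mono[of R2 "K_env \<omega> w" "mom * R1"] 3 mom_ge R1 R2 by (simp add: le_divide_eq)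
        finally show ?thesis using nn sigma2_gt by linarith
      next
        case 4
        have "mom * a w \<le> mom * R1" using mom_ge 4 in_G by (intro mult_left_mono) auto
        then have "var (\<omega> w) \<le> mom * R1" using var_le[of w] by linarith
        then show ?thesis using nn sigma2_gt 4 by simp
      qed (use nn in linarith)
    qed
    have "s2 x \<le> (\<Sum>w<x. \<sigma>2 / 4 + mom * a w ^ 3 / R1 + mom * R1 * K_env \<omega> w / R2
        + (if w \<in> G then mom * R1 else 0))"
      unfolding s2_def using pt by (intro sum_mono) auto
    also have "\<dots> = \<sigma>2 / 4 * real x + mom / R1 * (\<Sum>w<x. a w ^ 3) + mom * R1 / R2 * (\<Sum>w<x. K_env \<omega> w)
        + mom * R1 * real (card G)"
    proof -
      have "{..<x} \<inter> G = G" by (auto simp: G_def)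
      then have "(\<Sum>w<x. if w \<in> G then mom * R1 else 0) = mom * R1 * real (card G)"
        by (simp add: sum.If_cases)
      then show ?thesis by (simp add: sum.distrib sum_distrib_left sum_divide_distrib mult_ac)
    qed
    also have "\<dots> \<le> \<sigma>2 / 4 * real x + mom / R1 * (C * real x) + mom * R1 / R2 * (C * real x)
        + mom * R1 * real (card G)"
      using mom_ge R1 R2 sigma2_gt a_cube[of x] K_sum[of x] by (intro add_mono mult_left_mono) auto
    also have "mom / R1 * (C * real x) = (mom * C / R1) * real x" by simp
    also have "mom * R1 / R2 * (C * real x) = (mom * R1 * C / R2) * real x" by simp
    finally have "s2 x \<le> \<sigma>2 / 4 * real x + (mom * C / R1) * real x + (mom * R1 * C / R2) * real x
        + mom * R1 * real (card G)" .
    moreover have "(mom * C / R1) * real x \<le> \<sigma>2 / 16 * real x" "(mom * R1 * C / R2) * real x \<le> \<sigma>2 / 16 * real x"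
      using R1 R2 by (intro mult_right_mono; simp)+
    ultimately have "\<sigma>2 * real x / 8 \<le> mom * R1 * real (card G)" using elim by linarith
    then have "\<kappa> * real x \<le> real (card G)"
      using mom_ge R1 by (simp add: \<kappa>_def divide_le_eq mult_ac)
    moreover have "2 * c \<le> var (\<omega> w) \<and> c \<le> (1 - \<omega> w 1) * (\<omega> w 1 - \<omega> w 2) / 12" if "w \<in> G" for w
    proof -
      have "2 * c \<le> \<sigma>2 / 4" by (simp add: c_def)
      moreover have "\<sigma>2 / 4 \<le> var (\<omega> w)" using that by (simp add: G_def)
      ultimately show ?thesis using good[of w] that by (simp add: G_def)
    qed
    moreover have "G \<subseteq> {..<x}" by (auto simp: G_def)
    ultimately show ?case by blast
  qed
  show thesis
    by (rule that[OF _ _ ev]) (use c1 sigma2_gt R2 R1 mom_ge in \<open>auto simp: c_def \<kappa>_def\<close>)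
qed

lemma local_limit:
  obtains D where "\<forall>\<^sub>F x in sequentially. \<forall>k.
    \<bar>hitting \<omega> x k - normal_density (mu x) (sqrt (s2 x)) (real k)\<bar> \<le> D * real x powr (- (p - 1) / 2)"
proof -
  obtain c \<kappa> where c: "0 < c" "0 < \<kappa>" and
    ev: "\<forall>\<^sub>F x in sequentially. \<exists>G\<subseteq>{..<x}. \<kappa> * real x \<le> real (card G) \<and>
      (\<forall>w\<in>G. 2 * c \<le> var (\<omega> w) \<and> c \<le> (1 - \<omega> w 1) * (\<omega> w 1 - \<omega> w 2) / 12)"
    by (rule good_sites)
  define D' where "D' = 3 * mom ^ 3 * C"
  from ev eventually_ge_at_top[of 1]
  have "\<forall>\<^sub>F x in sequentially. \<forall>k.
    \<bar>hitting \<omega> x k - normal_density (mu x) (sqrt (s2 x)) (real k)\<bar>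
    \<le> (max 1 (exp (c * pi\<^sup>2) * D') / (2 * pi) * (\<integral>t. \<bar>t\<bar> powr p * exp (- (c * \<kappa>) * t\<^sup>2) \<partial>lborel))
      * real x powr (- (p - 1) / 2)"
  proof eventually_elim
    case (elim x)
    then obtain G where G: "G \<subseteq> {..<x}" "\<kappa> * real x \<le> real (card G)"
      and Gw: "\<And>w. w \<in> G \<Longrightarrow> 2 * c \<le> var (\<omega> w)"
        "\<And>w. w \<in> G \<Longrightarrow> c \<le> (1 - \<omega> w 1) * (\<omega> w 1 - \<omega> w 2) / 12"
      by blast
    show ?case
    proof
      fix k
      show "\<bar>hitting \<omega> x k - normal_density (mu x) (sqrt (s2 x)) (real k)\<bar>
        \<le> (max 1 (exp (c * pi\<^sup>2) * D') / (2 * pi) * (\<integral>t. \<bar>t\<bar> powr p * exp (- (c * \<kappa>) * t\<^sup>2) \<partial>lborel))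
          * real x powr (- (p - 1) / 2)"
      proof (rule local_limit_bound[OF _ _ _ c G _ Gw(1)])
        fix w t assume "w \<in> G" "\<bar>t\<bar> \<le> pi"
        have "c * t\<^sup>2 \<le> ((1 - \<omega> w 1) * (\<omega> w 1 - \<omega> w 2) / 12) * t\<^sup>2"
          using Gw(2)[OF \<open>w \<in> G\<close>] by (intro mult_right_mono) auto
        then show "norm (chf (\<omega> w) t) \<le> exp (- (c * t\<^sup>2))"
          using tail_seq.norm_chf_decay[OF tail \<open>\<bar>t\<bar> \<le> pi\<close>, of w] by (smt (verit) exp_le_cancel_iff)
      next
        fix w t
        show "cmod (cis (- t * mean (\<omega> w)) * chf (\<omega> w) t - exp (- var (\<omega> w) * t\<^sup>2 / 2))
          \<le> (3 * mom ^ 3 * a w ^ 3) * \<bar>t\<bar> powr p"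
          using tail_seq.chf_gauss[OF tail p_ge p(2,3), of t w] by (simp add: mom_def power_mult_distrib mult_ac)
      next
        have "(\<Sum>w<x. 3 * mom ^ 3 * a w ^ 3) = 3 * mom ^ 3 * (\<Sum>w<x. a w ^ 3)"
          by (simp add: sum_distrib_left)
        also have "\<dots> \<le> 3 * mom ^ 3 * (C * real x)"
          using mom_ge a_cube[of x] by (intro mult_left_mono) auto
        finally show "(\<Sum>w<x. 3 * mom ^ 3 * a w ^ 3) \<le> D' * real x" by (simp add: D'_def)
      qed (use p p_ge elim in auto)
    qed
  qed
  then show thesis by (rule that)
qed

end

subsection \<open>Centring and scale of the Gaussian density\<close>

text \<open>Centred normal density, parametrised by the inverse \<open>s\<close> of the standard
  deviation: in this parameter it is Lipschitz uniformly in \<open>z\<close>.\<close>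

definition gauss :: "real \<Rightarrow> real \<Rightarrow> real" where
  "gauss s z = s * exp (- (s * z)\<^sup>2 / 2) / sqrt (2 * pi)"

lemma gauss_minus [simp]: "gauss s (- z) = gauss s z"
  by (simp add: gauss_def)

lemma normal_density_gauss:
  "0 < \<sigma> \<Longrightarrow> normal_density m \<sigma> x = gauss (1 / \<sigma>) (x - m)"
  by (simp add: normal_density_def gauss_def real_sqrt_mult power_mult_distrib power_divide field_simps)

lemma gauss_rescale: "0 < m \<Longrightarrow> 1 / m * gauss s z = gauss (s / m) (m * z)"
  by (simp add: gauss_def)

lemma inverse_sqrt_2pi_le: "1 / sqrt (2 * pi) \<le> 1"
  using pi_gt3 by simp

text \<open>From \<open>\<bar>y\<bar> \<le> 1 + y\<^sup>2 / 2 \<le> exp (y\<^sup>2 / 2)\<close> with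
  \<open>s * y\<close> for \<open>y\<close>. For \<open>s\<close> of order
  \<open>x powr (-1/2)\<close> it converts an error of the centre of order
  \<open>x powr (1/2 - \<eta>)\<close> into one of order
  \<open>x powr (-1/2 - \<eta>)\<close>.\<close>

lemma gauss_lipschitz: "0 \<le> s \<Longrightarrow> \<bar>gauss s z - gauss s z'\<bar> \<le> s\<^sup>2 * \<bar>z - z'\<bar>"
proof -
  assume s: "0 \<le> s"
  define g where "g y = s * exp (- (s * y)\<^sup>2 / 2)" for y
  have "norm (g z - g z') \<le> s\<^sup>2 * norm (z - z')"
  proof (rule field_differentiable_bound[of UNIV])
    fix y :: real
    show "(g has_field_derivative - (s\<^sup>2 * ((s * y) * exp (- (s * y)\<^sup>2 / 2)))) (at y within UNIV)"
      unfolding g_def by (auto intro!: derivative_eq_intros simp: power2_eq_square)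
    have "\<bar>s * y\<bar> \<le> 1 + (s * y)\<^sup>2 / 2"
      using zero_le_power2[of "\<bar>s * y\<bar> - 1"] by (simp add: power2_diff)
    also have "\<dots> \<le> exp ((s * y)\<^sup>2 / 2)" by (rule exp_ge_add_one_self)
    finally have "\<bar>(s * y) * exp (- (s * y)\<^sup>2 / 2)\<bar> \<le> 1"
      by (simp add: abs_mult exp_minus divide_inverse[symmetric] divide_le_eq)
    from mult_left_mono[OF this, of "s\<^sup>2"]
    show "norm (- (s\<^sup>2 * ((s * y) * exp (- (s * y)\<^sup>2 / 2)))) \<le> s\<^sup>2"
      by (simp add: abs_mult)
  qed auto
  moreover have "\<bar>gauss s z - gauss s z'\<bar> = \<bar>g z - g z'\<bar> * (1 / sqrt (2 * pi))"
    by (simp add: gauss_def g_def diff_divide_distrib[symmetric] abs_divide)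
  moreover have "\<bar>g z - g z'\<bar> * (1 / sqrt (2 * pi)) \<le> \<bar>g z - g z'\<bar> * 1"
    using inverse_sqrt_2pi_le by (rule mult_left_mono) auto
  ultimately show ?thesis by simp
qed

lemma gauss_lipschitz_scale: "\<bar>gauss s z - gauss s' z\<bar> \<le> \<bar>s - s'\<bar>"
proof -
  define g where "g y = y * exp (- (y * z)\<^sup>2 / 2)" for y
  have "norm (g s - g s') \<le> 1 * norm (s - s')"
  proof (rule field_differentiable_bound[of UNIV])
    fix y :: real
    show "(g has_field_derivative (1 - (y * z)\<^sup>2) * exp (- (y * z)\<^sup>2 / 2)) (at y within UNIV)"
      unfolding g_def by (auto intro!: derivative_eq_intros simp: power2_eq_square algebra_simps)
    define r where "r = (y * z)\<^sup>2 / 2"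
    have r: "0 \<le> r" by (simp add: r_def)
    have "\<bar>1 - 2 * r\<bar> \<le> exp r"
    proof (cases "r \<le> 1")
      case True
      then have "\<bar>1 - 2 * r\<bar> \<le> 1 + r" using r by linarith
      then show ?thesis using exp_ge_add_one_self[of r] by linarith
    next
      case False
      have "exp r = exp (r / 2) ^ 2" by (simp add: exp_of_nat_mult[symmetric])
      moreover have "(1 + r / 2) ^ 2 \<le> exp (r / 2) ^ 2"
        using r exp_ge_add_one_self[of "r / 2"] by (intro power_mono) auto
      ultimately have "(1 + r / 2)\<^sup>2 \<le> exp r" by simp
      moreover have "2 * r - 1 \<le> (1 + r / 2)\<^sup>2"
        using zero_le_power2[of "r / 2 - 1"] by (simp add: power2_eq_square algebra_simps)
      ultimately show ?thesis using False by linarith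
    qed
    then have "\<bar>1 - 2 * r\<bar> * exp (- r) \<le> 1"
      by (simp add: exp_minus divide_inverse[symmetric] divide_le_eq)
    then show "norm ((1 - (y * z)\<^sup>2) * exp (- (y * z)\<^sup>2 / 2)) \<le> 1"
      by (simp add: r_def abs_mult)
  qed auto
  moreover have "\<bar>gauss s z - gauss s' z\<bar> = \<bar>g s - g s'\<bar> * (1 / sqrt (2 * pi))"
    by (simp add: gauss_def g_def diff_divide_distrib[symmetric] abs_divide)
  moreover have "\<bar>g s - g s'\<bar> * (1 / sqrt (2 * pi)) \<le> \<bar>g s - g s'\<bar> * 1"
    using inverse_sqrt_2pi_le by (rule mult_left_mono) auto
  ultimately show ?thesis by simp
qed

lemma gauss_nonneg: "0 \<le> s \<Longrightarrow> 0 \<le> gauss s z"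
  by (simp add: gauss_def)

lemma gauss_le:
  assumes "0 \<le> s" "y \<le> (s * z)\<^sup>2 / 2"
  shows "gauss s z \<le> s * exp (- y)"
proof -
  have "gauss s z = (s * exp (- (s * z)\<^sup>2 / 2)) * (1 / sqrt (2 * pi))" by (simp add: gauss_def)
  also have "\<dots> \<le> (s * exp (- (s * z)\<^sup>2 / 2)) * 1"
    using assms inverse_sqrt_2pi_le by (intro mult_left_mono) auto
  also have "\<dots> \<le> s * exp (- y)" using assms by (simp add: mult_left_mono)
  finally show ?thesis .
qed

text \<open>Rationalisation of the difference. With \<open>r\<close> of order \<open>x\<close>, an
  error of the variance of order \<open>x powr (1 - \<eta>)\<close> costs
  \<open>x powr (-1/2 - \<eta>)\<close>.\<close>

lemma inverse_sqrt_diff_le: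
  assumes "0 < r" "r \<le> v" "r \<le> v'"
  shows "\<bar>1 / sqrt v - 1 / sqrt v'\<bar> \<le> \<bar>v - v'\<bar> / (r * sqrt r)"
proof -
  have v: "0 < v" "0 < v'" using assms by auto
  have "1 / sqrt v - 1 / sqrt v' = (sqrt v' - sqrt v) / (sqrt v * sqrt v')"
    using v by (simp add: field_simps)
  also have "sqrt v' - sqrt v = (v' - v) / (sqrt v' + sqrt v)"
    using v by (simp add: field_simps add_pos_pos less_imp_neq[symmetric])
  finally have "\<bar>1 / sqrt v - 1 / sqrt v'\<bar> = \<bar>v - v'\<bar> / ((sqrt v * sqrt v') * (sqrt v' + sqrt v))"
    using v by (simp add: abs_mult abs_divide abs_minus_commute add_pos_pos mult.commute)
  also have "\<dots> \<le> \<bar>v - v'\<bar> / ((sqrt r * sqrt r) * (sqrt r + 0))"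
  proof (rule divide_left_mono)
    show "(sqrt r * sqrt r) * (sqrt r + 0) \<le> (sqrt v * sqrt v') * (sqrt v' + sqrt v)"
      using assms v by (intro mult_mono add_mono) auto
  qed (use assms v in \<open>auto intro!: mult_pos_pos add_pos_pos\<close>)
  finally show ?thesis using assms by simp
qed

lemma b_scale_bounds:
  assumes "exp 1 \<le> real x"
  shows "1 \<le> b_scale x" "(b_scale x)\<^sup>2 = real x * ln (real x)"
proof -
  have x: "1 \<le> real x" using assms exp_ge_add_one_self[of 1] by linarith
  then have l: "1 \<le> ln (real x)" using assms by (simp add: ln_ge_iff)
  have "1 * 1 \<le> real x * ln (real x)" using x l by (intro mult_mono) auto
  then show "1 \<le> b_scale x" by (simp add: b_scale_def)
  show "(b_scale x)\<^sup>2 = real x * ln (real x)"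
    using x l unfolding b_scale_def by (intro real_sqrt_pow2) auto
qed

lemma L_env_ge:
  assumes "real_of_int \<bar>l\<bar> \<le> u * b_scale x"
  shows "\<bar>\<Sum>w\<in>bracket x l. (m_env \<omega> w - \<mu>)\<bar> \<le> L_env \<omega> \<mu> x u"
  unfolding L_env_def
proof (rule Max_ge)
  have "{l. real_of_int \<bar>l\<bar> \<le> u * b_scale x} \<subseteq> {- \<lfloor>u * b_scale x\<rfloor>..\<lfloor>u * b_scale x\<rfloor>}"
    by (force simp: le_floor_iff minus_le_iff abs_le_iff)
  then have "finite {l. real_of_int \<bar>l\<bar> \<le> u * b_scale x}" by (rule finite_subset) auto
  then show "finite ((\<lambda>l. \<bar>\<Sum>w\<in>bracket x l. m_env \<omega> w - \<mu>\<bar>) ` {l. real_of_int \<bar>l\<bar> \<le> u * b_scale x})"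
    by simp
qed (use assms in auto)

section \<open>Sites against times: \<open>mu\<close>, its generalised inverse \<open>M_env\<close>,
  and the windows of (B3)\<close>

context walk_env
begin

lemma mean_m_env: "mean (\<omega> w) = m_env \<omega> w"
  by (simp add: mean_def m_env_def)

lemma mu_env_eq: "mu_env \<omega> x = mu x"
  by (simp add: mu_env_def mu_def mean_m_env)

lemma mu_diff: "x \<le> y \<Longrightarrow> mu y - mu x = (\<Sum>w\<in>{x..<y}. mean (\<omega> w))"
  unfolding mu_def using sum_diff_nat_ivl[of 0 x y "\<lambda>w. mean (\<omega> w)"] by (simp add: atLeast0LessThan)

lemma mu_mono_diff: "x \<le> y \<Longrightarrow> real y - real x \<le> mu y - mu x"
proof -
  assume le: "x \<le> y"
  have "(\<Sum>w\<in>{x..<y}. 1::real) \<le> (\<Sum>w\<in>{x..<y}. mean (\<omega> w))"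
    by (rule sum_mono) (rule tail_seq.mean_ge[OF tail])
  then show ?thesis using le by (simp add: mu_diff of_nat_diff)
qed

lemma M_env_bounds:
  assumes "1 \<le> l"
  shows "1 \<le> M_env \<omega> l" "real l \<le> mu (M_env \<omega> l)" "mu (M_env \<omega> l - 1) < real l"
proof -
  let ?S = "{x. real l \<le> mu x}"
  have "l \<in> ?S" using mu_mono_diff[of 0 l] by (simp add: mu_def)
  then have "M_env \<omega> l \<in> ?S"
    unfolding M_env_def mu_env_eq by (intro Inf_nat_def1) auto
  then show 1: "real l \<le> mu (M_env \<omega> l)" by simp
  show 2: "1 \<le> M_env \<omega> l"
    using 1 assms by (cases "M_env \<omega> l") (auto simp: mu_def)
  show "mu (M_env \<omega> l - 1) < real l"
  proof (rule ccontr)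
    assume "\<not> mu (M_env \<omega> l - 1) < real l"
    then have "M_env \<omega> l \<le> M_env \<omega> l - 1"
      unfolding M_env_def mu_env_eq by (intro wellorder_Inf_le1) simp
    with 2 show False by simp
  qed
qed

text \<open>Increments of \<open>mu\<close> are sums over half-open intervals, whereas a bracket
  with negative \<open>l\<close> contains \<open>x\<close> itself and reaches down to
  \<open>x + l - 1\<close>. The mismatch costs a second \<open>L_env\<close> and a constant
  \<open>\<mu>\<close>, absorbed because \<open>1/2 - \<eta>\<close> is positive.\<close>

lemma mu_window:
  assumes "0 < u" "0 < \<epsilon>"
  shows "\<forall>\<^sub>F x in sequentially. \<forall>k. \<bar>real k - real x\<bar> \<le> u * b_scale x \<longrightarrow>
    \<bar>mu k - mu x - \<mu> * (real k - real x)\<bar> \<le> \<epsilon> * real x powr (1 / 2 - \<eta>)"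
proof -
  have "\<forall>\<^sub>F x in sequentially. \<mu> * real x powr 0 \<le> \<epsilon> / 2 * real x powr (1 / 2 - \<eta>)"
    using eta assms by (intro eventually_powr_le) auto
  moreover have "\<forall>\<^sub>F x in sequentially. \<bar>L_env \<omega> \<mu> x u\<bar> \<le> \<epsilon> / 4 * real x powr (1 / 2 - \<eta>)"
    using assms by (intro L_asymp) auto
  moreover have "\<forall>\<^sub>F x in sequentially. max (exp 1) (max 2 (exp (1 / u\<^sup>2))) \<le> real x"
    using filterlim_real_sequentially unfolding filterlim_at_top by blast
  ultimately show ?thesis
  proof eventually_elim
    case (elim x)
    then have x: "2 \<le> x" "exp 1 \<le> real x" "exp (1 / u\<^sup>2) \<le> real x" by auto
    have "1 / u\<^sup>2 \<le> ln (real x)" using x by (simp add: ln_ge_iff)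
    then have "1 \<le> ln (real x) * u\<^sup>2" using assms by (simp add: divide_le_eq)
    also have "\<dots> \<le> (real x * ln (real x)) * u\<^sup>2"
      using x mult_right_mono[of 1 "real x" "ln (real x)"] by (intro mult_right_mono) auto
    also have "\<dots> = (u * b_scale x)\<^sup>2" by (simp add: power_mult_distrib b_scale_bounds(2)[OF x(2)])
    finally have ub: "1 \<le> u * b_scale x"
      using assms b_scale_bounds(1)[OF x(2)] power2_le_imp_le[of 1 "u * b_scale x"] by simp
    have 1: "\<bar>\<Sum>w\<in>bracket x l. (mean (\<omega> w) - \<mu>)\<bar> \<le> L_env \<omega> \<mu> x u" if "real_of_int \<bar>l\<bar> \<le> u * b_scale x" for l
      using L_env_ge[OF that, of \<omega> \<mu>] by (simp add: mean_m_env)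
    have m1: "1 \<le> mean (\<omega> w)" for w by (rule tail_seq.mean_ge[OF tail])
    have bx1: "bracket x 1 = {x}" by (auto simp: bracket_def)
    have bxm: "bracket x (- 1) = {x - 2, x - 1, x}" using x by (auto simp: bracket_def)
    \<comment> \<open>The bracket with \<open>l = 1\<close> isolates \<open>x\<close>, whose
      deviation can then be removed from brackets to the left.\<close>
    have Lx: "\<bar>mean (\<omega> x) - \<mu>\<bar> \<le> L_env \<omega> \<mu> x u" using 1[of 1] ub by (simp add: bx1)
    have main: "\<bar>mu k - mu x - \<mu> * (real k - real x)\<bar> \<le> 2 * L_env \<omega> \<mu> x u + \<mu>"
      if k: "\<bar>real k - real x\<bar> \<le> u * b_scale x" for k
    proof -
      consider "x \<le> k" | "k + 1 = x" | "k + 2 \<le> x" by linarith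
      then show ?thesis
      proof cases
        case 1
        have "bracket x (int k - int x) = {x..<k}" using 1 by (auto simp: bracket_def)
        moreover have "real_of_int \<bar>int k - int x\<bar> \<le> u * b_scale x" using k by simp
        ultimately have "\<bar>\<Sum>w\<in>{x..<k}. (mean (\<omega> w) - \<mu>)\<bar> \<le> L_env \<omega> \<mu> x u"
          using \<open>\<And>l. _ \<Longrightarrow> \<bar>\<Sum>w\<in>bracket x l. (mean (\<omega> w) - \<mu>)\<bar> \<le> L_env \<omega> \<mu> x u\<close> by metis
        moreover have "(\<Sum>w\<in>{x..<k}. (mean (\<omega> w) - \<mu>)) = mu k - mu x - \<mu> * (real k - real x)"
          using 1 by (simp add: sum_subtractf mu_diff of_nat_diff algebra_simps)
        ultimately show ?thesis using mu_gt Lx by linarith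
      next
        case 2
        have ne: "x - 2 \<noteq> x - 1" "x - 2 \<noteq> x" "x - 1 \<noteq> x" using x by auto
        have "real_of_int \<bar>- 1\<bar> \<le> u * b_scale x" using ub by simp
        from 1[OF this] have "\<bar>(mean (\<omega> (x - 2)) - \<mu>) + ((mean (\<omega> (x - 1)) - \<mu>) + (mean (\<omega> x) - \<mu>))\<bar> \<le> L_env \<omega> \<mu> x u"
          using ne unfolding bxm by (simp del: One_nat_def)
        moreover have "mu x - mu k = mean (\<omega> (x - 1))"
          using mu_diff[of k x] 2 by auto
        moreover have "real k - real x = -1" using 2 by auto
        ultimately show ?thesis using Lx mu_gt m1[of "x - 1"] m1[of "x - 2"] by auto
      next
        case 3
        have "bracket x (int k - int x + 1) = insert x {k..<x}" using 3 by (auto simp: bracket_def)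
        moreover have "real_of_int \<bar>int k - int x + 1\<bar> \<le> u * b_scale x" using k 3 by simp
        ultimately have "\<bar>(mean (\<omega> x) - \<mu>) + (\<Sum>w\<in>{k..<x}. (mean (\<omega> w) - \<mu>))\<bar> \<le> L_env \<omega> \<mu> x u"
          using 1[of "int k - int x + 1"] by simp
        moreover have "(\<Sum>w\<in>{k..<x}. (mean (\<omega> w) - \<mu>)) = - (mu k - mu x - \<mu> * (real k - real x))"
          using 3 mu_diff[of k x] by (simp add: sum_subtractf of_nat_diff algebra_simps)
        ultimately show ?thesis using mu_gt Lx by linarith
      qed
    qed
    show ?case
    proof (intro allI impI)
      fix k assume "\<bar>real k - real x\<bar> \<le> u * b_scale x"
      from main[OF this] show "\<bar>mu k - mu x - \<mu> * (real k - real x)\<bar> \<le> \<epsilon> * real x powr (1 / 2 - \<eta>)"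
        using elim x by simp
    qed
  qed
qed

end

section \<open>Comparison of the Gaussian in time with the Gaussian in space\<close>

context walk_env
begin

lemma eventually_b_scale_le:
  assumes "0 < \<epsilon>"
  shows "\<forall>\<^sub>F x in sequentially. B * b_scale x \<le> \<epsilon> * real x powr (1 - \<eta>)"
proof -
  \<comment> \<open>Half of the gap \<open>1 - 2 * \<eta>\<close>: trading the logarithm for
    \<open>x powr \<gamma>\<close> keeps \<open>(1 + \<gamma>) / 2\<close> below
    \<open>1 - \<eta>\<close>.\<close>
  define \<gamma> where "\<gamma> = (1 - 2 * \<eta>) / 2"
  have \<gamma>: "0 < \<gamma>" using eta by (simp add: \<gamma>_def)
  have "\<forall>\<^sub>F x in sequentially. (\<bar>B\<bar> / sqrt \<gamma>) * real x powr ((1 + \<gamma>) / 2) \<le> \<epsilon> * real x powr (1 - \<eta>)"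
    using assms eta by (intro eventually_powr_le) (auto simp: \<gamma>_def field_simps)
  then show ?thesis using eventually_ge_at_top[of 1]
  proof eventually_elim
    case (elim x)
    then have x: "1 \<le> real x" by simp
    have "real x * ln (real x) \<le> real x * (real x powr \<gamma> / \<gamma>)"
      using x \<gamma> by (intro mult_left_mono ln_powr_bound) auto
    also have "\<dots> = real x powr (1 + \<gamma>) / \<gamma>" using x by (simp add: powr_add)
    finally have "b_scale x \<le> sqrt (real x powr (1 + \<gamma>) / \<gamma>)"
      unfolding b_scale_def by (rule real_sqrt_le_mono)
    also have "\<dots> = real x powr ((1 + \<gamma>) / 2) / sqrt \<gamma>"
      using x by (simp add: real_sqrt_divide powr_half_sqrt[symmetric] powr_powr)
    finally have "\<bar>B\<bar> * b_scale x \<le> \<bar>B\<bar> * (real x powr ((1 + \<gamma>) / 2) / sqrt \<gamma>)"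
      by (rule mult_left_mono) auto
    moreover have "B * b_scale x \<le> \<bar>B\<bar> * b_scale x"
      using x by (intro mult_right_mono) (auto simp: b_scale_def)
    ultimately show ?case using elim by simp
  qed
qed

definition site_density :: "nat \<Rightarrow> nat \<Rightarrow> real" where
  "site_density l x = normal_density (real (M_env \<omega> l)) (sqrt (real l * (\<sigma>2 / \<mu> ^ 3))) (real x)"

text \<open>The factor \<open>1 / \<mu>\<close> is the Jacobian of passing from sites to times:
  distances are multiplied by \<open>\<mu>\<close>, and the variance by its square.\<close>

lemma site_density_rescale:
  assumes "1 \<le> l"
  shows "1 / \<mu> * site_density l x
    = gauss (1 / sqrt (real l * \<sigma>2 / \<mu>)) (\<mu> * (real x - real (M_env \<omega> l)))"
proof -
  have pos: "0 < real l * (\<sigma>2 / \<mu> ^ 3)" using assms sigma2_gt mu_gt by simp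
  have "sqrt (real l * (\<sigma>2 / \<mu> ^ 3)) * \<mu> = sqrt (real l * (\<sigma>2 / \<mu> ^ 3) * \<mu>\<^sup>2)"
    using mu_gt unfolding real_sqrt_mult[of _ "\<mu>\<^sup>2"] by simp
  also have "real l * (\<sigma>2 / \<mu> ^ 3) * \<mu>\<^sup>2 = real l * \<sigma>2 / \<mu>"
    using mu_gt by (simp add: power2_eq_square power3_eq_cube)
  finally have "1 / sqrt (real l * (\<sigma>2 / \<mu> ^ 3)) / \<mu> = 1 / sqrt (real l * \<sigma>2 / \<mu>)"
    by simp
  then show ?thesis
    using pos mu_gt unfolding site_density_def by (simp only: normal_density_gauss real_sqrt_gt_zero gauss_rescale)
qed

text \<open>If \<open>M_env \<omega> l\<close> is within a large multiple of \<open>b_scale x\<close> of \<open>x\<close>, the two Gaussians have nearly equal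
  scale and argument; otherwise both are \<open>O(x powr (-2))\<close>.\<close>

lemma hitting_density:
  assumes \<epsilon>: "0 < \<epsilon>" and c: "0 < c" "c \<le> 1"
  shows "\<forall>\<^sub>F x in sequentially. \<forall>l. 1 \<le> l \<and> c * real l \<le> real x \<longrightarrow>
    \<bar>hitting \<omega> x l - 1 / \<mu> * site_density l x\<bar> \<le> \<epsilon> * real x powr (- 1 / 2 - \<eta>)"
proof -
  \<comment> \<open>Outside the window both exponents must reach \<open>2 * ln x\<close>. The
    variances are at most \<open>2 * \<sigma>2 * x\<close> and, as \<open>l \<le> x / c\<close>, at
    most \<open>\<sigma>2 * x / c\<close>; the constant 32 also allows for half of the distance
    being lost in the first Gaussian.\<close>
  define u where "u = sqrt (32 * \<sigma>2 / c)"
  have u: "0 < u" "u\<^sup>2 = 32 * \<sigma>2 / c" using sigma2_gt c by (simp_all add: u_def)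
  obtain D where D: "\<forall>\<^sub>F x in sequentially. \<forall>k.
    \<bar>hitting \<omega> x k - normal_density (mu x) (sqrt (s2 x)) (real k)\<bar> \<le> D * real x powr (- (p - 1) / 2)"
    by (rule local_limit)
  define K2 where "K2 = (1 + 4 * \<sigma>2) / (\<sigma>2 / 2 * sqrt (\<sigma>2 / 2))"
  define K3 where "K3 = sqrt (2 / \<sigma>2) + sqrt (\<mu> / \<sigma>2)"
  \<comment> \<open>The bound 1/8 forces \<open>l \<ge> \<mu> * x / 2\<close> inside the window,
    hence a lower bound for the second variance. The other bound makes the errors of centre (factor
    \<open>4 / \<sigma>2\<close>) and scale (factor \<open>K2\<close>) together at most
    \<open>\<epsilon> / 2\<close>.\<close>
  define \<epsilon>1 where "\<epsilon>1 = min (1 / 8) (\<epsilon> / 2 / (4 / \<sigma>2 + K2))"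
  have K2: "0 < K2" using sigma2_gt by (simp add: K2_def)
  have s4: "0 < 4 / \<sigma>2 + K2" using sigma2_gt K2 by (simp add: add_pos_pos)
  have \<epsilon>1: "0 < \<epsilon>1" "\<epsilon>1 \<le> 1 / 8" "(4 / \<sigma>2 + K2) * \<epsilon>1 \<le> \<epsilon> / 2"
  proof -
    show "0 < \<epsilon>1" using \<epsilon> s4 by (simp add: \<epsilon>1_def)
    show "\<epsilon>1 \<le> 1 / 8" unfolding \<epsilon>1_def by (rule min.cobounded1)
    have "\<epsilon>1 \<le> \<epsilon> / 2 / (4 / \<sigma>2 + K2)" unfolding \<epsilon>1_def by (rule min.cobounded2)
    then show "(4 / \<sigma>2 + K2) * \<epsilon>1 \<le> \<epsilon> / 2" using s4 by (simp only: pos_le_divide_eq mult.commute)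
  qed
  have e1: "\<forall>\<^sub>F x in sequentially. D * real x powr (- (p - 1) / 2) \<le> \<epsilon> / 2 * real x powr (- 1 / 2 - \<eta>)"
    using \<epsilon> p by (intro eventually_powr_le) (auto simp: field_simps)
  have e2: "\<forall>\<^sub>F x in sequentially. K3 * real x powr (- 2) \<le> \<epsilon> / 2 * real x powr (- 1 / 2 - \<eta>)"
    using \<epsilon> eta by (intro eventually_powr_le) auto
  have e3: "\<forall>\<^sub>F x in sequentially. \<mu> * real x powr 0 \<le> \<epsilon>1 * real x powr (1 / 2 - \<eta>)"
    using \<epsilon>1 eta by (intro eventually_powr_le) auto
  have e4: "\<forall>\<^sub>F x in sequentially. max (exp 1) (exp (4 / u\<^sup>2)) \<le> real x"
    using filterlim_real_sequentially unfolding filterlim_at_top by blast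
  \<comment> \<open>The time \<open>l\<close> is squeezed between \<open>mu (k - 1)\<close> and
    \<open>mu k\<close> with \<open>k = M_env \<omega> l\<close>; the larger window accommodates
    \<open>k - 1\<close> as well as \<open>k\<close>.\<close>
  have u1: "0 < u + 1" using u by simp
  from D s2_bounds mu_asymp[OF \<epsilon>1(1)] s2_asymp[OF \<epsilon>1(1)] mu_window[OF u1 \<epsilon>1(1)]
    eventually_b_scale_le[OF \<epsilon>1(1), of "\<mu> * u"] e1 e2 e3 e4
  show ?thesis
  proof eventually_elim
    case (elim x)
    define y where "y = real x powr (- 1 / 2 - \<eta>)"
    have xe: "exp 1 \<le> real x" "exp (4 / u\<^sup>2) \<le> real x" using elim(10) by auto
    then have x: "1 \<le> real x" using exp_ge_add_one_self[of 1] by linarith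
    note b = b_scale_bounds[OF xe(1)]
    have y1: "real x powr (1 / 2 - \<eta>) = real x * y"
      using x powr_add[of "real x" 1 "- 1 / 2 - \<eta>"] by (simp add: y_def)
    have y2: "real x powr (1 - \<eta>) = (real x * sqrt (real x)) * y"
      using x powr_add[of "real x" 1 "1 / 2"] powr_add[of "real x" "3 / 2" "- 1 / 2 - \<eta>"]
      by (simp add: y_def powr_half_sqrt)
    have y0: "0 < y" using x by (simp add: y_def)
    have y2x: "real x powr (1 - \<eta>) \<le> real x"
      using x eta powr_mono[of "1 - \<eta>" 1 "real x"] by simp
    have y12: "real x powr (1 / 2 - \<eta>) \<le> real x powr (1 - \<eta>)"
      using x by (intro powr_mono) auto
    define v where "v = s2 x"
    have v: "\<sigma>2 * real x / 2 \<le> v" "v \<le> 2 * \<sigma>2 * real x" using elim(2) by (auto simp: v_def)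
    have rpos: "0 < \<sigma>2 * real x / 2" using sigma2_gt x by simp
    then have v0: "0 < v" using v by linarith
    have ub2: "(u * b_scale x)\<^sup>2 = 32 * \<sigma>2 / c * (real x * ln (real x))"
      by (simp add: power_mult_distrib u b)
    have ub: "2 \<le> u * b_scale x"
    proof -
      have l: "4 / u\<^sup>2 \<le> ln (real x)" using x xe by (simp add: ln_ge_iff)
      then have "4 \<le> u\<^sup>2 * ln (real x)" using u(1) by (simp add: divide_le_eq mult.commute)
      also have "\<dots> \<le> u\<^sup>2 * (real x * ln (real x))"
        using x mult_right_mono[of 1 "real x" "ln (real x)"] by (intro mult_left_mono) auto
      also have "\<dots> = (u * b_scale x)\<^sup>2" by (simp add: power_mult_distrib b)
      finally have "2\<^sup>2 \<le> (u * b_scale x)\<^sup>2" by simp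
      then show ?thesis using u(1) b(1) by (intro power2_le_imp_le[of 2]) auto
    qed
    show ?case
    proof (intro allI impI)
      fix l assume l: "1 \<le> l \<and> c * real l \<le> real x"
      define k where "k = M_env \<omega> l"
      have k: "1 \<le> k" "real l \<le> mu k" "mu (k - 1) < real l"
        using M_env_bounds l by (simp_all add: k_def)
      define v' where "v' = real l * \<sigma>2 / \<mu>"
      have v'0: "0 < v'" using l sigma2_gt mu_gt by (simp add: v'_def)
      define z where "z = real l - mu x"
      \<comment> \<open>The signs are opposite, \<open>z\<close> being close to \<open>- z'\<close>;
        this is harmless because \<open>gauss s\<close> is even.\<close>
      define z' where "z' = \<mu> * (real x - real k)"
      have nd: "normal_density (mu x) (sqrt (s2 x)) (real l) = gauss (1 / sqrt v) z"
        using v0 by (simp add: normal_density_gauss v_def z_def)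
      have sd: "1 / \<mu> * site_density l x = gauss (1 / sqrt v') z'"
        unfolding v'_def z'_def k_def using l by (intro site_density_rescale) blast
      have llt: "\<bar>hitting \<omega> x l - gauss (1 / sqrt v) z\<bar> \<le> \<epsilon> / 2 * y"
        using order_trans[OF spec[OF elim(1), of l] elim(7)] unfolding nd y_def .
      have "\<bar>gauss (1 / sqrt v) z - gauss (1 / sqrt v') z'\<bar> \<le> \<epsilon> / 2 * y"
      proof (cases "\<bar>real k - real x\<bar> \<le> u * b_scale x")
        case True
        define e where "e = \<epsilon>1 * real x powr (1 / 2 - \<eta>)"
        have e: "\<mu> \<le> e" using elim(9) x unfolding e_def by simp
        have w1: "\<bar>mu k - mu x - \<mu> * (real k - real x)\<bar> \<le> e"
        proof -
          have "u * b_scale x \<le> (u + 1) * b_scale x" using b(1) by (intro mult_right_mono) auto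
          with True have "\<bar>real k - real x\<bar> \<le> (u + 1) * b_scale x" by linarith
          then show ?thesis using elim(5) unfolding e_def by blast
        qed
        have "\<bar>real (k - 1) - real x\<bar> \<le> u * b_scale x + 1" using True k(1) by (simp add: of_nat_diff)
        also have "\<dots> \<le> (u + 1) * b_scale x" using b(1) by (simp add: distrib_right)
        finally have "\<bar>mu (k - 1) - mu x - \<mu> * (real (k - 1) - real x)\<bar> \<le> e"
          using elim(5) unfolding e_def by blast
        then have w2: "\<bar>mu (k - 1) - mu x - \<mu> * (real k - 1 - real x)\<bar> \<le> e"
          using k(1) by (simp add: of_nat_diff)
        have "\<mu> * (real k - 1 - real x) = \<mu> * (real k - real x) - \<mu>" by (simp add: algebra_simps)
        moreover have "- z' = \<mu> * (real k - real x)" by (simp add: z'_def algebra_simps)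
        ultimately have zz: "\<bar>z - (- z')\<bar> \<le> 2 * e"
          using w1 w2 k(2,3) e unfolding z_def abs_le_iff by linarith
        have "\<bar>gauss (1 / sqrt v) z - gauss (1 / sqrt v) (- z')\<bar> \<le> (1 / sqrt v)\<^sup>2 * \<bar>z - (- z')\<bar>"
          using v0 by (intro gauss_lipschitz) auto
        also have "\<dots> \<le> (2 / (\<sigma>2 * real x)) * (2 * e)"
        proof (rule mult_mono[OF _ zz])
          have "1 / v \<le> 1 / (\<sigma>2 * real x / 2)" using v rpos by (intro divide_left_mono) auto
          then show "(1 / sqrt v)\<^sup>2 \<le> 2 / (\<sigma>2 * real x)" using v0 by (simp add: power_divide)
        qed (use rpos in auto)
        also have "\<dots> = 4 / \<sigma>2 * \<epsilon>1 * y" using x by (simp add: e_def y1)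
        finally have g1: "\<bar>gauss (1 / sqrt v) z - gauss (1 / sqrt v) (- z')\<bar> \<le> 4 / \<sigma>2 * \<epsilon>1 * y" .
        have "\<bar>z'\<bar> \<le> \<mu> * (u * b_scale x)"
          using True mu_gt by (simp add: z'_def abs_mult abs_minus_commute)
        then have z'le: "\<bar>z'\<bar> \<le> \<epsilon>1 * real x powr (1 - \<eta>)" using elim(6) by (simp add: mult.assoc)
        have e2: "e \<le> \<epsilon>1 * real x powr (1 - \<eta>)" unfolding e_def using y12 \<epsilon>1 by (intro mult_left_mono) auto
        have lx: "\<bar>real l - \<mu> * real x\<bar> \<le> 4 * \<epsilon>1 * real x powr (1 - \<eta>)"
          using z'le e2 elim(3) zz unfolding z_def abs_le_iff by linarith
        have "4 * \<epsilon>1 * real x powr (1 - \<eta>) \<le> 4 * (1 / 8) * real x"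
          using \<epsilon>1 y2x x by (intro mult_mono) auto
        also have "\<dots> \<le> \<mu> * real x / 2" using mu_gt x by simp
        finally have "\<mu> * real x / 2 \<le> real l" using lx unfolding abs_le_iff by linarith
        from mult_right_mono[OF this, of "\<sigma>2 / \<mu>"]
        have v': "\<sigma>2 * real x / 2 \<le> v'" using mu_gt sigma2_gt by (simp add: v'_def mult_ac)
        have vv': "\<bar>v - v'\<bar> \<le> (1 + 4 * \<sigma>2) * \<epsilon>1 * real x powr (1 - \<eta>)"
        proof -
          have "\<sigma>2 * real x - v' = (\<sigma>2 / \<mu>) * (\<mu> * real x - real l)"
            using mu_gt by (simp add: v'_def field_simps)
          then have "\<bar>\<sigma>2 * real x - v'\<bar> = (\<sigma>2 / \<mu>) * \<bar>real l - \<mu> * real x\<bar>"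
            using mu_gt sigma2_gt by (simp add: abs_mult abs_minus_commute)
          also have "\<dots> \<le> \<sigma>2 * (4 * \<epsilon>1 * real x powr (1 - \<eta>))"
            using mu_gt sigma2_gt lx by (intro mult_mono) (auto simp: divide_le_eq)
          finally have "\<bar>\<sigma>2 * real x - v'\<bar> \<le> \<sigma>2 * (4 * \<epsilon>1 * real x powr (1 - \<eta>))" .
          moreover have "\<bar>v - \<sigma>2 * real x\<bar> \<le> \<epsilon>1 * real x powr (1 - \<eta>)" using elim(4) by (simp add: v_def)
          ultimately have "\<bar>v - v'\<bar> \<le> \<epsilon>1 * real x powr (1 - \<eta>) + \<sigma>2 * (4 * \<epsilon>1 * real x powr (1 - \<eta>))"
            by linarith
          then show ?thesis by (simp add: algebra_simps)
        qed
        have "\<bar>gauss (1 / sqrt v) z' - gauss (1 / sqrt v') z'\<bar> \<le> \<bar>1 / sqrt v - 1 / sqrt v'\<bar>"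
          by (rule gauss_lipschitz_scale)
        also have "\<dots> \<le> \<bar>v - v'\<bar> / ((\<sigma>2 * real x / 2) * sqrt (\<sigma>2 * real x / 2))"
          by (rule inverse_sqrt_diff_le[OF rpos v(1) v'])
        also have "\<dots> \<le> ((1 + 4 * \<sigma>2) * \<epsilon>1 * real x powr (1 - \<eta>)) / ((\<sigma>2 * real x / 2) * sqrt (\<sigma>2 * real x / 2))"
          using vv' rpos by (intro divide_right_mono) auto
        also have "(\<sigma>2 * real x / 2) * sqrt (\<sigma>2 * real x / 2) = (\<sigma>2 / 2 * sqrt (\<sigma>2 / 2)) * (real x * sqrt (real x))"
          by (simp add: real_sqrt_mult real_sqrt_divide)
        also have "((1 + 4 * \<sigma>2) * \<epsilon>1 * real x powr (1 - \<eta>)) / ((\<sigma>2 / 2 * sqrt (\<sigma>2 / 2)) * (real x * sqrt (real x)))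
            = K2 * \<epsilon>1 * y"
          using x unfolding K2_def y2 by simp
        finally have g2: "\<bar>gauss (1 / sqrt v) z' - gauss (1 / sqrt v') z'\<bar> \<le> K2 * \<epsilon>1 * y" .
        have "\<bar>gauss (1 / sqrt v) z - gauss (1 / sqrt v') z'\<bar> \<le> 4 / \<sigma>2 * \<epsilon>1 * y + K2 * \<epsilon>1 * y"
          using g1 g2 unfolding gauss_minus by linarith
        also have "\<dots> = ((4 / \<sigma>2 + K2) * \<epsilon>1) * y" by (simp add: algebra_simps)
        also have "\<dots> \<le> \<epsilon> / 2 * y" using \<epsilon>1(3) y0 by (intro mult_right_mono) auto
        finally show ?thesis .
      next
        case False
        have pow: "exp (- (2 * ln (real x))) = real x powr (- 2)" using x by (simp add: powr_def)
        have lnx: "0 \<le> ln (real x)" using x by simp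
        \<comment> \<open>As \<open>mu\<close> grows by at least 1 per site, a distance between
          sites is at most the corresponding distance between times. To the right of
          \<open>x\<close> one unit is lost, since only \<open>mu (k - 1) < l\<close> is known;
          \<open>u * b_scale x \<ge> 2\<close> turns this into a factor 2.\<close>
        have "u * b_scale x - 1 \<le> \<bar>z\<bar>"
        proof (cases "x \<le> k - 1")
          case True
          then have "real (k - 1) - real x \<le> mu (k - 1) - mu x" by (rule mu_mono_diff)
          then have "real k - 1 - real x \<le> z" using k by (simp add: z_def of_nat_diff)
          then show ?thesis using False True k(1) by auto
        next
          case le: False
          then have "k \<le> x" by auto
          from mu_mono_diff[OF this] have "real x - real k \<le> - z" using k by (simp add: z_def)
          then show ?thesis using False \<open>k \<le> x\<close> by auto
        qed
        then have "u * b_scale x / 2 \<le> \<bar>z\<bar>" using ub by linarith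
        then have "(u * b_scale x / 2)\<^sup>2 \<le> \<bar>z\<bar>\<^sup>2" using ub by (intro power_mono) auto
        then have "8 * \<sigma>2 / c * (real x * ln (real x)) \<le> z\<^sup>2"
          by (simp add: power_divide ub2)
        moreover have "8 * \<sigma>2 * (real x * ln (real x)) \<le> 8 * \<sigma>2 / c * (real x * ln (real x))"
          using c sigma2_gt x lnx by (intro mult_right_mono) (auto simp: le_divide_eq)
        ultimately have "8 * \<sigma>2 * (real x * ln (real x)) \<le> z\<^sup>2" by linarith
        moreover have "2 * (2 * ln (real x)) * v \<le> 2 * (2 * ln (real x)) * (2 * \<sigma>2 * real x)"
          using v(2) lnx by (intro mult_left_mono) auto
        ultimately have "2 * (2 * ln (real x)) * v \<le> z\<^sup>2" by (simp add: mult_ac)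
        then have "2 * ln (real x) \<le> (1 / sqrt v * z)\<^sup>2 / 2"
          using v0 by (simp add: power_mult_distrib power_divide le_divide_eq mult_ac)
        then have "gauss (1 / sqrt v) z \<le> 1 / sqrt v * exp (- (2 * ln (real x)))"
          using v0 by (intro gauss_le) auto
        also have "\<dots> \<le> sqrt (2 / \<sigma>2) * exp (- (2 * ln (real x)))"
        proof (rule mult_right_mono)
          have "\<sigma>2 * 1 \<le> \<sigma>2 * real x" using x sigma2_gt by (intro mult_left_mono) auto
          then have "\<sigma>2 / 2 \<le> v" using v(1) by linarith
          then have "1 / v \<le> 2 / \<sigma>2" using sigma2_gt v0 by (simp add: field_simps)
          then show "1 / sqrt v \<le> sqrt (2 / \<sigma>2)" by (metis real_sqrt_le_mono real_sqrt_divide real_sqrt_one)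
        qed auto
        finally have h1: "gauss (1 / sqrt v) z \<le> sqrt (2 / \<sigma>2) * real x powr (- 2)" by (simp add: pow)
        have "(u * b_scale x)\<^sup>2 \<le> \<bar>real k - real x\<bar>\<^sup>2" using False ub by (intro power_mono) auto
        also have "\<dots> \<le> z'\<^sup>2"
          using mu_gt mult_right_mono[of 1 "\<mu>\<^sup>2" "(real k - real x)\<^sup>2"]
          by (simp add: z'_def power_mult_distrib power2_commute)
        finally have z'2: "32 * \<sigma>2 / c * (real x * ln (real x)) \<le> z'\<^sup>2" by (simp add: ub2)
        have "2 * (2 * ln (real x)) * v' \<le> 2 * (2 * ln (real x)) * (\<sigma>2 / c * real x)"
        proof (rule mult_left_mono)
          have "v' \<le> real l * \<sigma>2" using mu_gt sigma2_gt mult_right_mono[of 1 \<mu> "real l * \<sigma>2"]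
            by (simp add: v'_def divide_le_eq mult_ac)
          also have "\<dots> \<le> (real x / c) * \<sigma>2" using l c sigma2_gt by (intro mult_right_mono) (auto simp: le_divide_eq mult.commute)
          finally show "v' \<le> \<sigma>2 / c * real x" by (simp add: mult_ac)
        qed (use lnx in auto)
        also have "\<dots> = 4 * (\<sigma>2 / c * (real x * ln (real x)))" by simp
        also have "\<dots> \<le> 32 * (\<sigma>2 / c * (real x * ln (real x)))"
          using sigma2_gt c x lnx by (intro mult_right_mono) auto
        also have "\<dots> \<le> z'\<^sup>2" using z'2 by simp
        finally have "2 * ln (real x) \<le> (1 / sqrt v' * z')\<^sup>2 / 2"
          using v'0 by (simp add: power_mult_distrib power_divide le_divide_eq mult_ac)
        then have "gauss (1 / sqrt v') z' \<le> 1 / sqrt v' * exp (- (2 * ln (real x)))"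
          using v'0 by (intro gauss_le) auto
        also have "\<dots> \<le> sqrt (\<mu> / \<sigma>2) * exp (- (2 * ln (real x)))"
        proof (rule mult_right_mono)
          have "\<sigma>2 / \<mu> \<le> v'" using l mu_gt sigma2_gt by (auto simp: v'_def intro!: divide_right_mono)
          then have "1 / v' \<le> 1 / (\<sigma>2 / \<mu>)" using sigma2_gt mu_gt v'0 by (intro divide_left_mono) auto
          then have "1 / v' \<le> \<mu> / \<sigma>2" by simp
          then show "1 / sqrt v' \<le> sqrt (\<mu> / \<sigma>2)" by (metis real_sqrt_le_mono real_sqrt_divide real_sqrt_one)
        qed auto
        finally have h2: "gauss (1 / sqrt v') z' \<le> sqrt (\<mu> / \<sigma>2) * real x powr (- 2)" by (simp add: pow)
        have "0 \<le> gauss (1 / sqrt v) z" "0 \<le> gauss (1 / sqrt v') z'"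
          using v0 v'0 by (simp_all add: gauss_nonneg)
        then have "\<bar>gauss (1 / sqrt v) z - gauss (1 / sqrt v') z'\<bar> \<le> K3 * real x powr (- 2)"
          using h1 h2 unfolding K3_def distrib_right abs_le_iff by linarith
        also have "\<dots> \<le> \<epsilon> / 2 * y" using elim(8) by (simp add: y_def)
        finally show ?thesis .
      qed
      then show "\<bar>hitting \<omega> x l - 1 / \<mu> * site_density l x\<bar> \<le> \<epsilon> * real x powr (- 1 / 2 - \<eta>)"
        using llt unfolding sd y_def[symmetric] by linarith
    qed
  qed
qed

end

subsection \<open>Summation over the hitting time\<close>

context walk_env
begin

lemma hitting_sum_asymp_far:
  assumes c: "0 < c" "c \<le> 1" and \<delta>: "0 < \<delta>"
  shows "\<forall>\<^sub>F n in sequentially. \<forall>x. c * real n \<le> real x \<longrightarrow>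
    \<bar>(\<Sum>l\<le>n. hitting \<omega> x l * \<omega> x (n - l)) - 1 / \<mu> * (\<Sum>l=1..n. site_density l x * \<omega> x (n - l))\<bar>
    \<le> \<delta> * real n powr (- 1 / 2)"
proof -
  \<comment> \<open>\<open>K * x powr \<eta>\<close> bounds the mean holding time at
    \<open>x\<close>, the 2 absorbing the shift from \<open>x + 1\<close> to \<open>x\<close>. In
    \<open>\<epsilon>\<close> below, \<open>sqrt c\<close> pays for the passage from
    \<open>x\<close> to \<open>n\<close> through \<open>x \<ge> c * n\<close>.\<close>
  define K where "K = 2 * (mom * C)"
  have K: "0 < K" using mom_ge C_ge by (simp add: K_def)
  define \<epsilon> where "\<epsilon> = \<delta> * sqrt c / K"
  have \<epsilon>: "0 < \<epsilon>" using \<delta> c K by (simp add: \<epsilon>_def)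
  from hitting_density[OF \<epsilon> c] obtain X where X: "\<And>x l. X \<le> x \<Longrightarrow> 1 \<le> l \<Longrightarrow> c * real l \<le> real x \<Longrightarrow>
    \<bar>hitting \<omega> x l - 1 / \<mu> * site_density l x\<bar> \<le> \<epsilon> * real x powr (- 1 / 2 - \<eta>)"
    unfolding eventually_at_top_linorder by blast
  have "\<forall>\<^sub>F n in sequentially. max 1 (real X) / c \<le> real n"
    using filterlim_real_sequentially unfolding filterlim_at_top by blast
  then show ?thesis
  proof eventually_elim
    case (elim n)
    then have n: "max 1 (real X) \<le> c * real n" using c by (simp add: divide_le_eq mult.commute)
    then have n0: "0 < real n" using c by (cases "n = 0") auto
    show ?case
    proof (intro allI impI)
      fix x assume cx: "c * real n \<le> real x"
      then have x: "1 \<le> x" "X \<le> x" using n by auto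
      have mean_le_x: "mean (\<omega> x) \<le> mom * a x" by (rule mean_le)
      interpret tail_seq "\<omega> x" "a x" b by (rule tail)
      \<comment> \<open>A column \<open>x \<ge> 1\<close> cannot be reached at time 0, so the sum
        may start at 1 like that of the Gaussians.\<close>
      have "(\<Sum>l\<le>n. hitting \<omega> x l * \<omega> x (n - l)) = (\<Sum>l=1..n. hitting \<omega> x l * \<omega> x (n - l))"
      proof (rule sum.mono_neutral_right)
        have "hitting \<omega> x 0 = 0" using x(1) by (cases x) (simp_all del: hitting.simps)
        then show "\<forall>l\<in>{..n} - {1..n}. hitting \<omega> x l * \<omega> x (n - l) = 0"
          by (auto simp: not_less_eq_eq le_Suc_eq)
      qed auto
      then have "(\<Sum>l\<le>n. hitting \<omega> x l * \<omega> x (n - l)) - 1 / \<mu> * (\<Sum>l=1..n. site_density l x * \<omega> x (n - l))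
          = (\<Sum>l=1..n. (hitting \<omega> x l - 1 / \<mu> * site_density l x) * \<omega> x (n - l))"
        by (simp add: sum_distrib_left sum_subtractf left_diff_distrib)
      also have "\<bar>\<dots>\<bar> \<le> (\<Sum>l=1..n. \<epsilon> * real x powr (- 1 / 2 - \<eta>) * \<omega> x (n - l))"
      proof (rule order_trans[OF sum_abs sum_mono])
        fix l assume l: "l \<in> {1..n}"
        then have "c * real l \<le> c * real n" using c by (intro mult_left_mono) auto
        then have "\<bar>hitting \<omega> x l - 1 / \<mu> * site_density l x\<bar> \<le> \<epsilon> * real x powr (- 1 / 2 - \<eta>)"
          using X[OF x(2), of l] l cx by auto
        then show "\<bar>(hitting \<omega> x l - 1 / \<mu> * site_density l x) * \<omega> x (n - l)\<bar>
            \<le> \<epsilon> * real x powr (- 1 / 2 - \<eta>) * \<omega> x (n - l)"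
          using w_pos[of "n - l"] by (simp add: abs_mult mult_right_mono)
      qed
      also have "\<dots> = \<epsilon> * real x powr (- 1 / 2 - \<eta>) * (\<Sum>l=1..n. \<omega> x (n - l))"
        by (simp add: sum_distrib_left)
      also have "\<dots> \<le> \<epsilon> * real x powr (- 1 / 2 - \<eta>) * (K * real x powr \<eta>)"
      proof (rule mult_left_mono)
        have "(\<Sum>l=1..n. \<omega> x (n - l)) = (\<Sum>j<n. \<omega> x j)"
          by (rule sum.reindex_bij_witness[of _ "\<lambda>j. n - j" "\<lambda>l. n - l"]) auto
        also have "\<dots> \<le> mean (\<omega> x)"
          unfolding mean_def using summable_w w_pos by (intro sum_le_suminf) (auto simp: less_imp_le)
        also have "\<dots> \<le> mom * (C * real (x + 1) powr \<eta>)"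
          using mean_le_x mult_left_mono[OF a_growth[of x], of mom] mom_ge by linarith
        also have "\<dots> \<le> mom * (C * (2 * real x powr \<eta>))"
        proof -
          have "real (x + 1) powr \<eta> \<le> (2 * real x) powr \<eta>" using x eta by (intro powr_mono2) auto
          also have "\<dots> = 2 powr \<eta> * real x powr \<eta>" by (simp add: powr_mult)
          also have "\<dots> \<le> 2 powr 1 * real x powr \<eta>" using eta by (intro mult_right_mono powr_mono) auto
          finally show ?thesis using mom_ge C_ge by (intro mult_left_mono) auto
        qed
        finally show "(\<Sum>l=1..n. \<omega> x (n - l)) \<le> K * real x powr \<eta>" by (simp add: K_def)
      qed (use \<epsilon> in auto)
      also have "\<dots> = \<delta> * sqrt c * real x powr (- 1 / 2)"
      proof -
        have "real x powr (- 1 / 2 - \<eta>) * real x powr \<eta> = real x powr (- 1 / 2)"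
          unfolding powr_add[symmetric] by simp
        then show ?thesis using K by (simp add: \<epsilon>_def)
      qed
      also have "\<dots> \<le> \<delta> * sqrt c * (c * real n) powr (- 1 / 2)"
        using cx n0 c \<delta> by (intro mult_left_mono powr_mono2') auto
      also have "\<dots> = \<delta> * real n powr (- 1 / 2)"
      proof -
        have "sqrt c * c powr (- 1 / 2) = 1"
          using c by (simp add: powr_half_sqrt[symmetric] powr_add[symmetric])
        then show ?thesis by (simp add: powr_mult)
      qed
      finally show "\<bar>(\<Sum>l\<le>n. hitting \<omega> x l * \<omega> x (n - l)) - 1 / \<mu> * (\<Sum>l=1..n. site_density l x * \<omega> x (n - l))\<bar>
          \<le> \<delta> * real n powr (- 1 / 2)" .
    qed
  qed
qed

text \<open>For \<open>2 * l \<le> n\<close> the tail \<open>\<omega> x (n - l)\<close> is small. For \<open>2 * l > n\<close> the distance from \<open>l\<close> to \<open>mu x\<close>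
  and the one from \<open>M_env \<omega> l\<close> to \<open>x\<close> are of order \<open>n\<close>.\<close>

lemma hitting_sum_near:
  fixes n x
  defines "W \<equiv> C * 2 * 2 powr b * real n powr (\<eta> - b)"
    and "t \<equiv> \<sigma>2 / \<mu> ^ 3" and "c \<equiv> 1 / (4 * (mom * C))"
  assumes n: "2 \<le> n" and x: "real x < c * real n"
  shows "0 \<le> (\<Sum>l\<le>n. hitting \<omega> x l * \<omega> x (n - l))"
    and "(\<Sum>l\<le>n. hitting \<omega> x l * \<omega> x (n - l)) \<le> W + 4 / real n"
    and "0 \<le> 1 / \<mu> * (\<Sum>l=1..n. site_density l x * \<omega> x (n - l))"
    and "1 / \<mu> * (\<Sum>l=1..n. site_density l x * \<omega> x (n - l))
      \<le> real n * (1 / sqrt t * (W + exp (- (c\<^sup>2 / (2 * t) * real n))))"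
proof -
  interpret tail_seq "\<omega> x" "a x" b by (rule tail)
  have C1: "1 \<le> mom * C" using mult_mono[of 1 mom 1 C] mom_ge C_ge by simp
  \<comment> \<open>By the choice of \<open>c\<close>, \<open>mu x \<le> n / 4\<close>, so for
    \<open>2 * l > n\<close> the time \<open>l\<close> exceeds \<open>mu x\<close> by at least
    \<open>n / 4\<close>. Likewise \<open>M_env \<omega> l \<ge> 2 * c * n\<close>, which exceeds
    \<open>x\<close> by at least \<open>c * n\<close>.\<close>
  have c: "0 < c" "c \<le> 1" "mom * C * c = 1 / 4" using C1 by (auto simp: c_def field_simps)
  have t: "0 < t" using sigma2_gt mu_gt by (simp add: t_def)
  have w1: "\<omega> x k \<le> 1" for k
    using decseq_SucI[of "\<omega> x"] w_dec w_0 by (metis decseq_def less_imp_le le0)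
  have w0: "0 \<le> \<omega> x k" for k using w_pos[of k] by simp
  have near: "\<omega> x (n - l) \<le> W" if "2 * l \<le> n" for l
  proof -
    have nl: "1 \<le> n - l" "real n / 2 \<le> real (n - l)" using that n by (auto simp: of_nat_diff)
    have "\<omega> x (n - l) \<le> a x * real (n - l) powr (- b)" using nl by (intro w_le)
    also have "\<dots> \<le> a x * (real n / 2) powr (- b)"
      using nl n b_gt a_ge by (intro mult_left_mono powr_mono2') auto
    also have "\<dots> \<le> (C * (2 * real n powr \<eta>)) * (real n / 2) powr (- b)"
    proof (rule mult_right_mono)
      have "c * real n \<le> 1 * real n" using c by (intro mult_right_mono) auto
      then have "real x < real n" using x by linarith
      then have "real (x + 1) \<le> 2 * real n" using n by simp
      then have "real (x + 1) powr \<eta> \<le> (2 * real n) powr \<eta>" using eta by (intro powr_mono2) auto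
      also have "\<dots> = 2 powr \<eta> * real n powr \<eta>" by (simp add: powr_mult)
      also have "\<dots> \<le> 2 powr 1 * real n powr \<eta>" using eta by (intro mult_right_mono powr_mono) auto
      finally have "C * real (x + 1) powr \<eta> \<le> C * (2 * real n powr \<eta>)"
        using C_ge by (intro mult_left_mono) auto
      then show "a x \<le> C * (2 * real n powr \<eta>)" using a_growth[of x] by linarith
    qed auto
    also have "(real n / 2) powr (- b) = real n powr (- b) * 2 powr b"
      by (simp add: powr_divide powr_minus_divide)
    also have "C * (2 * real n powr \<eta>) * (real n powr (- b) * 2 powr b) = W"
      by (simp add: W_def powr_add[symmetric] mult_ac diff_conv_add_uminus del: add_uminus_conv_diff)
    finally show ?thesis .
  qed
  have W0: "0 \<le> W" using C_ge by (simp add: W_def)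
  show "0 \<le> (\<Sum>l\<le>n. hitting \<omega> x l * \<omega> x (n - l))"
    using hitting_nonneg w0 by (intro sum_nonneg mult_nonneg_nonneg)
  have C1c: "mom * C * real x \<le> real n / 4"
    using mult_left_mono[of "real x" "c * real n" "mom * C"] x C1 c(3)
    by (metis (no_types, opaque_lifting) less_imp_le mult.assoc mult.commute mult.left_neutral order_trans times_divide_eq_right zero_le_one)
  have s: "(\<lambda>l. W * hitting \<omega> x l + 16 / (real n)\<^sup>2 * (hitting \<omega> x l * (real l - mu x)\<^sup>2)) sums
      (W * 1 + 16 / (real n)\<^sup>2 * s2 x)"
    by (intro sums_add sums_mult hitting_sums hitting_square_diff)
  \<comment> \<open>Chebyshev's inequality in summed form: \<open>\<omega> x (n - l)\<close> is
    dominated by \<open>W\<close> plus a multiple of the squared deviation that is at least 1 for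
    \<open>2 * l > n\<close>.\<close>
  have "(\<Sum>l\<le>n. hitting \<omega> x l * \<omega> x (n - l))
      \<le> (\<Sum>l\<le>n. W * hitting \<omega> x l + 16 / (real n)\<^sup>2 * (hitting \<omega> x l * (real l - mu x)\<^sup>2))"
  proof (rule sum_mono)
    fix l
    have "\<omega> x (n - l) \<le> W + 16 / (real n)\<^sup>2 * (real l - mu x)\<^sup>2"
    proof (cases "2 * l \<le> n")
      case True
      then show ?thesis using near[OF True] by (simp add: add_increasing2)
    next
      case False
      then have "real n / 4 \<le> real l - mu x" using mu_le[of x] C1c by linarith
      then have "(real n / 4)\<^sup>2 \<le> (real l - mu x)\<^sup>2" by (intro power_mono) auto
      then have "1 \<le> 16 / (real n)\<^sup>2 * (real l - mu x)\<^sup>2" using n by (simp add: field_simps)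
      then show ?thesis using w1[of "n - l"] W0 by linarith
    qed
    from mult_left_mono[OF this hitting_nonneg[of x l]]
    show "hitting \<omega> x l * \<omega> x (n - l)
        \<le> W * hitting \<omega> x l + 16 / (real n)\<^sup>2 * (hitting \<omega> x l * (real l - mu x)\<^sup>2)"
      by (simp add: algebra_simps)
  qed
  also have "\<dots> \<le> W * 1 + 16 / (real n)\<^sup>2 * s2 x"
    using s W0 hitting_nonneg by (subst sums_unique[OF s], intro sum_le_suminf) (auto simp: sums_iff)
  also have "\<dots> \<le> W * 1 + 16 / (real n)\<^sup>2 * (real n / 4)"
    using s2_le[of x] C1c by (intro add_left_mono mult_left_mono) auto
  also have "\<dots> = W + 4 / real n" using n by (simp add: power2_eq_square)
  finally show "(\<Sum>l\<le>n. hitting \<omega> x l * \<omega> x (n - l)) \<le> W + 4 / real n" .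
  have sd0: "0 \<le> site_density l x" for l by (simp add: site_density_def)
  then have sum0: "0 \<le> (\<Sum>l=1..n. site_density l x * \<omega> x (n - l))"
    using w0 by (intro sum_nonneg mult_nonneg_nonneg)
  then show "0 \<le> 1 / \<mu> * (\<Sum>l=1..n. site_density l x * \<omega> x (n - l))" using mu_gt by simp
  define E where "E = exp (- (c\<^sup>2 / (2 * t) * real n))"
  have "1 / \<mu> * (\<Sum>l=1..n. site_density l x * \<omega> x (n - l)) \<le> 1 * (\<Sum>l=1..n. site_density l x * \<omega> x (n - l))"
    using mu_gt sum0 by (intro mult_right_mono) auto
  also have "\<dots> \<le> (\<Sum>l=1..n. 1 / sqrt t * (W + E))"
    unfolding mult_1
  proof (rule sum_mono)
    fix l assume l: "l \<in> {1..n}"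
    define M where "M = M_env \<omega> l"
    have lt: "0 < real l * t" using l t by simp
    have sd: "site_density l x = gauss (1 / sqrt (real l * t)) (real x - real M)"
      using lt unfolding site_density_def t_def[symmetric] M_def by (simp only: normal_density_gauss real_sqrt_gt_zero)
    have "t \<le> real l * t" using l t by simp
    then have rt: "1 / sqrt (real l * t) \<le> 1 / sqrt t" using t by (intro divide_left_mono) auto
    show "site_density l x * \<omega> x (n - l) \<le> 1 / sqrt t * (W + E)"
    proof (cases "2 * l \<le> n")
      case True
      have "site_density l x \<le> 1 / sqrt (real l * t) * exp (- 0)"
        unfolding sd using lt by (intro gauss_le) auto
      then have "site_density l x \<le> 1 / sqrt t" using rt by simp
      then have "site_density l x * \<omega> x (n - l) \<le> 1 / sqrt t * W"
        using near[OF True] sd0 w0 t by (intro mult_mono) auto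
      also have "\<dots> \<le> 1 / sqrt t * (W + E)" using t by (intro mult_left_mono) (auto simp: E_def)
      finally show ?thesis .
    next
      case False
      have "real l \<le> mom * C * real M" using M_env_bounds(2)[of l] mu_le[of M] l by (simp add: M_def)
      then have "real n / 2 \<le> mom * C * real M" using False by linarith
      then have "c * (real n / 2) \<le> c * (mom * C * real M)" using c by (intro mult_left_mono) auto
      also have "\<dots> = real M / 4" using c(3) by (simp add: mult_ac)
      finally have "c * real n \<le> real M - real x" using x by simp
      then have "(c * real n)\<^sup>2 \<le> (real M - real x)\<^sup>2" using c by (intro power_mono) auto
      then have d: "c\<^sup>2 * (real n)\<^sup>2 \<le> (real x - real M)\<^sup>2" by (simp add: power_mult_distrib power2_commute)
      have "c\<^sup>2 * real n * real l \<le> c\<^sup>2 * real n * real n" using l by (intro mult_left_mono) auto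
      with d have "c\<^sup>2 * real n * real l \<le> (real x - real M)\<^sup>2" by (simp add: power2_eq_square)
      then have "c\<^sup>2 / (2 * t) * real n \<le> (1 / sqrt (real l * t) * (real x - real M))\<^sup>2 / 2"
        using lt l t by (simp add: power_mult_distrib power_divide field_simps)
      then have "site_density l x \<le> 1 / sqrt (real l * t) * E"
        unfolding sd E_def using lt by (intro gauss_le) auto
      also have "\<dots> \<le> 1 / sqrt t * E" using rt by (intro mult_right_mono) (auto simp: E_def)
      finally have "site_density l x * \<omega> x (n - l) \<le> (1 / sqrt t * E) * 1"
        using w0 w1 sd0 t by (intro mult_mono) (auto simp: E_def)
      also have "\<dots> \<le> 1 / sqrt t * (W + E)" using t W0 by (simp add: divide_right_mono)
      finally show ?thesis .
    qed
  qed
  also have "\<dots> = real n * (1 / sqrt t * (W + E))" by simp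
  finally show "1 / \<mu> * (\<Sum>l=1..n. site_density l x * \<omega> x (n - l)) \<le> real n * (1 / sqrt t * (W + exp (- (c\<^sup>2 / (2 * t) * real n))))"
    by (simp add: E_def)
qed

lemma hitting_sum_asymp:
  assumes \<delta>: "0 < \<delta>"
  shows "\<forall>\<^sub>F n in sequentially. \<forall>x.
    \<bar>(\<Sum>l\<le>n. hitting \<omega> x l * \<omega> x (n - l)) - 1 / \<mu> * (\<Sum>l=1..n. site_density l x * \<omega> x (n - l))\<bar>
    \<le> \<delta> * real n powr (- 1 / 2)"
proof -
  define t where "t = \<sigma>2 / \<mu> ^ 3"
  define c where "c = 1 / (4 * (mom * C))"
  define B where "B = C * 2 * 2 powr b"
  have C1: "1 \<le> mom * C" using mult_mono[of 1 mom 1 C] mom_ge C_ge by simp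
  have c: "0 < c" "c \<le> 1" using C1 by (auto simp: c_def field_simps)
  have t: "0 < t" using sigma2_gt mu_gt by (simp add: t_def)
  define \<gamma> where "\<gamma> = c\<^sup>2 / (2 * t)"
  have \<gamma>: "0 < \<gamma>" using c t by (simp add: \<gamma>_def)
  have b: "2 < b" by (rule tail_seq.b_gt[OF tail])
  have \<delta>4: "0 < \<delta> / 4" using \<delta> by simp
  have e1: "\<forall>\<^sub>F n in sequentially. B * real n powr (\<eta> - b) \<le> \<delta> / 4 * real n powr (- 1 / 2)"
    using \<delta>4 eta b by (intro eventually_powr_le) auto
  have e2: "\<forall>\<^sub>F n in sequentially. 4 * real n powr (- 1) \<le> \<delta> / 4 * real n powr (- 1 / 2)"
    using \<delta>4 by (intro eventually_powr_le) auto
  \<comment> \<open>Bounding the Gaussian sum by \<open>n\<close> times its largest summand is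
    affordable: \<open>1 + \<eta> - b < -1/2\<close>, as \<open>\<eta> < 1/2\<close> and
    \<open>b > 2\<close>.\<close>
  have e3: "\<forall>\<^sub>F n in sequentially. (1 / sqrt t * B) * real n powr (1 + \<eta> - b) \<le> \<delta> / 4 * real n powr (- 1 / 2)"
    using \<delta>4 eta b by (intro eventually_powr_le) auto
  have "(\<lambda>n::nat. real n * exp (- (\<gamma> * real n))) \<in> o(\<lambda>n. real n powr (- 1 / 2))"
    using \<gamma> by real_asymp
  then have e4: "\<forall>\<^sub>F n in sequentially. norm (real n * exp (- (\<gamma> * real n))) \<le> (\<delta> / 4 * sqrt t) * norm (real n powr (- 1 / 2))"
    using \<delta> t by (intro landau_o.smallD) auto
  from hitting_sum_asymp_far[OF c \<delta>] e1 e2 e3 e4 eventually_ge_at_top[of 2]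
  show ?thesis
  proof eventually_elim
    case (elim n)
    have n: "2 \<le> n" by fact
    show ?case
    proof
      fix x
      define A where "A = (\<Sum>l\<le>n. hitting \<omega> x l * \<omega> x (n - l))"
      define A' where "A' = 1 / \<mu> * (\<Sum>l=1..n. site_density l x * \<omega> x (n - l))"
      show "\<bar>A - A'\<bar> \<le> \<delta> * real n powr (- 1 / 2)"
      proof (cases "c * real n \<le> real x")
        case True
        then show ?thesis using elim(1) by (simp add: A_def A'_def)
      next
        case False
        then have x: "real x < 1 / (4 * (mom * C)) * real n" by (simp add: c_def)
        note near = hitting_sum_near[OF n x, folded A_def A'_def c_def t_def, folded B_def, folded \<gamma>_def]
        have p1: "real n powr (- 1) = 1 / real n" using n by (simp add: powr_minus_divide)
        have p2: "real n * real n powr (\<eta> - b) = real n powr (1 + \<eta> - b)"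
          using n powr_add[of "real n" 1 "\<eta> - b"] by (simp add: algebra_simps)
        have "real n * (1 / sqrt t * (B * real n powr (\<eta> - b) + exp (- (\<gamma> * real n))))
          = (1 / sqrt t * B) * real n powr (1 + \<eta> - b) + (real n * exp (- (\<gamma> * real n))) / sqrt t"
          unfolding p2[symmetric] by (simp add: algebra_simps)
        moreover have "(real n * exp (- (\<gamma> * real n))) / sqrt t \<le> \<delta> / 4 * real n powr (- 1 / 2)"
          using elim(5) t by (simp add: divide_le_eq mult_ac)
        ultimately have "A' \<le> \<delta> / 2 * real n powr (- 1 / 2)" using near(4) elim(4) by linarith
        moreover have "A \<le> \<delta> / 2 * real n powr (- 1 / 2)" using near(2) elim(2,3) unfolding p1 by linarith
        moreover have "0 \<le> \<delta> / 2 * real n powr (- 1 / 2)" using \<delta> by simp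
        ultimately show ?thesis using near(1,3) unfolding abs_le_iff by linarith
      qed
    qed
  qed
qed

end

subsection \<open>Tail bounds of the environment\<close>

lemma powr_neg_diff_ge:
  assumes "1 \<le> \<beta>" "1 \<le> n"
  shows "real (Suc n) powr (- (\<beta> + 1)) \<le> real n powr (- \<beta>) - real (Suc n) powr (- \<beta>)"
proof -
  obtain z where z: "real n < z" "z < real (Suc n)"
    "real (Suc n) powr (- \<beta>) - real n powr (- \<beta>) = (real (Suc n) - real n) * (- \<beta> * z powr (- \<beta> - 1))"
  proof -
    have "((\<lambda>x. x powr (- \<beta>)) has_real_derivative - \<beta> * x powr (- \<beta> - 1)) (at x)" if "real n \<le> x" for x
      using assms that by (intro has_real_derivative_powr) auto
    then have "\<exists>z>real n. z < real (Suc n) \<and>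
        real (Suc n) powr (- \<beta>) - real n powr (- \<beta>) = (real (Suc n) - real n) * (- \<beta> * z powr (- \<beta> - 1))"
      by (intro MVT2) auto
    then show thesis using that by blast
  qed
  have "1 * real (Suc n) powr (- \<beta> - 1) \<le> \<beta> * z powr (- \<beta> - 1)"
    using z assms by (intro mult_mono powr_mono2') auto
  moreover have "- (\<beta> + 1) = - \<beta> - 1" by simp
  ultimately show ?thesis using z(3) by (simp only:) simp
qed

text \<open>Bounds on the differences telescope to a bound on the tail. By
  \<open>powr_neg_diff_ge\<close> the power \<open>-(\<beta> + 1)\<close> is dominated by a
  difference of powers \<open>-\<beta>\<close>, with constant 1 since \<open>\<beta>\<close> is at
  least 1; hence no factor is lost.\<close>

lemma A_env_le_A'_env:
  assumes env: "environment \<omega>" and \<beta>: "1 \<le> \<beta> x" and fin: "A'_env \<omega> \<beta> x < \<infinity>"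
  shows "A_env \<omega> \<beta> x \<le> A'_env \<omega> \<beta> x"
proof -
  define c where "c = real_of_ereal (A'_env \<omega> \<beta> x)"
  have ge1: "1 \<le> A'_env \<omega> \<beta> x" by (simp add: A'_env_def)
  then have c: "A'_env \<omega> \<beta> x = ereal c"
    using fin unfolding c_def by (cases "A'_env \<omega> \<beta> x") auto
  have c1: "1 \<le> c" using ge1 by (simp add: c)
  have lim: "\<omega> x \<longlonglongrightarrow> 0" using env by (simp add: environment_def)
  have diff: "\<omega> x k - \<omega> x (Suc k) \<le> c * real (Suc k) powr (- (\<beta> x + 1))" for k
  proof -
    have "ereal (real (Suc k) powr (\<beta> x + 1) * (\<omega> x (Suc k - 1) - \<omega> x (Suc k)))
        \<le> (SUP n\<in>{1..}. ereal (real n powr (\<beta> x + 1) * (\<omega> x (n - 1) - \<omega> x n)))"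
      by (rule SUP_upper) auto
    also have "\<dots> \<le> ereal c" unfolding c[symmetric] A'_env_def by simp
    finally have "real (Suc k) powr (\<beta> x + 1) * (\<omega> x k - \<omega> x (Suc k)) \<le> c" by simp
    then have "real (Suc k) powr (\<beta> x + 1) * (\<omega> x k - \<omega> x (Suc k)) * real (Suc k) powr (- (\<beta> x + 1))
        \<le> c * real (Suc k) powr (- (\<beta> x + 1))" by (rule mult_right_mono) auto
    moreover have "real (Suc k) powr (\<beta> x + 1) * real (Suc k) powr (- (\<beta> x + 1)) = 1"
      unfolding powr_add[symmetric] by simp
    ultimately show ?thesis by (metis mult.assoc mult.commute mult_1)
  qed
  have main: "real n powr \<beta> x * \<omega> x n \<le> c" if n: "1 \<le> n" for n
  proof -
    have step: "\<omega> x n - \<omega> x (n + j) \<le> c * (real n powr (- \<beta> x) - real (n + j) powr (- \<beta> x))" for j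
    proof (induction j)
      case (Suc j)
      have "\<omega> x (n + j) - \<omega> x (Suc (n + j)) \<le> c * real (Suc (n + j)) powr (- (\<beta> x + 1))" by (rule diff)
      also have "\<dots> \<le> c * (real (n + j) powr (- \<beta> x) - real (Suc (n + j)) powr (- \<beta> x))"
        using c1 \<beta> n by (intro mult_left_mono powr_neg_diff_ge) auto
      finally show ?case using Suc by (simp only: add_Suc_right right_diff_distrib)
    qed simp
    have "\<omega> x n - \<omega> x (j + n) \<le> c * real n powr (- \<beta> x)" for j
    proof -
      have "0 \<le> c * real (n + j) powr (- \<beta> x)" using c1 by simp
      then show ?thesis using step[of j] unfolding right_diff_distrib add.commute[of j] by linarith
    qed
    then have "\<omega> x n - 0 \<le> c * real n powr (- \<beta> x)"
      by (intro tendsto_upperbound[OF tendsto_diff[OF tendsto_const LIMSEQ_ignore_initial_segment[OF lim, of n]]])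
        auto
    then have "real n powr \<beta> x * \<omega> x n \<le> real n powr \<beta> x * (c * real n powr (- \<beta> x))"
      by (intro mult_left_mono) auto
    also have "\<dots> = c * (real n powr \<beta> x * real n powr (- \<beta> x))" by simp
    also have "real n powr \<beta> x * real n powr (- \<beta> x) = 1" unfolding powr_add[symmetric] using n by simp
    finally show ?thesis by simp
  qed
  show ?thesis
    unfolding c unfolding A_env_def using main c1 by (auto intro!: SUP_least)
qed

lemma A_env_le_B_env:
  assumes "environment \<omega>" "1 \<le> \<beta> x" "B_env \<omega> \<beta> x < \<infinity>"
  shows "A_env \<omega> \<beta> x \<le> B_env \<omega> \<beta> x"
  using A_env_le_A'_env[of \<omega> \<beta> x] assms by (auto simp: B_env_def split: if_splits)

lemma tail_seq_environment:
  assumes env: "environment \<omega>" and \<beta>: "\<And>x. 1 < \<beta> x" "2 < beta_star \<beta>" and fin: "A_env \<omega> \<beta> x < \<infinity>"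
  shows "tail_seq (\<omega> x) (real_of_ereal (A_env \<omega> \<beta> x)) (beta_star \<beta>)"
proof -
  define a where "a = real_of_ereal (A_env \<omega> \<beta> x)"
  have ge1: "1 \<le> A_env \<omega> \<beta> x" by (simp add: A_env_def)
  then have a: "A_env \<omega> \<beta> x = ereal a"
    using fin unfolding a_def by (cases "A_env \<omega> \<beta> x") auto
  have a1: "1 \<le> a" using ge1 by (simp add: a)
  have b: "beta_star \<beta> \<le> \<beta> x"
    unfolding beta_star_def using \<beta>(1) by (intro cINF_lower bdd_belowI[of _ 1]) (auto simp: less_imp_le)
  have le: "\<omega> x n \<le> a * real n powr (- beta_star \<beta>)" if n: "1 \<le> n" for n
  proof -
    have "ereal (real n powr \<beta> x * \<omega> x n) \<le> (SUP n\<in>{1..}. ereal (real n powr \<beta> x * \<omega> x n))"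
      by (rule SUP_upper) (use n in auto)
    also have "\<dots> \<le> ereal a" unfolding a[symmetric] A_env_def by simp
    finally have "real n powr \<beta> x * \<omega> x n \<le> a" by simp
    then have "real n powr (- \<beta> x) * (real n powr \<beta> x * \<omega> x n) \<le> real n powr (- \<beta> x) * a"
      by (rule mult_left_mono) auto
    moreover have "real n powr (- \<beta> x) * real n powr \<beta> x = 1" unfolding powr_add[symmetric] using n by simp
    ultimately have "\<omega> x n \<le> real n powr (- \<beta> x) * a" by (metis mult.assoc mult_1)
    also have "\<dots> \<le> real n powr (- beta_star \<beta>) * a"
      using n b a1 by (intro mult_right_mono powr_mono) auto
    finally show ?thesis by (simp add: mult.commute)
  qed
  have pos: "0 < \<omega> x n" for n using env by (cases n) (auto simp: environment_def)
  show ?thesis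
    unfolding a_def[symmetric] using env le a1 \<beta>(2) pos by unfold_locales (auto simp: environment_def)
qed

section \<open>Asymptotic hypotheses as explicit bounds\<close>

lemma bigO_average:
  assumes "bigO_from_1 (\<lambda>x. 1 / real x * (\<Sum>w<x. f w)) (\<lambda>_. 1)"
  obtains C where "\<And>x. (\<Sum>w<x. f w) \<le> C * real x"
proof -
  obtain C where C: "\<And>x. 1 \<le> x \<Longrightarrow> \<bar>1 / real x * (\<Sum>w<x. f w)\<bar> \<le> C * 1"
    using assms unfolding bigO_from_1_def by blast
  have "(\<Sum>w<x. f w) \<le> C * real x" for x
  proof (cases "x = 0")
    case False
    then have "1 / real x * (\<Sum>w<x. f w) \<le> C" using C[of x] unfolding abs_le_iff by auto
    then show ?thesis using False by (simp add: divide_le_eq)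
  qed simp
  then show thesis by (rule that)
qed

lemma smallo_average:
  assumes "(\<lambda>x. 1 / real x * f x - c) \<in> o(\<lambda>x. real x powr (- \<eta>) * ln (real x) powr (- 1 / 2))" "0 < \<epsilon>"
  shows "\<forall>\<^sub>F x in sequentially. \<bar>f x - c * real x\<bar> \<le> \<epsilon> * real x powr (1 - \<eta>)"
proof -
  have "\<forall>\<^sub>F x in sequentially. exp 1 \<le> real x"
    using filterlim_real_sequentially unfolding filterlim_at_top by blast
  with landau_o.smallD[OF assms] show ?thesis
  proof eventually_elim
    case (elim x)
    have x: "1 \<le> real x" using elim(2) exp_ge_add_one_self[of 1] by linarith
    then have "1 \<le> ln (real x)" using elim(2) by (simp add: ln_ge_iff)
    then have "ln (real x) powr (- 1 / 2) \<le> ln (real x) powr 0" by (intro powr_mono) auto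
    then have "\<epsilon> * (real x powr (- \<eta>) * ln (real x) powr (- 1 / 2)) \<le> \<epsilon> * (real x powr (- \<eta>) * 1)"
      using \<open>1 \<le> ln (real x)\<close> assms(2) by (intro mult_left_mono) auto
    then have "\<bar>1 / real x * f x - c\<bar> \<le> \<epsilon> * real x powr (- \<eta>)" using elim(1) by simp
    then have "real x * \<bar>1 / real x * f x - c\<bar> \<le> real x * (\<epsilon> * real x powr (- \<eta>))"
      by (intro mult_left_mono) auto
    moreover have "real x * \<bar>1 / real x * f x - c\<bar> = \<bar>real x * (1 / real x * f x - c)\<bar>"
      by (simp add: abs_mult)
    moreover have "real x * (1 / real x * f x - c) = f x - c * real x" using x by (simp add: field_simps)
    moreover have "real x * (\<epsilon> * real x powr (- \<eta>)) = \<epsilon> * real x powr (1 - \<eta>)"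
      using x powr_add[of "real x" 1 "- \<eta>"] by simp
    ultimately show ?case by simp
  qed
qed

theorem theorem2p5:
  fixes \<omega> :: "nat \<Rightarrow> nat \<Rightarrow> real"
    and \<beta> :: "nat \<Rightarrow> real"
    and P :: "'s measure"
    and Z :: "nat \<Rightarrow> 's \<Rightarrow> nat \<times> nat"
    and \<epsilon> \<eta> \<mu> \<sigma>2 \<sigma>t2 :: real
  assumes env: "environment \<omega>"
    and chain: "env_chain \<omega> P Z"
    and beta: "\<And>x. \<beta> x > 1" "beta_star \<beta> > 2"
    and A_finite: "\<And>x. A_env \<omega> \<beta> x < \<infinity>"
    and eps: "\<epsilon> > 0"
    and eta: "0 \<le> \<eta>" "\<eta> < min (1/2) ((beta_star \<beta> - 2) / 2)"
    and B1_consts: "\<mu> > 1" "\<sigma>2 > 0"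
    and B1_mean:
      "(\<lambda>x. 1 / real x * (\<Sum>w<x. m_env \<omega> w) - \<mu>)
         \<in> o(\<lambda>x. real x powr (-\<eta>) * ln (real x) powr (-1/2))"
    and B1_var:
      "(\<lambda>x. 1 / real x * sigma2_env \<omega> x - \<sigma>2)
         \<in> o(\<lambda>x. real x powr (-\<eta>) * ln (real x) powr (-1/2))"
    and B2_A: "bigO_from_1 (\<lambda>x. real_of_ereal (A_env \<omega> \<beta> x)) (\<lambda>x. real x powr \<eta>)"
    and B2_B_finite: "\<And>w. B_env \<omega> \<beta> w < \<infinity>"
    and B2_B:
      "bigO_from_1 (\<lambda>x. 1 / real x * (\<Sum>w<x. real_of_ereal (B_env \<omega> \<beta> w) powr (3 + \<epsilon>))) (\<lambda>_. 1)"
    and B3: "\<And>u. u > 0 \<Longrightarrow> (\<lambda>x. L_env \<omega> \<mu> x u) \<in> o(\<lambda>x. real x powr (1/2 - \<eta>))"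
    and B4: "bigO_from_1 (\<lambda>x. 1 / real x * (\<Sum>w<x. K_env \<omega> w)) (\<lambda>_. 1)"
    and sigma_tilde: "\<sigma>t2 = \<sigma>2 / \<mu> ^ 3"
  shows "\<forall>\<delta>>0. \<forall>\<^sub>F n in sequentially. \<forall>x.
           \<bar>\<P>(s in P. fst (Z n s) = x)
              - 1 / \<mu> * (\<Sum>l=1..n. normal_density (real (M_env \<omega> l)) (sqrt (real l * \<sigma>t2)) (real x)
                                      * \<omega> x (n - l))\<bar>
           \<le> \<delta> * real n powr (-1/2)"
proof -
  define a where "a w = real_of_ereal (A_env \<omega> \<beta> w)" for w
  define b where "b = beta_star \<beta>"
  interpret tail_env \<omega> a b
    unfolding a_def b_def using tail_seq_environment[OF env beta A_finite] by (rule tail_env.intro)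
  have a_ge: "1 \<le> a w" for w by (rule tail_seq.a_ge[OF tail])
  obtain C1 where C1: "\<And>x. 1 \<le> x \<Longrightarrow> \<bar>a x\<bar> \<le> C1 * real x powr \<eta>"
    using B2_A unfolding bigO_from_1_def a_def by blast
  obtain C2 where C2: "\<And>x. (\<Sum>w<x. real_of_ereal (B_env \<omega> \<beta> w) powr (3 + \<epsilon>)) \<le> C2 * real x"
    using B2_B by (rule bigO_average) blast
  obtain C3 where C3: "\<And>x. (\<Sum>w<x. K_env \<omega> w) \<le> C3 * real x"
    using B4 by (rule bigO_average) blast
  \<comment> \<open>The value \<open>a 0\<close> enters because (B2) bounds \<open>A_env\<close> for
    \<open>x \<ge> 1\<close> only.\<close>
  define C where "C = max (max 1 (a 0)) (max C1 (max C2 C3))"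
  have C: "1 \<le> C" "a 0 \<le> C" "C1 \<le> C" "C2 \<le> C" "C3 \<le> C" by (auto simp: C_def)
  have growth: "a x \<le> C * real (x + 1) powr \<eta>" for x
  proof (cases "x = 0")
    case False
    have "a x \<le> C1 * real x powr \<eta>" using C1[of x] False by simp
    also have "\<dots> \<le> C * real (x + 1) powr \<eta>"
      using C eta by (intro mult_mono powr_mono2) auto
    finally show ?thesis .
  qed (use C in simp)
  have cube: "(\<Sum>w<x. a w ^ 3) \<le> C * real x" for x
  proof -
    have "a w ^ 3 \<le> real_of_ereal (B_env \<omega> \<beta> w) powr (3 + \<epsilon>)" for w
    proof -
      have "A_env \<omega> \<beta> w \<le> B_env \<omega> \<beta> w"
        using env beta(1)[of w] B2_B_finite by (intro A_env_le_B_env) auto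
      then have le: "a w \<le> real_of_ereal (B_env \<omega> \<beta> w)"
        unfolding a_def using B2_B_finite[of w] A_finite[of w] a_ge[of w]
        by (cases "A_env \<omega> \<beta> w"; cases "B_env \<omega> \<beta> w") (auto simp: a_def)
      have "a w ^ 3 = a w powr 3" using a_ge[of w] by simp
      also have "\<dots> \<le> a w powr (3 + \<epsilon>)" using a_ge[of w] eps by (intro powr_mono) auto
      also have "\<dots> \<le> real_of_ereal (B_env \<omega> \<beta> w) powr (3 + \<epsilon>)"
        using le a_ge[of w] eps by (intro powr_mono2) auto
      finally show ?thesis .
    qed
    then have "(\<Sum>w<x. a w ^ 3) \<le> C2 * real x" using C2[of x] by (meson order_trans sum_mono)
    also have "\<dots> \<le> C * real x" using C by (intro mult_right_mono) auto
    finally show ?thesis .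
  qed
  have K: "(\<Sum>w<x. K_env \<omega> w) \<le> C * real x" for x
    using C3[of x] C mult_right_mono[of C3 C "real x"] by simp
  have mu_eq: "mu x = (\<Sum>w<x. m_env \<omega> w)" for x by (simp add: mu_def mean_def m_env_def)
  have s2_eq: "s2 x = sigma2_env \<omega> x" for x by (simp add: s2_def var_def sigma2_env_def)
  \<comment> \<open>The midpoint of \<open>2 + 2 * \<eta>\<close> and \<open>min 3 b\<close>, an
    interval that is nonempty by the two upper bounds on \<eta>.\<close>
  define p where "p = (2 + 2 * \<eta> + min 3 b) / 2"
  have p: "2 + 2 * \<eta> < p" "p \<le> 3" "p < b" using eta by (auto simp: p_def b_def min_def)
  interpret walk_env \<omega> a b C \<eta> p \<mu> \<sigma>2
  proof unfold_locales
    show "\<forall>\<^sub>F x in sequentially. \<bar>mu x - \<mu> * real x\<bar> \<le> e * real x powr (1 - \<eta>)" if "0 < e" for e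
      unfolding mu_eq using B1_mean that by (rule smallo_average)
    show "\<forall>\<^sub>F x in sequentially. \<bar>s2 x - \<sigma>2 * real x\<bar> \<le> e * real x powr (1 - \<eta>)" if "0 < e" for e
      unfolding s2_eq using B1_var that by (rule smallo_average)
    show "\<forall>\<^sub>F x in sequentially. \<bar>L_env \<omega> \<mu> x u\<bar> \<le> e * real x powr (1 / 2 - \<eta>)" if "0 < u" "0 < e" for u e
      using landau_o.smallD[OF B3[OF that(1)] that(2)] by simp
  qed (use eta p C growth cube K B1_consts in auto)
  show ?thesis
    using hitting_sum_asymp
    by (simp add: env_chain_fst_prob[OF chain env] site_density_def sigma_tilde)
qed

end
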